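(* Let $d\ge 1$ and let $X=(X_t)_{t\in\mathbb{R}_+^d}$ be a $d$-parameter Lévy field with jump measure $J_X$ and characteristic triplet $(\gamma,\sigma,\nu)$, and let $\dot X$ be the associated Lévy white noise. Let $\Omega_{\dot X}=\{\omega\in\Omega:\dot X(\omega)\in\mathcal{S}'(\mathbb{R}^d)\}$. Then: (i) If there exists $\eta>0$ such that $\mathbb{E}(|X_{\mathbf 1_d}|^\eta)<+\infty$, then $\mathbb{P}(\Omega_{\dot X})=1$. (ii) If $\mathbb{E}(|X_{\mathbf 1_d}|^\eta)=+\infty$ for all $\eta>0$, then $\mathbb{P}(\Omega_{\dot X})=0$.
   Context: $(\Omega,\mathcal F,\mathbb P)$ is a complete probability space. $\mathbf 1_d=(1,\dots,1)\in\mathbb{R}^d$. For $s,t\in\mathbb{R}^d_+$, $s\le t$ (resp. $s<t$) means $s_i\le t_i$ (resp. $s_i<t_i$) for all $i$. For $a\le b$ in $\mathbb{R}_+^d$, $]a,b]=\{t: a<t\le b\}$, and $\Delta_a^bX=\sum_{\varepsilon\in\{0,1\}^d}(-1)^{|\varepsilon|}X_{c_\varepsilon(a,b)}$, where $|\varepsilon|=\sum_i\varepsilon_i$, $c_\varepsilon(a,b)_i=a_i$ if $\varepsilon_i=1$ and $b_i$ if $\varepsilon_i=0$. Lamp: for each of the $2^d$ relations $\mathcal R=(\mathcal R_1,\dots,\mathcal R_d)$ with $\mathcal R_i\in\{\le,>\}$, write $a\,\mathcal R\,b$ iff $a_i\mathcal R_ib_i$ for all $i$. A field $X$ is lamp if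 (a) for all $\mathcal R$ and $t$, $\lim_{u\to t,\,t\mathcal R u}X_u$ exists; (b) for $\mathcal R=(\le,\dots,\le)$ this limit equals $X_t$; (c) $X_t=0$ if $t_i=0$ for some $i$. A $d$-parameter Lévy field is a real-valued random field $X=(X_t)_{t\in\mathbb{R}_+^d}$ that is almost surely lamp, is continuous in probability, has independent increments $\Delta_{a_k}^{b_k}X$ over disjoint boxes $]a_k,b_k]$, and has identically distributed increments over boxes that are translates of each other. Its jump at $t$ is $\Delta_tX=\lim_{u\to t,u<t}\Delta_u^tX$, and $J_X(B)=\#\{(t,\Delta_tX)\in B\}$ for Borel $B\subset\mathbb{R}_+^d\times(\mathbb{R}\setminus\{0\})$. Its characteristic triplet $(\gamma,\sigma,\nu)$ (with $\gamma,\sigma\in\mathbb{R}$, $\nu$ a Lévy measure) is determined by $\mathbb{E}(e^{iuX_t})=\exp\big(\mathrm{Leb}_d([0,t])\,[iu\gamma-\tfrac12\sigma^2u^2+\int_{\mathbb{R}}(e^{iux}-1-iux\mathbf 1_{|x|\le1})\nu(dx)]\big)$ for all $t\in\mathbb{R}_+^d$, $u\in\mathbb{R}$. The Lévy white noise $\dot X$ is the distribution in $\mathcal D'(\mathbb{R}^d)$ given by $\langle\dot X(\omega),\varphi\rangle=(-1)^d\int_{\mathbb{R}_+^d}X_t(\omega)\,\frac{\partial^d\varphi}{\partial t_1\cdots\partial t_d}(t)\,dt$ for $\varphi\in\mathcal D(\mathbb{R}^d)$ (smooth, compactly supported). $\mathcal S(\mathbb{R}^d)$ is the Schwartz space of real-valued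 functions and $\mathcal S'(\mathbb{R}^d)$ the space of tempered distributions; an element of $\mathcal D'(\mathbb{R}^d)$ belongs to $\mathcal S'(\mathbb{R}^d)$ if it extends to a continuous linear functional on $\mathcal S(\mathbb{R}^d)$. *)

theory Defs
  imports "HOL-Probability.Probability"
begin

section \<open>Test functions, Schwartz functions and distributions\<close>

definition partial_deriv :: "'n::finite \<Rightarrow> (real^'n \<Rightarrow> real) \<Rightarrow> real^'n \<Rightarrow> real" where
  "partial_deriv i f x = frechet_derivative f (at x) (axis i 1)"

text \<open>A list of coordinate directions plays the role of a multi-index; for smooth functions the
  order of its entries is irrelevant.\<close>

fun iter_partial :: "'n::finite list \<Rightarrow> (real^'n \<Rightarrow> real) \<Rightarrow> real^'n \<Rightarrow> real" where
  "iter_partial [] f = f"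
| "iter_partial (i # is) f = partial_deriv i (iter_partial is f)"

definition smooth :: "(real^'n::finite \<Rightarrow> real) \<Rightarrow> bool" where
  "smooth f \<longleftrightarrow> (\<forall>is x. iter_partial is f differentiable (at x))"

text \<open>The derivative \<open>\<partial>\<^sup>d f / \<partial>t\<^sub>1 \<dots> \<partial>t\<^sub>d\<close>. The index type carries no order, so some enumeration of
  the coordinates is chosen; for smooth \<open>f\<close> the result does not depend on it.\<close>

definition mixed_partial :: "(real^'n::finite \<Rightarrow> real) \<Rightarrow> real^'n \<Rightarrow> real" where
  "mixed_partial f = iter_partial (SOME is. distinct is \<and> set is = UNIV) f"

definition test_functions :: "(real^'n::finite \<Rightarrow> real) set" where
  "test_functions = {f. smooth f \<and> compact (closure {x. f x \<noteq> 0})}"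

definition schwartz_space :: "(real^'n::finite \<Rightarrow> real) set" where
  "schwartz_space =
     {f. smooth f \<and> (\<forall>k is. bounded (range (\<lambda>x. (1 + norm x) ^ k * iter_partial is f x)))}"

definition schwartz_seminorm :: "nat \<Rightarrow> 'n::finite list \<Rightarrow> (real^'n \<Rightarrow> real) \<Rightarrow> real" where
  "schwartz_seminorm k is f = (SUP x. (1 + norm x) ^ k * \<bar>iter_partial is f x\<bar>)"

text \<open>The locally convex topology that a family \<open>P\<close> of seminorms induces on a space \<open>V\<close> of functions.\<close>

definition seminorm_topology ::
    "('b \<Rightarrow> real) set \<Rightarrow> (('b \<Rightarrow> real) \<Rightarrow> real) set \<Rightarrow> ('b \<Rightarrow> real) topology" where
  "seminorm_topology V P = topology_generated_by
     {{g \<in> V. p (\<lambda>x. g x - f x) < e} | p f e. p \<in> P \<and> f \<in> V \<and> 0 < e}"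

definition schwartz_topology :: "(real^'n::finite \<Rightarrow> real) topology" where
  "schwartz_topology =
     seminorm_topology schwartz_space {schwartz_seminorm k is | k is. True}"

text \<open>The topology of uniform convergence of all derivatives on the test functions supported in \<open>K\<close>.\<close>

definition test_topology :: "(real^'n::finite) set \<Rightarrow> (real^'n \<Rightarrow> real) topology" where
  "test_topology K =
     seminorm_topology {f \<in> test_functions. closure {x. f x \<noteq> 0} \<subseteq> K}
       {schwartz_seminorm 0 is | is. True}"

definition linear_functional_on :: "('b \<Rightarrow> real) set \<Rightarrow> (('b \<Rightarrow> real) \<Rightarrow> real) \<Rightarrow> bool" where
  "linear_functional_on V T \<longleftrightarrow>
     (\<forall>f\<in>V. \<forall>g\<in>V. \<forall>a b. T (\<lambda>x. a * f x + b * g x) = a * T f + b * T g)"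

text \<open>A functional is represented by a function on all of \<^typ>\<open>real^'n \<Rightarrow> real\<close>, of which only the
  values on test functions matter. Continuity for the inductive limit topology on the space of test
  functions is continuity on the test functions supported in \<open>K\<close>, for every compact \<open>K\<close>.\<close>

definition distributions :: "((real^'n::finite \<Rightarrow> real) \<Rightarrow> real) set" where
  "distributions =
     {T. linear_functional_on test_functions T \<and>
         (\<forall>K. compact K \<longrightarrow> continuous_map (test_topology K) euclideanreal T)}"

definition tempered_distributions :: "((real^'n::finite \<Rightarrow> real) \<Rightarrow> real) set" where
  "tempered_distributions =
     {T \<in> distributions. \<exists>L. linear_functional_on schwartz_space L \<and>
         continuous_map schwartz_topology euclideanreal L \<and>
         (\<forall>f\<in>test_functions. L f = T f)}"


section \<open>Lamp paths, increments and jumps\<close>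

text \<open>The order \<open>\<le>\<close> on \<^typ>\<open>real^'n\<close> is componentwise, but the library's \<open><\<close> is not the
  componentwise strict order; the latter is therefore written out below. Paths are functions on
  \<^typ>\<open>real^'n\<close> of which only the values on the orthant matter.\<close>

abbreviation orthant :: "(real^'n::finite) set" where
  "orthant \<equiv> {t. 0 \<le> t}"

definition half_open_box :: "real^'n::finite \<Rightarrow> real^'n \<Rightarrow> (real^'n) set" where
  "half_open_box a b = {t. \<forall>i. a $ i < t $ i \<and> t $ i \<le> b $ i}"

text \<open>The set \<open>E\<close> stands for the \<open>\<epsilon> \<in> {0,1}\<^sup>d\<close> with \<open>\<epsilon>\<^sub>i = 1\<close> iff \<open>i \<in> E\<close>.\<close>

definition increment :: "(real^'n::finite \<Rightarrow> real) \<Rightarrow> real^'n \<Rightarrow> real^'n \<Rightarrow> real" where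
  "increment x a b =
     (\<Sum>E\<in>UNIV. (-1) ^ card E * x (\<chi> i. if i \<in> E then a $ i else b $ i))"

text \<open>The set \<open>R\<close> stands for the relation with \<open>\<R>\<^sub>i\<close> equal to \<open>\<le>\<close> for \<open>i \<in> R\<close> and to \<open>>\<close>
  otherwise; the set below consists of the \<open>u\<close> with \<open>t \<R> u\<close>.\<close>

definition quadrant :: "'n set \<Rightarrow> real^'n::finite \<Rightarrow> (real^'n) set" where
  "quadrant R t = {u \<in> orthant. \<forall>i. if i \<in> R then t $ i \<le> u $ i else t $ i > u $ i}"

definition lamp :: "(real^'n::finite \<Rightarrow> real) \<Rightarrow> bool" where
  "lamp x \<longleftrightarrow>
     (\<forall>R. \<forall>t\<in>orthant. \<exists>l. (x \<longlongrightarrow> l) (at t within quadrant R t)) \<and>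
     (\<forall>t\<in>orthant. (x \<longlongrightarrow> x t) (at t within quadrant UNIV t)) \<and>
     (\<forall>t\<in>orthant. (\<exists>i. t $ i = 0) \<longrightarrow> x t = 0)"

text \<open>If some \<open>t\<^sub>i = 0\<close>, there is no \<open>u\<close> in the orthant with \<open>u < t\<close>, and hence no jump at \<open>t\<close>.\<close>

definition jump :: "(real^'n::finite \<Rightarrow> real) \<Rightarrow> real^'n \<Rightarrow> real" where
  "jump x t = (if \<exists>i. t $ i = 0 then 0
     else Lim (at t within {u \<in> orthant. \<forall>i. u $ i < t $ i}) (\<lambda>u. increment x u t))"

text \<open>The measure that maps \<open>B\<close> to the number of \<open>t\<close> such that \<open>(t, jump x t) \<in> B\<close> and
  \<open>jump x t \<noteq> 0\<close>.\<close>

definition jump_measure :: "(real^'n::finite \<Rightarrow> real) \<Rightarrow> ((real^'n) \<times> real) measure" where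
  "jump_measure x =
     distr (count_space {t \<in> orthant. jump x t \<noteq> 0}) borel (\<lambda>t. (t, jump x t))"


section \<open>Levy fields and Levy white noise\<close>

locale levy_field = prob_space M
  for M :: "'a measure" +
  fixes X :: "real^'n::finite \<Rightarrow> 'a \<Rightarrow> real"
  assumes random_field: "\<And>t. t \<in> orthant \<Longrightarrow> X t \<in> borel_measurable M"
    and AE_lamp: "AE \<omega> in M. lamp (\<lambda>t. X t \<omega>)"
    and continuous_in_probability:
      "\<And>t e. t \<in> orthant \<Longrightarrow> 0 < e \<Longrightarrow>
         ((\<lambda>s. prob {\<omega> \<in> space M. \<bar>X s \<omega> - X t \<omega>\<bar> > e}) \<longlongrightarrow> 0) (at t within orthant)"
    and independent_increments:
      "\<And>(m::nat) a b. (\<And>k. k < m \<Longrightarrow> 0 \<le> a k \<and> a k \<le> b k) \<Longrightarrow>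
         disjoint_family_on (\<lambda>k. half_open_box (a k) (b k)) {..<m} \<Longrightarrow>
         indep_vars (\<lambda>_. borel) (\<lambda>k \<omega>. increment (\<lambda>t. X t \<omega>) (a k) (b k)) {..<m}"
    and stationary_increments:
      "\<And>a b h. 0 \<le> a \<Longrightarrow> a \<le> b \<Longrightarrow> 0 \<le> a + h \<Longrightarrow>
         distr M borel (\<lambda>\<omega>. increment (\<lambda>t. X t \<omega>) (a + h) (b + h)) =
         distr M borel (\<lambda>\<omega>. increment (\<lambda>t. X t \<omega>) a b)"

definition levy_measure :: "real measure \<Rightarrow> bool" where
  "levy_measure \<nu> \<longleftrightarrow> sets \<nu> = sets borel \<and> emeasure \<nu> {0} = 0 \<and>
     (\<integral>\<^sup>+ x. ennreal (min 1 (x\<^sup>2)) \<partial>\<nu>) < \<infinity>"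

definition characteristic_triplet ::
    "'a measure \<Rightarrow> (real^'n::finite \<Rightarrow> 'a \<Rightarrow> real) \<Rightarrow> real \<Rightarrow> real \<Rightarrow> real measure \<Rightarrow> bool" where
  "characteristic_triplet M X \<gamma> \<sigma> \<nu> \<longleftrightarrow> levy_measure \<nu> \<and>
     (\<forall>t\<in>orthant. \<forall>u::real.
        (LINT \<omega>|M. exp (\<i> * complex_of_real (u * X t \<omega>))) =
        exp (complex_of_real (measure lborel {0..t}) *
          (\<i> * complex_of_real (u * \<gamma>) - complex_of_real (\<sigma>\<^sup>2 * u\<^sup>2 / 2) +
           (LINT x|\<nu>. exp (\<i> * complex_of_real (u * x)) - 1 -
              \<i> * complex_of_real (u * x * indicator {-1..1} x)))))"

definition white_noise :: "(real^'n::finite \<Rightarrow> real) \<Rightarrow> (real^'n \<Rightarrow> real) \<Rightarrow> real" where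
  "white_noise x \<phi> = (-1) ^ CARD('n) * (LINT t:orthant|lborel. x t * mixed_partial \<phi> t)"

definition tempered_event :: "'a measure \<Rightarrow> (real^'n::finite \<Rightarrow> 'a \<Rightarrow> real) \<Rightarrow> 'a set" where
  "tempered_event M X = {\<omega> \<in> space M. white_noise (\<lambda>t. X t \<omega>) \<in> tempered_distributions}"

end

theory Submission
  imports Defs "HOL-Computational_Algebra.Polynomial"
begin

text \<open>Both halves rest on one observation about cells: over a grid, the increments of the field over
the cells are independent, and the increment over any box composed of cells is the sum of its cells
(\<open>indep_cells\<close>, \<open>increment_eq_sum_cells\<close>).

Suppose that \<open>X\<close> at \<open>(1, \<dots>, 1)\<close> has a moment of some order \<open>\<eta> > 0\<close>. A path of polynomial growth
defines a tempered distribution, because the white noise integrates the path against a mixed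
derivative of the test function, which decays faster than any polynomial
(\<open>slowly_growing_path.white_noise_tempered\<close>). So it suffices that almost every path grows at most
polynomially. Etemadi's inequality, applied to one coordinate after the other, bounds the
distribution of the maximum of the partial sums of independent cell variables by the largest tail of
a single partial sum, with no moment needed (\<open>maximal_inequality_partial_sums\<close>). The tail of a
single value of the field in the cube of side \<open>N\<close> is controlled by \<open>2 N\<^sup>d\<close> times the tail of the
field at \<open>(1, \<dots>, 1)\<close> (\<open>tail_unit_cube\<close>, \<open>tail_cube\<close>). Markov's inequality at a level that is a high
power of \<open>N\<close> makes the resulting bounds summable, and the Borel-Cantelli lemma gives polynomial
growth (\<open>AE_polynomial_growth\<close>).

Suppose that there is no moment of positive order. Take a test function whose mixed derivative is a
signed sum of translates of one nonnegative bump, and translate it along the diagonal by \<open>3 m\<close>. The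
pairing of the noise with the translate is an average of increments over boxes that all contain one
and the same unit cube and avoid the unit cubes that belong to other \<open>m\<close> (\<open>white_noise_probe\<close>,
\<open>probe_coeff_core\<close>). Up to a constant it is therefore \<open>A\<^sub>m + Z\<^sub>m\<close> with independent \<open>A\<^sub>m\<close>,
distributed like the field at \<open>(1, \<dots>, 1)\<close>, and a sequence \<open>Z\<close> that is independent of all of them.
If the noise were tempered, these pairings would grow at most polynomially in \<open>m\<close>
(\<open>tempered_probe_growth\<close>). But an independent summand cannot make a variable with heavy tails small:
whatever \<open>z\<close> is, \<open>\<bar>A + z\<bar> < K\<close> has probability at most \<open>1/2\<close> or at most \<open>P(\<bar>A\<bar> < 2 K + c)\<close>
(\<open>prob_shift_le\<close>). As the tails of the field along any polynomial sequence of levels have a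
divergent sum (\<open>not_summable_tail\<close>), the probability that all pairings stay below polynomial levels
is an infinite product that vanishes (\<open>AE_not_tempered\<close>).\<close>


section \<open>Increments and their additivity over grids\<close>

lemma sum_UNIV_pair:
  fixes h :: "'n::finite set \<Rightarrow> 'b::comm_monoid_add"
  shows "(\<Sum>E\<in>UNIV. h E) = (\<Sum>E\<in>{E. i \<notin> E}. h E + h (insert i E))"
proof -
  have inj: "inj_on (insert i) {E. i \<notin> E}"
    by (auto simp: inj_on_def)
  have "UNIV = {E. i \<notin> E} \<union> insert i ` {E. i \<notin> E}"
  proof (intro set_eqI iffI UNIV_I)
    fix E
    show "E \<in> {E. i \<notin> E} \<union> insert i ` {E. i \<notin> E}"
    proof (cases "i \<in> E")
      case True
      then have "E = insert i (E - {i})" by auto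
      then show ?thesis by (metis UnI2 imageI mem_Collect_eq Diff_iff singletonI)
    qed simp
  qed
  then have "(\<Sum>E\<in>UNIV. h E) = (\<Sum>E\<in>{E. i \<notin> E} \<union> insert i ` {E. i \<notin> E}. h E)" by simp
  also have "\<dots> = (\<Sum>E\<in>{E. i \<notin> E}. h E) + (\<Sum>E\<in>insert i ` {E. i \<notin> E}. h E)"
    by (rule sum.union_disjoint) auto
  also have "\<dots> = (\<Sum>E\<in>{E. i \<notin> E}. h E + h (insert i E))"
    by (simp add: sum.reindex[OF inj] sum.distrib)
  finally show ?thesis .
qed

definition corner :: "'n::finite set \<Rightarrow> real^'n \<Rightarrow> real^'n \<Rightarrow> real^'n" where
  "corner E a b = (\<chi> i. if i \<in> E then a $ i else b $ i)"

lemma increment_corner: "increment x a b = (\<Sum>E\<in>UNIV. (-1) ^ card E * x (corner E a b))"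
  by (simp add: increment_def corner_def)

definition set_coord :: "real^'n::finite \<Rightarrow> 'n \<Rightarrow> real \<Rightarrow> real^'n" where
  "set_coord a i c = (\<chi> j. if j = i then c else a $ j)"

text \<open>An increment is a signed sum, over the choices of a corner in the other coordinates, of differences in
the coordinate \<open>i\<close>. In this form additivity in that coordinate and the vanishing over degenerate boxes
are immediate.\<close>

lemma increment_one_coordinate:
  "increment x a b = (\<Sum>E\<in>{E. i \<notin> E}. (-1) ^ card E *
     (x (set_coord (corner E a b) i (b $ i)) - x (set_coord (corner E a b) i (a $ i))))"
proof -
  have "x (corner E a b) = x (set_coord (corner E a b) i (b $ i))"
    "x (corner (insert i E) a b) = x (set_coord (corner E a b) i (a $ i))" if "i \<notin> E" for E
    using that by (auto intro!: arg_cong[where f=x] simp: corner_def set_coord_def vec_eq_iff)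
  then show ?thesis
    unfolding increment_corner sum_UNIV_pair[where i=i]
    by (intro sum.cong) (auto simp: algebra_simps card_insert_if)
qed

lemma increment_split:
  "increment x a b = increment x a (set_coord b i c) + increment x (set_coord a i c) b"
proof -
  have *: "set_coord (corner E a (set_coord b i c)) i z = set_coord (corner E a b) i z"
    "set_coord (corner E (set_coord a i c) b) i z = set_coord (corner E a b) i z" for E z
    by (auto simp: corner_def set_coord_def vec_eq_iff)
  have "set_coord b i c $ i = c" "set_coord a i c $ i = c" by (auto simp: set_coord_def)
  then show ?thesis
    unfolding increment_one_coordinate[of x _ _ i] * sum.distrib[symmetric]
    by (simp add: algebra_simps)
qed

lemma increment_degenerate:
  assumes "a $ i = b $ i"
  shows "increment x a b = 0"
  unfolding increment_one_coordinate[of x a b i] assms by simp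

definition index_box :: "('n::finite \<Rightarrow> nat) \<Rightarrow> ('n \<Rightarrow> nat) \<Rightarrow> ('n \<Rightarrow> nat) set" where
  "index_box l u = {k. \<forall>i. l i \<le> k i \<and> k i < u i}"

text \<open>The spacing of a grid may vary along each coordinate, and differ from one coordinate to another.
Besides the dyadic grids, the partition \<open>0, s\<^sub>i, 1\<close> and the partition of \<open>[0, t\<^sub>i]\<close> at the integers occur.\<close>

definition grid_point :: "('n::finite \<Rightarrow> nat \<Rightarrow> real) \<Rightarrow> ('n \<Rightarrow> nat) \<Rightarrow> real^'n" where
  "grid_point c k = (\<chi> i. c i (k i))"

definition cell_increment ::
    "('n::finite \<Rightarrow> nat \<Rightarrow> real) \<Rightarrow> (real^'n \<Rightarrow> real) \<Rightarrow> ('n \<Rightarrow> nat) \<Rightarrow> real" where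
  "cell_increment c x k = increment x (grid_point c k) (grid_point c (\<lambda>i. Suc (k i)))"

lemma finite_index_box [simp]: "finite (index_box l u)"
proof -
  have "index_box l u \<subseteq> PiE UNIV (\<lambda>i. {..<u i})" by (auto simp: index_box_def)
  then show ?thesis by (rule finite_subset) (auto intro: finite_PiE)
qed

text \<open>Induction on the total number of layers: a box with at least two layers in some coordinate is cut
below its top layer in that coordinate.\<close>

lemma increment_eq_sum_cells:
  assumes "\<And>i. l i \<le> u i"
  shows "increment x (grid_point c l) (grid_point c u) = (\<Sum>k\<in>index_box l u. cell_increment c x k)"
  using assms
proof (induction "\<Sum>i\<in>UNIV. u i - l i" arbitrary: l u rule: less_induct)
  case less
  consider (empty) i where "u i = l i" | (cell) "u = (\<lambda>i. Suc (l i))" | (split) i where "l i + 1 < u i"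
  proof (cases "\<exists>i. u i = l i \<or> l i + 1 < u i")
    case False
    have "u i = Suc (l i)" for i
      using False less.prems[of i] by (metis Suc_eq_plus1 Suc_lessI le_neq_implies_less)
    with that(2) show ?thesis by blast
  qed (use that in blast)
  then show ?case
  proof cases
    case (empty i)
    then have "index_box l u = {}"
      by (auto simp: index_box_def intro!: exI[of _ i])
    with empty show ?thesis by (simp add: increment_degenerate[of _ i] grid_point_def)
  next
    case cell
    have "index_box l u = {l}"
      unfolding cell index_box_def by (auto simp: less_Suc_eq_le intro!: ext order_antisym)
    with cell show ?thesis by (simp add: cell_increment_def)
  next
    case (split i)
    define m where "m = u i - 1"
    have m: "l i < m" "m < u i" using split by (auto simp: m_def)
    have gp: "set_coord (grid_point c k) i (c i m) = grid_point c (k(i := m))" for k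
      by (auto simp: set_coord_def grid_point_def vec_eq_iff)
    have "index_box l u = index_box l (u(i := m)) \<union> index_box (l(i := m)) u" (is "_ = ?L \<union> ?R")
    proof (intro set_eqI iffI)
      fix k assume k: "k \<in> index_box l u"
      show "k \<in> ?L \<union> ?R"
        using k by (cases "k i < m") (simp_all add: index_box_def)
    next
      fix k assume k: "k \<in> ?L \<union> ?R"
      have "l j \<le> k j \<and> k j < u j" for j
        using k m by (cases "j = i") (auto simp: index_box_def dest!: spec[of _ j])
      then show "k \<in> index_box l u" by (simp add: index_box_def)
    qed
    moreover have "index_box l (u(i := m)) \<inter> index_box (l(i := m)) u = {}"
      by (auto simp: index_box_def dest!: spec[of _ i])
    moreover have "(\<Sum>j\<in>UNIV. (u(i := m)) j - l j) < (\<Sum>j\<in>UNIV. u j - l j)"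
      "(\<Sum>j\<in>UNIV. u j - (l(i := m)) j) < (\<Sum>j\<in>UNIV. u j - l j)"
      using m by (auto intro!: sum_strict_mono_ex1 bexI[of _ i])
    then have "increment x (grid_point c l) (grid_point c (u(i := m))) =
        (\<Sum>k\<in>index_box l (u(i := m)). cell_increment c x k)"
      "increment x (grid_point c (l(i := m))) (grid_point c u) =
        (\<Sum>k\<in>index_box (l(i := m)) u. cell_increment c x k)"
      using m less.prems by (auto intro!: less.hyps)
    ultimately show ?thesis
      by (subst increment_split[of x _ _ i "c i m"]) (simp add: gp sum.union_disjoint)
  qed
qed

text \<open>Every corner except \<open>t\<close> lies on a coordinate hyperplane, where a lamp path vanishes.\<close>

lemma increment_from_zero:
  assumes "lamp x" "t \<in> orthant"
  shows "increment x 0 t = x t"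
proof -
  have "x (corner E 0 t) = 0" if "E \<noteq> {}" for E
  proof -
    from that obtain i where "i \<in> E" by blast
    then have "corner E 0 t $ i = 0" "corner E 0 t \<in> orthant"
      using assms(2) by (auto simp: corner_def less_eq_vec_def)
    then show ?thesis using assms(1) unfolding lamp_def by blast
  qed
  then have "increment x 0 t = (\<Sum>E\<in>{{}}. (-1) ^ card E * x (corner E 0 t))"
    unfolding increment_corner by (intro sum.mono_neutral_right) auto
  also have "\<dots> = x t" by (simp add: corner_def)
  finally show ?thesis .
qed


section \<open>Lamp paths\<close>

abbreviation dyadic_grid :: "nat \<Rightarrow> 'n::finite \<Rightarrow> nat \<Rightarrow> real" where
  "dyadic_grid n \<equiv> \<lambda>i j. real j / 2 ^ n"

lemma dyadic_grid_props:
  "mono (dyadic_grid n i)" "0 \<le> dyadic_grid n i 0" "grid_point (dyadic_grid n) (\<lambda>_. 0) = 0"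
  "0 \<le> grid_point (dyadic_grid n) k"
proof -
  show "mono (dyadic_grid n i)"
    by (rule monoI, rule divide_right_mono) simp_all
qed (simp_all add: grid_point_def vec_eq_iff less_eq_vec_def)

text \<open>At level \<open>n\<close> these are the cells of the unit cube with lower corner \<open>3 m + 1\<close> in all coordinates,
the central unit cube of the \<open>m\<close>-th cube of side 3 on the diagonal.\<close>

abbreviation core_box :: "nat \<Rightarrow> nat \<Rightarrow> ('n::finite \<Rightarrow> nat) set" where
  "core_box n m \<equiv> index_box (\<lambda>_. (3 * m + 1) * 2 ^ n) (\<lambda>_. (3 * m + 2) * 2 ^ n)"

text \<open>The least dyadic point of level \<open>n\<close> that is strictly above \<open>t\<close> in every coordinate. Being strictly
above, also when \<open>t\<close> itself is dyadic, puts it into the quadrant in which lamp paths are continuous.\<close>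

definition dyadic_above :: "nat \<Rightarrow> real^'n::finite \<Rightarrow> real^'n" where
  "dyadic_above n t = (\<chi> i. (real_of_int \<lfloor>2 ^ n * t $ i\<rfloor> + 1) / 2 ^ n)"

lemma dyadic_above_bounds:
  "t $ i < dyadic_above n t $ i" "dyadic_above n t $ i \<le> t $ i + 1 / 2 ^ n"
proof -
  have "2 ^ n * t $ i < real_of_int \<lfloor>2 ^ n * t $ i\<rfloor> + 1" by linarith
  then show "t $ i < dyadic_above n t $ i" by (simp add: dyadic_above_def field_simps)
  have "real_of_int \<lfloor>2 ^ n * t $ i\<rfloor> \<le> 2 ^ n * t $ i" by linarith
  then show "dyadic_above n t $ i \<le> t $ i + 1 / 2 ^ n" by (simp add: dyadic_above_def field_simps)
qed

lemma dyadic_above_tendsto: "(\<lambda>n. dyadic_above n t) \<longlonglongrightarrow> t"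
proof (rule vec_tendstoI)
  fix i
  have "(\<lambda>n. t $ i + 1 / 2 ^ n) \<longlonglongrightarrow> t $ i + 0"
    by (intro tendsto_intros LIMSEQ_divide_realpow_zero) auto
  then have lim: "(\<lambda>n. t $ i + 1 / 2 ^ n) \<longlonglongrightarrow> t $ i" by simp
  show "(\<lambda>n. dyadic_above n t $ i) \<longlonglongrightarrow> t $ i"
  proof (rule tendsto_sandwich[OF _ _ tendsto_const lim])
    show "\<forall>\<^sub>F n in sequentially. t $ i \<le> dyadic_above n t $ i"
      using dyadic_above_bounds(1) less_imp_le by (intro always_eventually) blast
    show "\<forall>\<^sub>F n in sequentially. dyadic_above n t $ i \<le> t $ i + 1 / 2 ^ n"
      using dyadic_above_bounds(2) by (intro always_eventually) blast
  qed
qed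

lemma lamp_tendsto_above:
  assumes "lamp x" "t \<in> orthant" "u \<longlonglongrightarrow> t" "\<And>n i. t $ i < u n $ i"
  shows "(\<lambda>n. x (u n)) \<longlonglongrightarrow> x t"
proof -
  have lim: "(x \<longlongrightarrow> x t) (at t within quadrant UNIV t)"
    using assms(1,2) unfolding lamp_def by blast
  have "0 \<le> u n $ i" for n i
    using assms(2) assms(4)[of i n] by (auto simp: less_eq_vec_def intro: order_trans less_imp_le)
  moreover have "u n \<noteq> t" for n using assms(4)[of undefined n] by auto
  ultimately have "filterlim u (at t within quadrant UNIV t) sequentially"
    unfolding filterlim_at using assms(3,4)
    by (auto simp: quadrant_def less_eq_vec_def less_imp_le intro!: always_eventually)
  from filterlim_compose[OF lim this] show ?thesis .
qed

lemma orthant_borel: "orthant \<in> sets (borel :: (real^'n::finite) measure)"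
proof -
  have "closed {t::real^'n. \<forall>i. 0 \<le> t $ i}"
    by (intro closed_Collect_all closed_Collect_le continuous_intros)
  then show ?thesis by (auto simp: less_eq_vec_def)
qed

text \<open>The path is the pointwise limit of its values at the dyadic points above, and these approximations
take countably many values.\<close>

lemma lamp_path_measurable:
  fixes x :: "real^'n::finite \<Rightarrow> real"
  assumes "lamp x"
  shows "(\<lambda>t. indicator orthant t * x t) \<in> borel_measurable borel"
proof (rule borel_measurable_LIMSEQ_real)
  fix t :: "real^'n"
  show "(\<lambda>n. indicator orthant t * x (dyadic_above n t)) \<longlonglongrightarrow> indicator orthant t * x t"
  proof (cases "t \<in> orthant")
    case True
    show ?thesis
      by (intro tendsto_intros lamp_tendsto_above[OF assms True] dyadic_above_tendsto dyadic_above_bounds)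
  qed simp
next
  fix n
  let ?f = "\<lambda>t::real^'n. \<lambda>i. \<lfloor>2 ^ n * t $ i\<rfloor>"
  let ?g = "\<lambda>k::'n \<Rightarrow> int. x (\<chi> i. (real_of_int (k i) + 1) / 2 ^ n)"
  have "?f \<in> borel \<rightarrow>\<^sub>M count_space UNIV"
  proof (subst measurable_count_space_eq2_countable, safe)
    fix k :: "'n \<Rightarrow> int"
    have "?f -` {k} \<inter> space borel = (\<Inter>i. {t. real_of_int (k i) \<le> 2 ^ n * t $ i} \<inter> {t. 2 ^ n * t $ i < real_of_int (k i) + 1})"
      by (auto simp: fun_eq_iff floor_eq_iff)
    also have "\<dots> \<in> sets borel"
      by (intro sets.countable_INT'' sets.Int) (auto intro!: borel_measurable_le borel_measurable_less borel_measurable_const borel_measurable_continuous_onI continuous_intros)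
    finally show "?f -` {k} \<inter> space borel \<in> sets borel" .
  qed auto
  then have "(\<lambda>t. ?g (?f t)) \<in> borel_measurable borel"
    by (rule measurable_compose) simp
  then show "(\<lambda>t. indicator orthant t * x (dyadic_above n t)) \<in> borel_measurable borel"
    unfolding dyadic_above_def
    by (intro borel_measurable_times borel_measurable_indicator) (use orthant_borel in auto)
qed

lemma lamp_limit:
  assumes "lamp x" "t \<in> orthant"
  shows "\<exists>l. (x \<longlongrightarrow> l) (at t within quadrant R t)"
  by (rule bspec[OF spec[OF conjunct1[OF assms(1)[unfolded lamp_def]]] assms(2)])

text \<open>Finitely many quadrants cover a neighbourhood of \<open>t\<close>, and the path has a limit in each of them.\<close>

lemma lamp_locally_bounded:
  assumes x: "lamp x" and t: "t \<in> orthant"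
  shows "\<exists>U B. open U \<and> t \<in> U \<and> (\<forall>u\<in>U \<inter> orthant. \<bar>x u\<bar> \<le> B)"
proof -
  have "\<forall>R. \<exists>U B. open U \<and> t \<in> U \<and> (\<forall>u\<in>U \<inter> quadrant R t. u \<noteq> t \<longrightarrow> \<bar>x u\<bar> \<le> B)"
  proof
    fix R
    obtain l where "(x \<longlongrightarrow> l) (at t within quadrant R t)"
      using lamp_limit[OF x t, of R] ..
    then have "eventually (\<lambda>u. dist (x u) l < 1) (at t within quadrant R t)"
      by (rule tendstoD) simp
    then obtain U where "open U" "t \<in> U" "\<forall>u\<in>U. u \<noteq> t \<longrightarrow> u \<in> quadrant R t \<longrightarrow> dist (x u) l < 1"
      unfolding eventually_at_topological by blast
    then show "\<exists>U B. open U \<and> t \<in> U \<and> (\<forall>u\<in>U \<inter> quadrant R t. u \<noteq> t \<longrightarrow> \<bar>x u\<bar> \<le> B)"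
      by (intro exI[of _ U] exI[of _ "\<bar>l\<bar> + 1"]) (auto simp: dist_real_def abs_if split: if_splits)
  qed
  then obtain U B where UB: "\<And>R. open (U R)" "\<And>R. t \<in> U R"
    "\<And>R u. u \<in> U R \<Longrightarrow> u \<in> quadrant R t \<Longrightarrow> u \<noteq> t \<Longrightarrow> \<bar>x u\<bar> \<le> B R"
    by (metis IntI)
  have "\<bar>x u\<bar> \<le> \<bar>x t\<bar> + (\<Sum>R\<in>UNIV. \<bar>B R\<bar>)" if "u \<in> (\<Inter>R. U R) \<inter> orthant" for u
  proof (cases "u = t")
    case False
    let ?R = "{i. t $ i \<le> u $ i}"
    have "\<bar>x u\<bar> \<le> B ?R"
      using that False by (intro UB(3)) (auto simp: quadrant_def)
    also have "\<dots> \<le> \<bar>B ?R\<bar>" by simp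
    also have "\<dots> \<le> (\<Sum>R\<in>UNIV. \<bar>B R\<bar>)" by (rule member_le_sum) auto
    finally show ?thesis by simp
  qed (simp add: sum_nonneg)
  moreover have "open (\<Inter>R. U R)" "t \<in> (\<Inter>R. U R)" using UB by (auto intro: open_INT)
  ultimately show ?thesis by blast
qed

lemma lamp_bounded_on_compact:
  assumes x: "lamp x" and K: "compact K" "K \<subseteq> orthant"
  shows "\<exists>B. \<forall>t\<in>K. \<bar>x t\<bar> \<le> B"
proof -
  have "\<forall>t\<in>K. \<exists>p. open (fst p) \<and> t \<in> fst p \<and> (\<forall>u\<in>fst p \<inter> orthant. \<bar>x u\<bar> \<le> snd p)"
  proof
    fix t assume "t \<in> K"
    then obtain U B where "open U" "t \<in> U" "\<forall>u\<in>U \<inter> orthant. \<bar>x u\<bar> \<le> B"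
      using lamp_locally_bounded[OF x subsetD[OF K(2)]] by blast
    then show "\<exists>p. open (fst p) \<and> t \<in> fst p \<and> (\<forall>u\<in>fst p \<inter> orthant. \<bar>x u\<bar> \<le> snd p)"
      by (intro exI[of _ "(U, B)"]) simp
  qed
  from bchoice[OF this] obtain p where p:
    "\<forall>t\<in>K. open (fst (p t)) \<and> t \<in> fst (p t) \<and> (\<forall>u\<in>fst (p t) \<inter> orthant. \<bar>x u\<bar> \<le> snd (p t))" ..
  define U B where "U t = fst (p t)" and "B t = snd (p t)" for t
  have UB: "open (U t)" "t \<in> U t" "\<And>u. u \<in> U t \<inter> orthant \<Longrightarrow> \<bar>x u\<bar> \<le> B t" if "t \<in> K" for t
    using p that by (auto simp: U_def B_def)
  have cover: "K \<subseteq> (\<Union>t\<in>K. U t)"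
    using UB(2) by blast
  obtain D where D: "D \<subseteq> K" "finite D" "K \<subseteq> (\<Union>t\<in>D. U t)"
    by (rule compactE_image[OF K(1) UB(1) cover])
  have "\<bar>x u\<bar> \<le> (\<Sum>t\<in>D. \<bar>B t\<bar>)" if "u \<in> K" for u
  proof -
    from that D(3) obtain t where t: "t \<in> D" "u \<in> U t" by blast
    have tK: "t \<in> K" using t(1) D(1) by (rule rev_subsetD)
    have "u \<in> U t \<inter> orthant" using t(2) that K(2) by blast
    then have "\<bar>x u\<bar> \<le> B t" by (rule UB(3)[OF tK])
    also have "\<dots> \<le> \<bar>B t\<bar>" by simp
    also have "\<dots> \<le> (\<Sum>t\<in>D. \<bar>B t\<bar>)" using t D by (intro member_le_sum) auto
    finally show ?thesis .
  qed
  then show ?thesis by blast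
qed


section \<open>Schwartz functions and slowly growing paths\<close>

lemma partial_deriv_eqI: "(f has_derivative D) (at x) \<Longrightarrow> partial_deriv i f x = D (axis i 1)"
  unfolding partial_deriv_def by (drule frechet_derivative_at) simp

lemma smooth_has_derivative:
  "smooth f \<Longrightarrow> (iter_partial is f has_derivative frechet_derivative (iter_partial is f) (at x)) (at x)"
  unfolding smooth_def frechet_derivative_works by blast

lemma smooth_continuous: "smooth f \<Longrightarrow> continuous_on A (iter_partial is f)"
  by (intro continuous_at_imp_continuous_on ballI has_derivative_continuous[OF smooth_has_derivative])

lemma iter_partial_lincomb:
  assumes "smooth f" "smooth g"
  shows "iter_partial is (\<lambda>x. a * f x + b * g x) = (\<lambda>x. a * iter_partial is f x + b * iter_partial is g x)"
proof (induction "is")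
  case (Cons i "is")
  have "partial_deriv i (\<lambda>x. a * iter_partial is f x + b * iter_partial is g x) x =
      a * partial_deriv i (iter_partial is f) x + b * partial_deriv i (iter_partial is g) x" for x
    by (subst partial_deriv_eqI[OF has_derivative_add[OF
          has_derivative_mult_right[OF smooth_has_derivative[OF assms(1)]]
          has_derivative_mult_right[OF smooth_has_derivative[OF assms(2)]]]])
      (simp add: partial_deriv_def)
  then show ?case by (simp add: Cons.IH)
qed simp

lemma smooth_lincomb:
  assumes "smooth f" "smooth g"
  shows "smooth (\<lambda>x. a * f x + b * g x)"
  using assms unfolding smooth_def iter_partial_lincomb[OF assms]
  by (intro allI differentiable_add differentiable_mult differentiable_const) auto

lemma iter_partial_translate:
  assumes "smooth f"
  shows "iter_partial is (\<lambda>x. f (x - v)) = (\<lambda>x. iter_partial is f (x - v))"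
proof (induction "is")
  case (Cons i "is")
  have "((\<lambda>x. iter_partial is f (x - v)) has_derivative
      (\<lambda>h. frechet_derivative (iter_partial is f) (at (x - v)) h)) (at x)" for x
    by (rule has_derivative_compose[OF _ smooth_has_derivative[OF assms]])
      (auto intro!: derivative_eq_intros)
  from partial_deriv_eqI[OF this] show ?case
    by (simp add: Cons.IH partial_deriv_def)
qed simp

lemma smooth_translate:
  assumes "smooth f"
  shows "smooth (\<lambda>x. f (x - v))"
  unfolding smooth_def iter_partial_translate[OF assms]
proof (intro allI)
  fix "is" x
  have "((\<lambda>x. iter_partial is f (x - v)) has_derivative
      (\<lambda>h. frechet_derivative (iter_partial is f) (at (x - v)) h)) (at x)"
    by (rule has_derivative_compose[OF _ smooth_has_derivative[OF assms]])
      (auto intro!: derivative_eq_intros)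
  then show "(\<lambda>x. iter_partial is f (x - v)) differentiable at x" by (rule differentiableI)
qed

lemma schwartz_iff:
  "f \<in> schwartz_space \<longleftrightarrow>
     smooth f \<and> (\<forall>k is. \<exists>B. \<forall>x. (1 + norm x) ^ k * \<bar>iter_partial is f x\<bar> \<le> B)"
  by (simp add: schwartz_space_def bounded_iff abs_mult)

lemma schwartz_seminorm_upper:
  assumes "f \<in> schwartz_space"
  shows "(1 + norm x) ^ k * \<bar>iter_partial is f x\<bar> \<le> schwartz_seminorm k is f"
proof -
  obtain B where "\<And>x. (1 + norm x) ^ k * \<bar>iter_partial is f x\<bar> \<le> B"
    using assms unfolding schwartz_iff by blast
  then show ?thesis
    unfolding schwartz_seminorm_def by (intro cSUP_upper bdd_aboveI2) auto
qed

lemma schwartz_seminorm_least: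
  "(\<And>x. (1 + norm x) ^ k * \<bar>iter_partial is f x\<bar> \<le> B) \<Longrightarrow> schwartz_seminorm k is f \<le> B"
  unfolding schwartz_seminorm_def by (intro cSUP_least) auto

text \<open>One pointwise estimate yields both that the Schwartz functions form a vector space and that the
seminorms are subadditive and homogeneous.\<close>

lemma schwartz_lincomb_bound:
  assumes "f \<in> schwartz_space" "g \<in> schwartz_space"
  shows "(1 + norm x) ^ k * \<bar>iter_partial is (\<lambda>x. a * f x + b * g x) x\<bar> \<le>
     \<bar>a\<bar> * schwartz_seminorm k is f + \<bar>b\<bar> * schwartz_seminorm k is g"
proof -
  have s: "smooth f" "smooth g" using assms by (auto simp: schwartz_iff)
  let ?w = "(1 + norm x) ^ k" and ?F = "iter_partial is f x" and ?G = "iter_partial is g x"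
  have "?w * \<bar>a * ?F + b * ?G\<bar> \<le> ?w * (\<bar>a\<bar> * \<bar>?F\<bar> + \<bar>b\<bar> * \<bar>?G\<bar>)"
    by (intro mult_left_mono order_trans[OF abs_triangle_ineq]) (auto simp: abs_mult)
  also have "\<dots> = \<bar>a\<bar> * (?w * \<bar>?F\<bar>) + \<bar>b\<bar> * (?w * \<bar>?G\<bar>)" by (simp add: algebra_simps)
  also have "\<dots> \<le> \<bar>a\<bar> * schwartz_seminorm k is f + \<bar>b\<bar> * schwartz_seminorm k is g"
    using assms by (intro add_mono mult_left_mono schwartz_seminorm_upper) auto
  finally show ?thesis by (simp add: iter_partial_lincomb[OF s])
qed

lemma schwartz_lincomb:
  assumes "f \<in> schwartz_space" "g \<in> schwartz_space"
  shows "(\<lambda>x. a * f x + b * g x) \<in> schwartz_space"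
  using schwartz_lincomb_bound[OF assms] smooth_lincomb assms unfolding schwartz_iff by blast

lemma schwartz_seminorm_lincomb:
  assumes "f \<in> schwartz_space" "g \<in> schwartz_space"
  shows "schwartz_seminorm k is (\<lambda>x. a * f x + b * g x) \<le>
     \<bar>a\<bar> * schwartz_seminorm k is f + \<bar>b\<bar> * schwartz_seminorm k is g"
  by (rule schwartz_seminorm_least) (rule schwartz_lincomb_bound[OF assms])

lemma iter_partial_zero: "iter_partial is (\<lambda>x. 0) = (\<lambda>x. 0)"
proof (induction "is")
  case (Cons i "is")
  then show ?case using partial_deriv_eqI[OF has_derivative_const[of 0]] by auto
qed simp

lemma schwartz_seminorm_zero: "schwartz_seminorm k is (\<lambda>x. 0) = 0"
  by (simp add: schwartz_seminorm_def iter_partial_zero)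

text \<open>Off the closed support the function vanishes on an open set, so all derivatives vanish there.\<close>

lemma iter_partial_outside_support:
  assumes "x \<notin> closure {x. f x \<noteq> 0}"
  shows "iter_partial is f x = 0"
  using assms
proof (induction "is" arbitrary: x)
  case Nil
  then show ?case using closure_subset by force
next
  case (Cons i "is")
  have "((\<lambda>x. 0) has_derivative (\<lambda>h. 0)) (at x)" by simp
  then have "(iter_partial is f has_derivative (\<lambda>h. 0)) (at x)"
    by (rule has_derivative_transform_within_open[of _ _ _ _ "- closure {x. f x \<noteq> 0}"])
      (use Cons in auto)
  then show ?case by (simp add: partial_deriv_eqI)
qed

lemma test_functions_schwartz:
  assumes "f \<in> test_functions"
  shows "f \<in> schwartz_space"
proof -
  let ?K = "closure {x. f x \<noteq> 0}"
  have s: "smooth f" and K: "compact ?K" using assms by (auto simp: test_functions_def)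
  have "\<exists>B. \<forall>x. (1 + norm x) ^ k * \<bar>iter_partial is f x\<bar> \<le> B" for k "is"
  proof -
    have "continuous_on ?K (\<lambda>x. (1 + norm x) ^ k * \<bar>iter_partial is f x\<bar>)"
      by (intro continuous_intros smooth_continuous s)
    from compact_continuous_image[OF this K]
    obtain B where B: "\<And>x. x \<in> ?K \<Longrightarrow> (1 + norm x) ^ k * \<bar>iter_partial is f x\<bar> \<le> B"
      using compact_imp_bounded bounded_iff[of "_ ` ?K"] by (metis (no_types, lifting) abs_le_D1 imageI real_norm_def)
    have "(1 + norm x) ^ k * \<bar>iter_partial is f x\<bar> \<le> max B 0" for x
      using B[of x] iter_partial_outside_support[of x f "is"] by (cases "x \<in> ?K") auto
    then show ?thesis by blast
  qed
  with s show ?thesis unfolding schwartz_iff by blast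
qed

lemma seminorm_topology_topspace_subset: "topspace (seminorm_topology V P) \<subseteq> V"
  unfolding seminorm_topology_def topology_generated_by_topspace by blast

lemma seminorm_topology_ball:
  "p \<in> P \<Longrightarrow> f \<in> V \<Longrightarrow> 0 < e \<Longrightarrow> openin (seminorm_topology V P) {g \<in> V. p (\<lambda>x. g x - f x) < e}"
  unfolding seminorm_topology_def by (intro topology_generated_by_Basis) blast

text \<open>A functional that is Lipschitz with respect to one of the seminorms is continuous, because the ball
of that seminorm around a point is open.\<close>

lemma continuous_map_seminorm_topology:
  assumes p: "p \<in> P" "p (\<lambda>x. 0) = 0" and D: "0 \<le> D"
    and bound: "\<And>f g. f \<in> V \<Longrightarrow> g \<in> V \<Longrightarrow> \<bar>T g - T f\<bar> \<le> D * p (\<lambda>x. g x - f x)"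
  shows "continuous_map (seminorm_topology V P) euclideanreal T"
proof -
  let ?X = "seminorm_topology V P"
  have "openin ?X {f \<in> topspace ?X. T f \<in> U}" if U: "open U" for U
  proof (subst openin_subopen, intro ballI)
    fix f assume f: "f \<in> {f \<in> topspace ?X. T f \<in> U}"
    then have fV: "f \<in> V" using seminorm_topology_topspace_subset by blast
    obtain e where e: "0 < e" "\<And>y. dist y (T f) < e \<Longrightarrow> y \<in> U"
      using U f unfolding open_dist by blast
    let ?B = "{g \<in> V. p (\<lambda>x. g x - f x) < e / (D + 1)}"
    have B: "openin ?X ?B"
      using p(1) fV e(1) D by (intro seminorm_topology_ball) auto
    have "g \<in> topspace ?X \<and> T g \<in> U" if g: "g \<in> ?B" for g
    proof
      show "g \<in> topspace ?X" using openin_subset[OF B] g by blast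
      have "\<bar>T g - T f\<bar> \<le> D * p (\<lambda>x. g x - f x)" using bound fV g by blast
      also have "\<dots> \<le> D * (e / (D + 1))" using g D by (intro mult_left_mono) auto
      also have "\<dots> < e" using D e(1) by (simp add: field_simps)
      finally show "T g \<in> U" by (intro e(2)) (simp add: dist_real_def)
    qed
    moreover have "f \<in> ?B" using fV p(2) e(1) D by simp
    ultimately show "\<exists>S. openin ?X S \<and> f \<in> S \<and> S \<subseteq> {f \<in> topspace ?X. T f \<in> U}"
      using B by blast
  qed
  then show ?thesis by (simp add: continuous_map_def)
qed

lemma ennreal_term_le_suminf: "f N \<le> (\<Sum>n. f n :: ennreal)"
  using sum_le_suminf[of f "{N}"] by simp

text \<open>The power of the decay exceeds the dimension by two, which leaves room for the crude estimate of the
integral by a sum over the cubes of side \<open>2 (N + 1)\<close>.\<close>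

definition decay_weight :: "real^'n::finite \<Rightarrow> real" where
  "decay_weight t = inverse ((1 + norm t) ^ (CARD('n) + 2))"

lemma integrable_decay_weight: "integrable lborel (decay_weight :: real^'n::finite \<Rightarrow> real)"
  unfolding decay_weight_def
proof (rule integrableI_nonneg)
  let ?d = "CARD('n)"
  let ?B = "\<lambda>N::nat. cbox (- (real (Suc N) *\<^sub>R One)) (real (Suc N) *\<^sub>R One) :: (real^'n) set"
  let ?c = "\<lambda>N::nat. ennreal (inverse (real (Suc N) ^ (?d + 2)))"
  have "ennreal (inverse ((1 + norm t) ^ (?d + 2))) \<le> (\<Sum>N. ?c N * indicator (?B N) t)" for t :: "real^'n"
  proof -
    define N where "N = nat \<lfloor>norm t\<rfloor>"
    have N: "real N \<le> norm t" "norm t \<le> real (Suc N)"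
      using norm_ge_zero[of t] unfolding N_def by linarith+
    have "t \<in> ?B N"
      unfolding mem_box
    proof (intro ballI)
      fix b :: "real^'n" assume b: "b \<in> Basis"
      have "\<bar>t \<bullet> b\<bar> \<le> real (Suc N)" using Basis_le_norm[OF b, of t] N(2) by linarith
      then show "- (real (Suc N) *\<^sub>R One) \<bullet> b \<le> t \<bullet> b \<and> t \<bullet> b \<le> real (Suc N) *\<^sub>R One \<bullet> b"
        using b by (simp add: inner_sum_left_Basis abs_le_iff)
    qed
    moreover have "inverse ((1 + norm t) ^ (?d + 2)) \<le> inverse (real (Suc N) ^ (?d + 2))"
      using N(1) by (intro le_imp_inverse_le power_mono) auto
    ultimately have "ennreal (inverse ((1 + norm t) ^ (?d + 2))) \<le> ?c N * indicator (?B N) t"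
      by (simp add: ennreal_leI)
    also have "\<dots> \<le> (\<Sum>n. ?c n * indicator (?B n) t)"
      by (rule ennreal_term_le_suminf)
    finally show ?thesis .
  qed
  then have "(\<integral>\<^sup>+ t. ennreal (inverse ((1 + norm (t::real^'n)) ^ (?d + 2))) \<partial>lborel) \<le>
      (\<integral>\<^sup>+ t. (\<Sum>N. ?c N * indicator (?B N) t) \<partial>lborel)"
    by (rule nn_integral_mono)
  also have "\<dots> = (\<Sum>N. ?c N * emeasure lborel (?B N))"
    by (subst nn_integral_suminf) (simp_all add: nn_integral_cmult_indicator del: of_nat_Suc)
  also have "\<dots> = (\<Sum>N. ennreal (2 ^ ?d * inverse (real (Suc N) ^ 2)))"
  proof (rule arg_cong[where f=suminf], rule ext)
    fix N
    define r where "r = real (Suc N)"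
    have r: "0 < r" by (simp add: r_def)
    have "emeasure lborel (?B N) = ennreal (\<Prod>b\<in>(Basis :: (real^'n) set). 2 * r)"
    proof -
      have one: "One \<bullet> b = 1" if "b \<in> Basis" for b :: "real^'n"
        using that by (simp add: inner_sum_left_Basis)
      have "emeasure lborel (?B N) = ennreal (\<Prod>b\<in>(Basis :: (real^'n) set). (r *\<^sub>R One - - (r *\<^sub>R One)) \<bullet> b)"
        unfolding r_def[symmetric] using r
        by (intro emeasure_lborel_cbox) (simp only: inner_minus_left inner_scaleR_left one)
      also have "(\<Prod>b\<in>(Basis :: (real^'n) set). (r *\<^sub>R One - - (r *\<^sub>R One)) \<bullet> b) = (\<Prod>b\<in>(Basis :: (real^'n) set). 2 * r)"
        by (rule prod.cong[OF refl]) (simp only: inner_diff_left inner_minus_left inner_scaleR_left one)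
      finally show ?thesis .
    qed
    also have "\<dots> = ennreal ((2 * r) ^ ?d)" by simp
    finally show "?c N * emeasure lborel (?B N) = ennreal (2 ^ ?d * inverse (real (Suc N) ^ 2))"
      using r unfolding r_def[symmetric]
      by (simp add: ennreal_mult[symmetric] power_mult_distrib power_add power2_eq_square field_simps)
  qed
  also have "\<dots> < \<infinity>"
  proof -
    have "summable (\<lambda>N. 2 ^ ?d * inverse (real (Suc N) ^ 2))"
      using inverse_power_summable[of 2, where 'a=real]
      by (intro summable_mult) (subst summable_Suc_iff, simp)
    then show ?thesis by (subst suminf_ennreal2) auto
  qed
  finally show "(\<integral>\<^sup>+ t. ennreal (inverse ((1 + norm (t::real^'n)) ^ (?d + 2))) \<partial>lborel) < \<infinity>" .
qed auto

text \<open>The enumeration of the coordinates that enters the mixed partial derivative.\<close>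

definition all_directions :: "'n list" where
  "all_directions = (SOME is. distinct is \<and> set is = UNIV)"

lemma all_directions_enumerates:
  "distinct (all_directions :: 'n::finite list)" "set (all_directions :: 'n list) = UNIV"
proof -
  have "\<exists>is :: 'n::finite list. distinct is \<and> set is = UNIV"
    using finite_distinct_list[of "UNIV :: 'n set"] by auto
  then show "distinct (all_directions :: 'n list)" "set (all_directions :: 'n list) = UNIV"
    unfolding all_directions_def by (metis (mono_tags, lifting) someI_ex)+
qed

lemma mixed_partial_eq: "mixed_partial f = iter_partial all_directions f"
  by (simp add: mixed_partial_def all_directions_def)

text \<open>For such a path the white noise makes sense on all Schwartz functions, and the formula that defines
it on test functions is itself the continuous extension.\<close>

locale slowly_growing_path =
  fixes x :: "real^'n::finite \<Rightarrow> real" and C :: real and p :: nat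
  assumes path_measurable: "(\<lambda>t. indicator orthant t * x t) \<in> borel_measurable borel"
    and growth: "\<And>t. t \<in> orthant \<Longrightarrow> \<bar>x t\<bar> \<le> C * (1 + norm t) ^ p"
begin

definition decay_order :: nat where "decay_order = p + (CARD('n) + 2)"

abbreviation weighted_norm :: "(real^'n \<Rightarrow> real) \<Rightarrow> real" where
  "weighted_norm \<equiv> schwartz_seminorm decay_order all_directions"

definition weight_mass :: real where
  "weight_mass = (LINT t|lborel. decay_weight (t::real^'n))"

lemma C_nonneg: "0 \<le> C"
  using growth[of 0] abs_ge_zero[of "x 0"] by simp

text \<open>The weight of the seminorm pays for the growth of the path and leaves an integrable weight.\<close>

lemma integrand_bound:
  assumes "f \<in> schwartz_space"
  shows "\<bar>indicator orthant t * (x t * mixed_partial f t)\<bar> \<le>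
     C * weighted_norm f * decay_weight t"
proof (cases "t \<in> orthant")
  case True
  let ?w = "1 + norm t" and ?m = "\<bar>mixed_partial f t\<bar>"
  have w: "0 < ?w" by (simp add: add_pos_nonneg)
  have "?w ^ p * ?m * ?w ^ (CARD('n) + 2) \<le> weighted_norm f"
    using schwartz_seminorm_upper[OF assms, of t decay_order all_directions]
    by (simp add: mixed_partial_eq decay_order_def power_add mult_ac)
  then have "?w ^ p * ?m \<le> weighted_norm f * inverse (?w ^ (CARD('n) + 2))"
    using w by (simp add: pos_le_divide_eq flip: divide_inverse)
  then have "C * (?w ^ p * ?m) \<le> C * (weighted_norm f * inverse (?w ^ (CARD('n) + 2)))"
    using C_nonneg by (rule mult_left_mono)
  moreover have "\<bar>x t\<bar> * ?m \<le> C * ?w ^ p * ?m"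
    using growth[OF True] by (rule mult_right_mono) simp
  ultimately show ?thesis using True by (simp add: abs_mult mult.assoc decay_weight_def)
next
  case False
  have "0 \<le> weighted_norm f"
    by (rule order_trans[OF _ schwartz_seminorm_upper[OF assms, of 0]]) simp
  with False C_nonneg show ?thesis by (simp add: decay_weight_def)
qed

lemma integrand_integrable:
  assumes "f \<in> schwartz_space"
  shows "integrable lborel (\<lambda>t. indicator orthant t * (x t * mixed_partial f t))"
proof (rule Bochner_Integration.integrable_bound)
  show "integrable lborel (\<lambda>t. C * weighted_norm f * decay_weight t)"
    by (intro integrable_mult_right integrable_decay_weight)
  have "mixed_partial f \<in> borel_measurable borel"
    unfolding mixed_partial_eq using assms
    by (intro borel_measurable_continuous_onI smooth_continuous) (simp add: schwartz_iff)
  then have "(\<lambda>t. (indicator orthant t * x t) * mixed_partial f t) \<in> borel_measurable borel"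
    by (intro borel_measurable_times path_measurable)
  then show "(\<lambda>t. indicator orthant t * (x t * mixed_partial f t)) \<in> borel_measurable lborel"
    by (simp add: mult.assoc)
  show "AE t in lborel. norm (indicator orthant t * (x t * mixed_partial f t)) \<le>
      norm (C * weighted_norm f * decay_weight t)"
    using integrand_bound[OF assms] by (intro AE_I2) (metis abs_ge_self order_trans real_norm_def)
qed

lemma white_noise_eq:
  "white_noise x f = (-1) ^ CARD('n) * (LINT t|lborel. indicator orthant t * (x t * mixed_partial f t))"
  by (simp add: white_noise_def set_lebesgue_integral_def)

lemma white_noise_lincomb:
  assumes "f \<in> schwartz_space" "g \<in> schwartz_space"
  shows "white_noise x (\<lambda>t. a * f t + b * g t) = a * white_noise x f + b * white_noise x g"
proof -
  have s: "smooth f" "smooth g" using assms by (auto simp: schwartz_iff)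
  have "indicator orthant t * (x t * mixed_partial (\<lambda>t. a * f t + b * g t) t) =
      a * (indicator orthant t * (x t * mixed_partial f t)) + b * (indicator orthant t * (x t * mixed_partial g t))" for t
    unfolding mixed_partial_eq iter_partial_lincomb[OF s] by (simp add: algebra_simps)
  then show ?thesis
    unfolding white_noise_eq using integrand_integrable[OF assms(1)] integrand_integrable[OF assms(2)]
    by (simp add: algebra_simps)
qed

lemma white_noise_bound:
  assumes "f \<in> schwartz_space"
  shows "\<bar>white_noise x f\<bar> \<le> C * weight_mass * weighted_norm f"
proof -
  have "\<bar>white_noise x f\<bar> = \<bar>LINT t|lborel. indicator orthant t * (x t * mixed_partial f t)\<bar>"
    by (simp add: white_noise_eq abs_mult power_abs)
  also have "\<dots> \<le> (LINT t|lborel. \<bar>indicator orthant t * (x t * mixed_partial f t)\<bar>)"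
    by (rule integral_abs_bound)
  also have "\<dots> \<le> (LINT t|lborel. C * weighted_norm f * decay_weight (t::real^'n))"
    by (intro integral_mono integrable_abs integrand_integrable[OF assms] integrand_bound[OF assms]
        integrable_mult_right integrable_decay_weight)
  also have "\<dots> = C * weight_mass * weighted_norm f"
    by (simp add: weight_mass_def)
  finally show ?thesis .
qed

lemma weight_mass_nonneg: "0 \<le> weight_mass"
  unfolding weight_mass_def by (rule Bochner_Integration.integral_nonneg) (simp add: decay_weight_def)

lemma white_noise_diff:
  assumes "f \<in> schwartz_space" "g \<in> schwartz_space"
  shows "\<bar>white_noise x g - white_noise x f\<bar> \<le>
    C * weight_mass * weighted_norm (\<lambda>t. g t - f t)"
  using white_noise_lincomb[OF assms(2,1), of 1 "-1"] white_noise_bound[OF schwartz_lincomb[OF assms(2,1), of 1 "-1"]]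
  by simp

lemma white_noise_tempered: "white_noise x \<in> tempered_distributions"
proof -
  have lin: "linear_functional_on schwartz_space (white_noise x)"
    unfolding linear_functional_on_def using white_noise_lincomb by blast
  then have lin': "linear_functional_on test_functions (white_noise x)"
    unfolding linear_functional_on_def using test_functions_schwartz by blast
  have nonneg: "0 \<le> C * weight_mass" using C_nonneg weight_mass_nonneg by simp
  have "continuous_map schwartz_topology euclideanreal (white_noise x)"
    unfolding schwartz_topology_def
    by (rule continuous_map_seminorm_topology[OF _ schwartz_seminorm_zero nonneg white_noise_diff]) auto
  moreover have "continuous_map (test_topology K) euclideanreal (white_noise x)" if K: "compact K" for K
  proof -
    let ?V = "{f \<in> test_functions. closure {x. f x \<noteq> 0} \<subseteq> K}"
    obtain r where r: "0 \<le> r" "\<And>t. t \<in> K \<Longrightarrow> norm t \<le> r"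
      using compact_imp_bounded[OF K] unfolding bounded_pos by (meson less_imp_le)
    have diff: "\<bar>white_noise x g - white_noise x f\<bar> \<le>
        C * weight_mass * (1 + r) ^ decay_order * schwartz_seminorm 0 all_directions (\<lambda>t. g t - f t)"
      if f: "f \<in> ?V" and g: "g \<in> ?V" for f g
    proof -
      have S: "f \<in> schwartz_space" "g \<in> schwartz_space" using f g test_functions_schwartz by auto
      let ?h = "\<lambda>t. g t - f t"
      have h: "?h \<in> schwartz_space" using schwartz_lincomb[OF S(2,1), of 1 "-1"] by simp
      have supp: "closure {t. ?h t \<noteq> 0} \<subseteq> K"
      proof (rule closure_minimal[OF _ compact_imp_closed[OF K]])
        have "{t. ?h t \<noteq> 0} \<subseteq> {t. g t \<noteq> 0} \<union> {t. f t \<noteq> 0}" by auto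
        also have "\<dots> \<subseteq> K"
        proof (rule Un_least)
          from g have "closure {t. g t \<noteq> 0} \<subseteq> K" by simp
          with closure_subset show "{t. g t \<noteq> 0} \<subseteq> K" by (rule order_trans)
          from f have "closure {t. f t \<noteq> 0} \<subseteq> K" by simp
          with closure_subset show "{t. f t \<noteq> 0} \<subseteq> K" by (rule order_trans)
        qed
        finally show "{t. ?h t \<noteq> 0} \<subseteq> K" .
      qed
      have "weighted_norm ?h \<le> (1 + r) ^ decay_order * schwartz_seminorm 0 all_directions ?h"
      proof (rule schwartz_seminorm_least)
        fix t
        have s0: "\<bar>iter_partial all_directions ?h t\<bar> \<le> schwartz_seminorm 0 all_directions ?h"
          using schwartz_seminorm_upper[OF h, of t 0 all_directions] by simp
        show "(1 + norm t) ^ decay_order * \<bar>iter_partial all_directions ?h t\<bar> \<le>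
            (1 + r) ^ decay_order * schwartz_seminorm 0 all_directions ?h"
        proof (cases "t \<in> K")
          case True
          then show ?thesis using s0 r by (intro mult_mono power_mono) auto
        next
          case False
          then have "iter_partial all_directions ?h t = 0"
            using supp by (intro iter_partial_outside_support) blast
          then show ?thesis using s0 r(1) by simp
        qed
      qed
      from mult_left_mono[OF this nonneg] show ?thesis
        using white_noise_diff[OF S] by (simp add: mult.assoc)
    qed
    show ?thesis
      unfolding test_topology_def
      by (rule continuous_map_seminorm_topology[OF _ schwartz_seminorm_zero _ diff]) (use nonneg r(1) in auto)
  qed
  ultimately show ?thesis
    using lin lin' unfolding tempered_distributions_def distributions_def by blast
qed

end


section \<open>Independence of the increments over grid cells\<close>

text \<open>Events that depend on disjoint blocks of an independent family are independent; the events are given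
by predicates on the restrictions of the family to the blocks.\<close>

lemma (in prob_space) prob_indep_blocks:
  fixes \<xi> :: "'i \<Rightarrow> 'a \<Rightarrow> real"
  assumes "indep_vars (\<lambda>_. borel) \<xi> J" "A \<subseteq> J" "B \<subseteq> J" "A \<inter> B = {}"
    and [measurable]: "Measurable.pred (PiM A (\<lambda>_. borel)) P" "Measurable.pred (PiM B (\<lambda>_. borel)) Q"
  shows "\<P>(\<omega> in M. P (\<lambda>i\<in>A. \<xi> i \<omega>) \<and> Q (\<lambda>i\<in>B. \<xi> i \<omega>)) =
    \<P>(\<omega> in M. P (\<lambda>i\<in>A. \<xi> i \<omega>)) * \<P>(\<omega> in M. Q (\<lambda>i\<in>B. \<xi> i \<omega>))"
proof -
  let ?U = "\<lambda>\<omega>. \<lambda>i\<in>A. \<xi> i \<omega>" and ?V = "\<lambda>\<omega>. \<lambda>i\<in>B. \<xi> i \<omega>"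
  have ind: "indep_var (PiM A (\<lambda>_. borel)) ?U (PiM B (\<lambda>_. borel)) ?V"
    using indep_var_restrict[OF assms(1) assms(4) assms(2,3)] .
  note rv = indep_var_rv1[OF ind] indep_var_rv2[OF ind]
  have sets: "{z \<in> space (PiM A (\<lambda>_. borel)). P z} \<in> sets (PiM A (\<lambda>_. borel))" (is "?SP \<in> _")
    "{z \<in> space (PiM B (\<lambda>_. borel)). Q z} \<in> sets (PiM B (\<lambda>_. borel))" (is "?SQ \<in> _")
    by measurable
  have "prob ((\<lambda>\<omega>. (?U \<omega>, ?V \<omega>)) -` (?SP \<times> ?SQ) \<inter> space M) =
      prob (?U -` ?SP \<inter> space M) * prob (?V -` ?SQ \<inter> space M)"
    using indep_varD[OF ind sets] .
  moreover have "?U -` ?SP \<inter> space M = {\<omega>\<in>space M. P (?U \<omega>)}"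
    "?V -` ?SQ \<inter> space M = {\<omega>\<in>space M. Q (?V \<omega>)}"
    "(\<lambda>\<omega>. (?U \<omega>, ?V \<omega>)) -` (?SP \<times> ?SQ) \<inter> space M = {\<omega>\<in>space M. P (?U \<omega>) \<and> Q (?V \<omega>)}"
    using measurable_space[OF rv(1)] measurable_space[OF rv(2)] by auto
  ultimately show ?thesis by simp
qed

text \<open>The independence of increments is available for boxes enumerated by numbers; this carries it over to
cells indexed by their position.\<close>

lemma (in prob_space) indep_vars_bij_betw:
  assumes e: "bij_betw e I J" and ind: "indep_vars (\<lambda>_. N) (\<lambda>m. Y (e m)) I"
  shows "indep_vars (\<lambda>_. N) Y J"
proof -
  let ?F = "\<lambda>j. {Y j -` A \<inter> space M | A. A \<in> sets N}"
  have J: "e ` I = J" and inj: "inj_on e I" using e by (auto simp: bij_betw_def)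
  have rv: "\<And>m. m \<in> I \<Longrightarrow> Y (e m) \<in> measurable M N"
    and sets: "indep_sets (\<lambda>m. ?F (e m)) I"
    using ind unfolding indep_vars_def2 by blast+
  have "indep_sets ?F J"
    unfolding indep_sets_def
  proof (intro conjI ballI allI impI)
    fix j assume "j \<in> J"
    then obtain m where "m \<in> I" "j = e m" using J by blast
    then show "?F j \<subseteq> events" using sets unfolding indep_sets_def by blast
  next
    fix K A assume K: "K \<subseteq> J" "K \<noteq> {}" "finite K" and A: "A \<in> Pi K ?F"
    obtain L where L: "L \<subseteq> I" "K = e ` L"
      using K(1) J by (metis subset_imageE)
    have injL: "inj_on e L" using inj L(1) by (rule inj_on_subset)
    have finL: "finite L" "L \<noteq> {}"
      using K L finite_imageD[OF _ injL] by auto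
    have AL: "(\<lambda>m. A (e m)) \<in> Pi L (\<lambda>m. ?F (e m))"
    proof (rule Pi_I)
      fix m assume "m \<in> L"
      then have "e m \<in> K" using L(2) by blast
      then show "A (e m) \<in> ?F (e m)" by (rule Pi_mem[OF A])
    qed
    have "prob (\<Inter>m\<in>L. A (e m)) = (\<Prod>m\<in>L. prob (A (e m)))"
      using sets L(1) finL AL unfolding indep_sets_def by blast
    then show "prob (\<Inter>j\<in>K. A j) = (\<Prod>j\<in>K. prob (A j))"
      unfolding L(2) by (simp add: prod.reindex[OF injL])
  qed
  moreover have "Y j \<in> measurable M N" if "j \<in> J" for j
    using that J rv by blast
  ultimately show ?thesis unfolding indep_vars_def2 by blast
qed

context levy_field
begin

lemma increment_measurable:
  assumes "0 \<le> a" "0 \<le> b"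
  shows "(\<lambda>\<omega>. increment (\<lambda>t. X t \<omega>) a b) \<in> borel_measurable M"
proof -
  have "(\<lambda>\<omega>. X (corner E a b) \<omega>) \<in> borel_measurable M" for E
    using assms by (intro random_field) (auto simp: corner_def less_eq_vec_def)
  then show ?thesis unfolding increment_corner by auto
qed

lemma AE_increment_from_zero:
  assumes "0 \<le> t"
  shows "AE \<omega> in M. increment (\<lambda>t. X t \<omega>) 0 t = X t \<omega>"
  using AE_lamp
proof eventually_elim
  case (elim \<omega>)
  then show ?case using increment_from_zero[of "\<lambda>t. X t \<omega>" t] assms by simp
qed

text \<open>Translate the lower corner of the box to the origin and use that the field almost surely vanishes on the
coordinate hyperplanes.\<close>

lemma distr_increment:
  assumes "0 \<le> a" "a \<le> b"
  shows "distr M borel (\<lambda>\<omega>. increment (\<lambda>t. X t \<omega>) a b) = distr M borel (X (b - a))"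
proof -
  have "distr M borel (\<lambda>\<omega>. increment (\<lambda>t. X t \<omega>) (0 + a) (b - a + a)) =
      distr M borel (\<lambda>\<omega>. increment (\<lambda>t. X t \<omega>) 0 (b - a))"
    using assms by (intro stationary_increments) (auto simp: less_eq_vec_def)
  also have "\<dots> = distr M borel (X (b - a))"
    using assms by (intro distr_cong_AE AE_increment_from_zero increment_measurable random_field)
      (auto simp: less_eq_vec_def)
  finally show ?thesis by simp
qed

lemma prob_increment:
  assumes "0 \<le> a" "a \<le> b" "S \<in> sets borel"
  shows "\<P>(\<omega> in M. increment (\<lambda>t. X t \<omega>) a b \<in> S) = \<P>(\<omega> in M. X (b - a) \<omega> \<in> S)"
proof -
  have b: "0 \<le> b" "0 \<le> b - a" using order_trans[OF assms(1,2)] assms(2)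
    by (auto simp: less_eq_vec_def)
  then have "\<P>(\<omega> in M. increment (\<lambda>t. X t \<omega>) a b \<in> S) =
      measure (distr M borel (\<lambda>\<omega>. increment (\<lambda>t. X t \<omega>) a b)) S"
    using increment_measurable[OF assms(1) b(1)] assms(3)
    by (simp add: measure_distr vimage_def Int_def conj_commute)
  also have "\<dots> = \<P>(\<omega> in M. X (b - a) \<omega> \<in> S)"
    unfolding distr_increment[OF assms(1,2)]
    using random_field[of "b - a"] b(2) assms(3)
    by (simp add: measure_distr vimage_def Int_def conj_commute)
  finally show ?thesis .
qed

lemma indep_cells:
  assumes c: "\<And>i. mono (c i)" "\<And>i. 0 \<le> c i 0" and J: "finite J"
  shows "indep_vars (\<lambda>_. borel) (\<lambda>k \<omega>. cell_increment c (\<lambda>t. X t \<omega>) k) J"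
proof -
  obtain e where e: "bij_betw e {..<card J} J"
    using ex_bij_betw_nat_finite[OF J] unfolding atLeast0LessThan by blast
  let ?a = "\<lambda>m. grid_point c (e m)" and ?b = "\<lambda>m. grid_point c (\<lambda>i. Suc (e m i))"
  have pos: "0 \<le> grid_point c k" "grid_point c k \<le> grid_point c (\<lambda>i. Suc (k i))" for k
  proof -
    have "0 \<le> c i (k i)" for i using c(2)[of i] monoD[OF c(1), of 0 "k i" i] by linarith
    moreover have "c i (k i) \<le> c i (Suc (k i))" for i using monoD[OF c(1)] by simp
    ultimately show "0 \<le> grid_point c k" "grid_point c k \<le> grid_point c (\<lambda>i. Suc (k i))"
      by (auto simp: grid_point_def less_eq_vec_def)
  qed
  have disj: "half_open_box (?a m) (?b m) \<inter> half_open_box (?a m') (?b m') = {}"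
    if mm: "m < card J" "m' < card J" "m \<noteq> m'" for m m'
  proof -
    have "e m \<noteq> e m'" using e mm by (auto simp: bij_betw_def inj_on_def)
    then obtain i where i: "e m i \<noteq> e m' i" by auto
    have "c i (Suc p) \<le> c i q" if "p < q" for p q using c(1)[of i] that by (simp add: monoD)
    then have "c i (Suc (e m i)) \<le> c i (e m' i) \<or> c i (Suc (e m' i)) \<le> c i (e m i)"
      using i by (metis linorder_neqE_nat)
    then show ?thesis
      by (auto simp: half_open_box_def grid_point_def dest!: spec[of _ i])
  qed
  have "indep_vars (\<lambda>_. borel) (\<lambda>m \<omega>. increment (\<lambda>t. X t \<omega>) (?a m) (?b m)) {..<card J}"
    using pos disj by (intro independent_increments) (auto simp: disjoint_family_on_def)
  then show ?thesis
    unfolding cell_increment_def[symmetric]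
    by (rule indep_vars_bij_betw[OF e, where Y="\<lambda>k \<omega>. cell_increment c (\<lambda>t. X t \<omega>) k"])
qed

end


section \<open>Maximal inequalities\<close>

text \<open>Etemadi's inequality for the norm \<open>max\<^sub>k \<bar>V r k\<bar>\<close>. At the first time \<open>r\<close> at which the norm reaches
\<open>3 \<alpha>\<close>, either the norm of the final value is still at least \<open>\<alpha>\<close>, or the remaining increment has norm
at least \<open>2 \<alpha>\<close>. The latter is independent of the first passage and forces the norm at time \<open>r\<close> or
at time \<open>N\<close> to be at least \<open>\<alpha>\<close>. A family over \<open>k\<close> is allowed so that the inequality can be iterated
over the coordinates.\<close>

lemma (in prob_space) etemadi:
  fixes V :: "nat \<Rightarrow> 'k \<Rightarrow> 'a \<Rightarrow> real"
  assumes K: "finite K" and rv: "\<And>r k. r \<le> N \<Longrightarrow> k \<in> K \<Longrightarrow> V r k \<in> borel_measurable M"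
    and \<alpha>: "0 \<le> \<alpha>"
    and indep: "\<And>r. r \<le> N \<Longrightarrow>
      \<P>(\<omega> in M. ((\<exists>k\<in>K. 3 * \<alpha> \<le> \<bar>V r k \<omega>\<bar>) \<and> (\<forall>s<r. \<forall>k\<in>K. \<bar>V s k \<omega>\<bar> < 3 * \<alpha>)) \<and>
          (\<exists>k\<in>K. 2 * \<alpha> \<le> \<bar>V N k \<omega> - V r k \<omega>\<bar>)) =
      \<P>(\<omega> in M. (\<exists>k\<in>K. 3 * \<alpha> \<le> \<bar>V r k \<omega>\<bar>) \<and> (\<forall>s<r. \<forall>k\<in>K. \<bar>V s k \<omega>\<bar> < 3 * \<alpha>)) *
      \<P>(\<omega> in M. \<exists>k\<in>K. 2 * \<alpha> \<le> \<bar>V N k \<omega> - V r k \<omega>\<bar>)"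
    and tail: "\<And>r. r \<le> N \<Longrightarrow> \<P>(\<omega> in M. \<exists>k\<in>K. \<alpha> \<le> \<bar>V r k \<omega>\<bar>) \<le> q"
  shows "\<P>(\<omega> in M. \<exists>r\<le>N. \<exists>k\<in>K. 3 * \<alpha> \<le> \<bar>V r k \<omega>\<bar>) \<le> 3 * q"
proof -
  define F where "F r = {\<omega>\<in>space M. (\<exists>k\<in>K. 3 * \<alpha> \<le> \<bar>V r k \<omega>\<bar>) \<and> (\<forall>s<r. \<forall>k\<in>K. \<bar>V s k \<omega>\<bar> < 3 * \<alpha>)}" for r
  define D where "D r = {\<omega>\<in>space M. \<exists>k\<in>K. 2 * \<alpha> \<le> \<bar>V N k \<omega> - V r k \<omega>\<bar>}" for r
  define T where "T r = {\<omega>\<in>space M. \<exists>k\<in>K. \<alpha> \<le> \<bar>V r k \<omega>\<bar>}" for r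
  have T: "T r \<in> events" if "r \<le> N" for r
    unfolding T_def using K rv[OF that] by (intro sets.sets_Collect_finite_Ex) measurable
  have D: "D r \<in> events" if "r \<le> N" for r
    unfolding D_def using K rv[OF that] rv[of N]
    by (intro sets.sets_Collect_finite_Ex) (auto intro!: borel_measurable_le)
  have F: "F r \<in> events" if "r \<le> N" for r
  proof -
    have 1: "{\<omega>\<in>space M. \<exists>k\<in>K. 3 * \<alpha> \<le> \<bar>V s k \<omega>\<bar>} \<in> events" if "s \<le> r" for s
      using K rv[of s] \<open>r \<le> N\<close> that by (intro sets.sets_Collect_finite_Ex) (auto intro!: borel_measurable_le)
    have "F r = {\<omega>\<in>space M. \<exists>k\<in>K. 3 * \<alpha> \<le> \<bar>V r k \<omega>\<bar>} - (\<Union>s<r. {\<omega>\<in>space M. \<exists>k\<in>K. 3 * \<alpha> \<le> \<bar>V s k \<omega>\<bar>})"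
      unfolding F_def by (auto simp: not_le) (meson not_less)
    also have "\<dots> \<in> events" using 1 by (intro sets.Diff sets.finite_UN) auto
    finally show ?thesis .
  qed
  \<comment> \<open>\<open>F r\<close> is the first passage at time \<open>r\<close>.\<close>
  have FD: "prob (F r \<inter> D r) = prob (F r) * prob (D r)" if "r \<le> N" for r
  proof -
    have "F r \<inter> D r = {\<omega>\<in>space M. ((\<exists>k\<in>K. 3 * \<alpha> \<le> \<bar>V r k \<omega>\<bar>) \<and> (\<forall>s<r. \<forall>k\<in>K. \<bar>V s k \<omega>\<bar> < 3 * \<alpha>)) \<and>
          (\<exists>k\<in>K. 2 * \<alpha> \<le> \<bar>V N k \<omega> - V r k \<omega>\<bar>)}"
      unfolding F_def D_def by blast
    then show ?thesis using indep[OF that] unfolding F_def D_def by simp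
  qed
  have D_le: "prob (D r) \<le> 2 * q" if r: "r \<le> N" for r
  proof -
    have "D r \<subseteq> T N \<union> T r"
      unfolding D_def T_def by (auto simp: abs_real_def split: if_splits) (smt (verit))+
    then have "prob (D r) \<le> prob (T N \<union> T r)" using T r by (intro finite_measure_mono) auto
    also have "\<dots> \<le> prob (T N) + prob (T r)" using T r by (intro measure_Un_le) auto
    finally show ?thesis using tail[OF r] tail[of N] by (simp add: T_def)
  qed
  have q: "0 \<le> q" using tail[of N] measure_nonneg order_trans by blast
  have disj: "disjoint_family_on F {..N}"
    unfolding disjoint_family_on_def F_def by (auto simp: not_le neq_iff) (meson not_le)+
  have "{\<omega>\<in>space M. \<exists>r\<le>N. \<exists>k\<in>K. 3 * \<alpha> \<le> \<bar>V r k \<omega>\<bar>} \<subseteq> T N \<union> (\<Union>r\<le>N. F r \<inter> D r)"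
  proof safe
    fix \<omega> r k assume \<omega>: "\<omega> \<in> space M" "\<omega> \<notin> (\<Union>r\<le>N. F r \<inter> D r)" "r \<le> N" "k \<in> K" "3 * \<alpha> \<le> \<bar>V r k \<omega>\<bar>"
    define m where "m = (LEAST r. \<exists>k\<in>K. 3 * \<alpha> \<le> \<bar>V r k \<omega>\<bar>)"
    have ex: "\<exists>k\<in>K. 3 * \<alpha> \<le> \<bar>V m k \<omega>\<bar>"
      unfolding m_def using \<omega> by (intro LeastI_ex[of "\<lambda>r. \<exists>k\<in>K. 3 * \<alpha> \<le> \<bar>V r k \<omega>\<bar>"]) blast
    have "m \<le> r" unfolding m_def using \<omega> by (intro Least_le) blast
    then have m: "m \<le> N" using \<omega> by simp
    have "\<bar>V s k \<omega>\<bar> < 3 * \<alpha>" if "s < m" "k \<in> K" for s k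
      using not_less_Least[OF that(1)[unfolded m_def]] that(2) by (meson not_le)
    then have "\<omega> \<in> F m" unfolding F_def using \<omega>(1) ex by blast
    then have "\<omega> \<notin> D m" using \<omega>(2) m by blast
    obtain k' where k': "k' \<in> K" "3 * \<alpha> \<le> \<bar>V m k' \<omega>\<bar>" using ex by blast
    have "\<bar>V N k' \<omega> - V m k' \<omega>\<bar> < 2 * \<alpha>" using \<open>\<omega> \<notin> D m\<close> k' \<omega>(1) unfolding D_def by (simp add: not_le)
    then have "\<alpha> \<le> \<bar>V N k' \<omega>\<bar>" using k'(2) by linarith
    then show "\<omega> \<in> T N" using k'(1) \<omega>(1) by (auto simp: T_def)
  qed
  then have "\<P>(\<omega> in M. \<exists>r\<le>N. \<exists>k\<in>K. 3 * \<alpha> \<le> \<bar>V r k \<omega>\<bar>) \<le> prob (T N \<union> (\<Union>r\<le>N. F r \<inter> D r))"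
    using T F D by (intro finite_measure_mono sets.Un sets.finite_UN) auto
  also have "\<dots> \<le> prob (T N) + prob (\<Union>r\<le>N. F r \<inter> D r)"
    using T F D by (intro measure_Un_le sets.finite_UN) auto
  also have "prob (\<Union>r\<le>N. F r \<inter> D r) \<le> (\<Sum>r\<le>N. prob (F r \<inter> D r))"
    using F D by (intro finite_measure_subadditive_finite) auto
  also have "\<dots> \<le> (\<Sum>r\<le>N. prob (F r) * (2 * q))"
    using D_le by (intro sum_mono) (auto simp: FD intro!: mult_left_mono)
  also have "\<dots> = prob (\<Union>r\<le>N. F r) * (2 * q)"
    using F disj by (subst finite_measure_finite_Union) (auto simp: sum_distrib_right)
  also have "\<dots> \<le> 1 * (2 * q)" using q by (intro mult_right_mono) auto
  finally show ?thesis using tail[of N] by (simp add: T_def)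
qed

lemma pred_abs_sum_PiM:
  assumes "C \<subseteq> A"
  shows "Measurable.pred (PiM A (\<lambda>_. borel :: real measure)) (\<lambda>z. a \<le> \<bar>\<Sum>j\<in>C. z j\<bar>)"
proof -
  have "(\<lambda>z. \<Sum>j\<in>C. z j) \<in> borel_measurable (PiM A (\<lambda>_. borel :: real measure))"
    using assms by (intro borel_measurable_sum measurable_component_singleton) auto
  then show ?thesis by measurable
qed

text \<open>Etemadi's inequality is applied to one coordinate after the other. For the set \<open>A\<close> of coordinates that
have been treated, the maximum over the positions that vary in \<open>A\<close> only is the norm for the next step;
each step costs a factor 3 in the level and in the probability.\<close>

lemma (in prob_space) maximal_inequality_partial_sums:
  fixes \<xi> :: "('n::finite \<Rightarrow> nat) \<Rightarrow> 'a \<Rightarrow> real"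
  defines "S \<equiv> \<lambda>k \<omega>. \<Sum>j\<in>index_box (\<lambda>_. 0) k. \<xi> j \<omega>"
  assumes ind: "indep_vars (\<lambda>_. borel) \<xi> (index_box (\<lambda>_. 0) (\<lambda>_. N))"
    and \<alpha>: "0 \<le> \<alpha>"
    and tail: "\<And>k. (\<And>i. k i \<le> N) \<Longrightarrow> \<P>(\<omega> in M. \<alpha> \<le> \<bar>S k \<omega>\<bar>) \<le> q"
  shows "\<P>(\<omega> in M. \<exists>k. (\<forall>i. k i \<le> N) \<and> 3 ^ CARD('n) * \<alpha> \<le> \<bar>S k \<omega>\<bar>) \<le> 3 ^ CARD('n) * q"
proof -
  let ?J = "index_box (\<lambda>_. 0) (\<lambda>_. N) :: ('n \<Rightarrow> nat) set"
  define G where "G A n = {k. (\<forall>i. k i \<le> N) \<and> (\<forall>i. i \<notin> A \<longrightarrow> k i = n i)}" for A and n :: "'n \<Rightarrow> nat"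
  have finG: "finite (G A n)" for A n
  proof (rule finite_subset)
    show "G A n \<subseteq> index_box (\<lambda>_. 0) (\<lambda>_. Suc N)"
      unfolding G_def index_box_def less_Suc_eq_le by blast
  qed simp
  have \<xi>: "\<xi> j \<in> borel_measurable M" if "j \<in> ?J" for j
    using ind that unfolding indep_vars_def by blast
  have box_mono: "index_box (\<lambda>_. 0) k \<subseteq> index_box (\<lambda>_. 0) k'" if "\<And>i. k i \<le> k' i" for k k' :: "'n \<Rightarrow> nat"
    using that by (auto simp: index_box_def intro: less_le_trans)
  have S: "S k \<in> borel_measurable M" if "\<And>i. k i \<le> N" for k
    unfolding S_def using box_mono[of k "\<lambda>_. N"] that \<xi> by (intro borel_measurable_sum) auto
  have main: "\<P>(\<omega> in M. \<exists>k\<in>G A n. 3 ^ card A * \<alpha> \<le> \<bar>S k \<omega>\<bar>) \<le> 3 ^ card A * q"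
    if "finite A" "\<And>i. n i \<le> N" for A n
    using that
  proof (induction A arbitrary: n rule: finite_induct)
    case empty
    then have "G {} n = {n}" by (auto simp: G_def)
    then show ?case using tail[OF empty] by simp
  next
    case (insert i A)
    let ?\<alpha> = "3 ^ card A * \<alpha>"
    let ?V = "\<lambda>r k. S (k(i := r))"
    have le: "(k(i := r)) l \<le> N" if "k \<in> G A n" "r \<le> N" for k r l
      using that by (auto simp: G_def)
    have G1: "(\<lambda>k. k(i := r)) ` G A n = G A (n(i := r))" if "r \<le> N" for r
    proof (intro equalityI subsetI)
      fix k assume "k \<in> G A (n(i := r))"
      then have "k(i := n i) \<in> G A n" "(k(i := n i))(i := r) = k"
        using insert.hyps insert.prems by (auto simp: G_def fun_eq_iff)
      then show "k \<in> (\<lambda>k. k(i := r)) ` G A n" by (metis imageI)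
    qed (use that insert.hyps in \<open>auto simp: G_def\<close>)
    have G2: "G (insert i A) n = (\<Union>r\<le>N. (\<lambda>k. k(i := r)) ` G A n)"
    proof (intro equalityI subsetI)
      fix k assume k: "k \<in> G (insert i A) n"
      then have "k \<in> G A (n(i := k i))" "k i \<le> N" by (auto simp: G_def)
      then show "k \<in> (\<Union>r\<le>N. (\<lambda>k. k(i := r)) ` G A n)" using G1 by blast
    qed (use insert.hyps in \<open>auto simp: G_def\<close>)
    have "\<P>(\<omega> in M. \<exists>r\<le>N. \<exists>k\<in>G A n. 3 * ?\<alpha> \<le> \<bar>?V r k \<omega>\<bar>) \<le> 3 * (3 ^ card A * q)"
    proof (rule etemadi[OF finG])
      show "?V r k \<in> borel_measurable M" if "r \<le> N" "k \<in> G A n" for r k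
        using le that by (intro S) auto
      show "0 \<le> ?\<alpha>" using \<alpha> by simp
      show "\<P>(\<omega> in M. \<exists>k\<in>G A n. ?\<alpha> \<le> \<bar>?V r k \<omega>\<bar>) \<le> 3 ^ card A * q" if "r \<le> N" for r
      proof -
        have "\<P>(\<omega> in M. \<exists>k\<in>G A (n(i := r)). ?\<alpha> \<le> \<bar>S k \<omega>\<bar>) \<le> 3 ^ card A * q"
          using insert.prems that by (intro insert.IH) simp
        then show ?thesis unfolding G1[OF that, symmetric] by simp
      qed
    next
      fix r assume r: "r \<le> N"
      \<comment> \<open>The first passage at \<open>r\<close> depends on the layers below \<open>r\<close>, the remaining increment on the others.\<close>
      define A1 where "A1 = {j \<in> ?J. j i < r}"
      define B1 where "B1 = {j \<in> ?J. r \<le> j i}"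
      let ?C = "\<lambda>k. index_box (\<lambda>_. 0) (k(i := N)) - index_box (\<lambda>_. 0) (k(i := r))"
      have C1: "index_box (\<lambda>_. 0) (k(i := s)) \<subseteq> A1" if "s \<le> r" "k \<in> G A n" for s k
      proof -
        have "index_box (\<lambda>_. 0) (k(i := s)) \<subseteq> ?J"
          using le[OF that(2), of s] that r by (intro box_mono) auto
        moreover have "j i < r" if "j \<in> index_box (\<lambda>_. 0) (k(i := s))" for j
          using that \<open>s \<le> r\<close> by (auto simp: index_box_def dest!: spec[of _ i])
        ultimately show ?thesis by (auto simp: A1_def)
      qed
      have C2: "?C k \<subseteq> B1" if "k \<in> G A n" for k
      proof -
        have "?C k \<subseteq> ?J" using box_mono[of "k(i := N)" "\<lambda>_. N"] le[OF that, of N] by auto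
        moreover have "r \<le> j i" if "j \<in> ?C k" for j
        proof (rule ccontr)
          assume "\<not> r \<le> j i"
          then have "j l < (k(i := r)) l" for l
            using that by (cases "l = i") (auto simp: index_box_def dest!: spec[of _ l])
          then show False using that by (auto simp: index_box_def)
        qed
        ultimately show ?thesis by (auto simp: B1_def)
      qed
      have eq1: "?V s k \<omega> = (\<Sum>j\<in>index_box (\<lambda>_. 0) (k(i := s)). (\<lambda>j\<in>A1. \<xi> j \<omega>) j)"
        if "s \<le> r" "k \<in> G A n" for s k \<omega>
        unfolding S_def using C1[OF that] by (intro sum.cong) auto
      have eq2: "?V N k \<omega> - ?V r k \<omega> = (\<Sum>j\<in>?C k. (\<lambda>j\<in>B1. \<xi> j \<omega>) j)" if "k \<in> G A n" for k \<omega>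
      proof -
        have "?V N k \<omega> - ?V r k \<omega> = (\<Sum>j\<in>?C k. \<xi> j \<omega>)"
          unfolding S_def using r by (intro sum_diff[symmetric] box_mono) auto
        also have "\<dots> = (\<Sum>j\<in>?C k. (\<lambda>j\<in>B1. \<xi> j \<omega>) j)"
          using C2[OF that] by (intro sum.cong) auto
        finally show ?thesis .
      qed
      define P where "P z \<longleftrightarrow> (\<exists>k\<in>G A n. 3 * ?\<alpha> \<le> \<bar>\<Sum>j\<in>index_box (\<lambda>_. 0) (k(i := r)). z j\<bar>) \<and>
        (\<forall>s\<in>{..<r}. \<forall>k\<in>G A n. \<not> 3 * ?\<alpha> \<le> \<bar>\<Sum>j\<in>index_box (\<lambda>_. 0) (k(i := s)). z j\<bar>)" for z :: "('n \<Rightarrow> nat) \<Rightarrow> real"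
      define Q where "Q z \<longleftrightarrow> (\<exists>k\<in>G A n. 2 * ?\<alpha> \<le> \<bar>\<Sum>j\<in>?C k. z j\<bar>)" for z :: "('n \<Rightarrow> nat) \<Rightarrow> real"
      have "Measurable.pred (PiM A1 (\<lambda>_. borel)) P"
        unfolding P_def using C1
        by (intro pred_intros_logic pred_intros_finite finG finite_lessThan pred_abs_sum_PiM) auto
      moreover have "Measurable.pred (PiM B1 (\<lambda>_. borel)) Q"
        unfolding Q_def using C2 by (intro pred_intros_finite finG pred_abs_sum_PiM) auto
      moreover have "A1 \<subseteq> ?J" "B1 \<subseteq> ?J" "A1 \<inter> B1 = {}" by (auto simp: A1_def B1_def)
      ultimately have "\<P>(\<omega> in M. P (\<lambda>j\<in>A1. \<xi> j \<omega>) \<and> Q (\<lambda>j\<in>B1. \<xi> j \<omega>)) =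
          \<P>(\<omega> in M. P (\<lambda>j\<in>A1. \<xi> j \<omega>)) * \<P>(\<omega> in M. Q (\<lambda>j\<in>B1. \<xi> j \<omega>))"
        by (intro prob_indep_blocks[OF ind])
      moreover have "P (\<lambda>j\<in>A1. \<xi> j \<omega>) \<longleftrightarrow>
          (\<exists>k\<in>G A n. 3 * ?\<alpha> \<le> \<bar>?V r k \<omega>\<bar>) \<and> (\<forall>s<r. \<forall>k\<in>G A n. \<bar>?V s k \<omega>\<bar> < 3 * ?\<alpha>)" for \<omega>
        unfolding P_def Ball_def[of "{..<r}"] lessThan_iff not_le using eq1 by (metis (no_types, lifting) less_imp_le order_refl)
      moreover have "Q (\<lambda>j\<in>B1. \<xi> j \<omega>) \<longleftrightarrow> (\<exists>k\<in>G A n. 2 * ?\<alpha> \<le> \<bar>?V N k \<omega> - ?V r k \<omega>\<bar>)" for \<omega>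
        unfolding Q_def using eq2 by simp
      ultimately show "\<P>(\<omega> in M. ((\<exists>k\<in>G A n. 3 * ?\<alpha> \<le> \<bar>?V r k \<omega>\<bar>) \<and>
            (\<forall>s<r. \<forall>k\<in>G A n. \<bar>?V s k \<omega>\<bar> < 3 * ?\<alpha>)) \<and> (\<exists>k\<in>G A n. 2 * ?\<alpha> \<le> \<bar>?V N k \<omega> - ?V r k \<omega>\<bar>)) =
          \<P>(\<omega> in M. (\<exists>k\<in>G A n. 3 * ?\<alpha> \<le> \<bar>?V r k \<omega>\<bar>) \<and> (\<forall>s<r. \<forall>k\<in>G A n. \<bar>?V s k \<omega>\<bar> < 3 * ?\<alpha>)) *
          \<P>(\<omega> in M. \<exists>k\<in>G A n. 2 * ?\<alpha> \<le> \<bar>?V N k \<omega> - ?V r k \<omega>\<bar>)"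
        by simp
    qed
    moreover have "(\<exists>k\<in>G (insert i A) n. 3 * ?\<alpha> \<le> \<bar>S k \<omega>\<bar>) \<longleftrightarrow>
        (\<exists>r\<le>N. \<exists>k\<in>G A n. 3 * ?\<alpha> \<le> \<bar>?V r k \<omega>\<bar>)" for \<omega>
      unfolding G2 by blast
    ultimately show ?case using insert.hyps by (simp add: mult.assoc)
  qed
  have "G UNIV n = {k. \<forall>i. k i \<le> N}" for n by (simp add: G_def)
  then show ?thesis using main[of UNIV "\<lambda>_. 0"] by simp
qed


section \<open>Polynomial growth of the paths under a moment condition\<close>

lemma (in prob_space) real_tight:
  fixes Y :: "'a \<Rightarrow> real"
  assumes [measurable]: "Y \<in> borel_measurable M" and "0 < e"
  shows "\<exists>n::nat. \<P>(\<omega> in M. real n < \<bar>Y \<omega>\<bar>) < e"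
proof -
  let ?A = "\<lambda>n::nat. {\<omega>\<in>space M. real n < \<bar>Y \<omega>\<bar>}"
  have "range ?A \<subseteq> events" by auto
  moreover have "decseq ?A" by (auto simp: decseq_def)
  ultimately have "(\<lambda>n. prob (?A n)) \<longlonglongrightarrow> prob (\<Inter>n. ?A n)"
    by (intro finite_Lim_measure_decseq) auto
  moreover have "(\<Inter>n. ?A n) = {}"
  proof -
    have "\<omega> \<notin> (\<Inter>n. ?A n)" for \<omega>
      using real_arch_simple[of "\<bar>Y \<omega>\<bar>"] by (auto simp: not_less)
    then show ?thesis by blast
  qed
  ultimately have "(\<lambda>n. prob (?A n)) \<longlonglongrightarrow> 0" by simp
  from eventually_happens'[OF sequentially_bot order_tendstoD(2)[OF this assms(2)]] show ?thesis .
qed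

context levy_field
begin

text \<open>If the tails were not uniformly small, a sequence of bad points would accumulate at some \<open>t\<close>, and
continuity in probability at \<open>t\<close> would keep the tails of \<open>X t\<close> away from 0.\<close>

lemma tight_on_compact:
  assumes K: "compact K" "K \<subseteq> orthant" and e: "0 < e"
  shows "\<exists>n::nat. \<forall>s\<in>K. \<P>(\<omega> in M. real n < \<bar>X s \<omega>\<bar>) < e"
proof (rule ccontr)
  assume "\<not> ?thesis"
  then have "\<forall>n. \<exists>s\<in>K. e \<le> \<P>(\<omega> in M. real n < \<bar>X s \<omega>\<bar>)" by (meson not_le)
  then obtain s where s: "\<And>n. s n \<in> K" "\<And>n. e \<le> \<P>(\<omega> in M. real n < \<bar>X (s n) \<omega>\<bar>)"
    by metis
  obtain t r where t: "t \<in> K" and r: "strict_mono r" "(s \<circ> r) \<longlonglongrightarrow> t"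
    using compact_imp_seq_compact[OF K(1)] s(1) by (metis seq_compactE)
  have tO: "t \<in> orthant" using t K(2) by (rule rev_subsetD)
  have sO: "s n \<in> orthant" for n using s(1) K(2) by (rule rev_subsetD)
  note [measurable] = random_field[OF tO] random_field[OF sO]
  obtain m where m: "\<P>(\<omega> in M. real m < \<bar>X t \<omega>\<bar>) < e / 2"
    using real_tight[of "X t" "e / 2"] e by auto
  have "eventually (\<lambda>s. \<P>(\<omega> in M. 1 < \<bar>X s \<omega> - X t \<omega>\<bar>) < e / 2) (at t within orthant)"
    using continuous_in_probability[OF tO, of 1] e by (intro order_tendstoD(2)[where y=0]) auto
  then obtain U where U: "open U" "t \<in> U"
    "\<And>s. s \<in> U \<Longrightarrow> s \<noteq> t \<Longrightarrow> s \<in> orthant \<Longrightarrow> \<P>(\<omega> in M. 1 < \<bar>X s \<omega> - X t \<omega>\<bar>) < e / 2"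
    unfolding eventually_at_topological by blast
  have "eventually (\<lambda>n. (s \<circ> r) n \<in> U) sequentially"
    using r(2) U(1,2) by (rule topological_tendstoD)
  then obtain n where n: "n \<ge> m + 1" "s (r n) \<in> U"
    unfolding eventually_sequentially by (metis comp_apply nle_le)
  have close: "\<P>(\<omega> in M. 1 < \<bar>X (s (r n)) \<omega> - X t \<omega>\<bar>) < e / 2"
  proof (cases "s (r n) = t")
    case True
    then show ?thesis using e by simp
  qed (use U(3) n(2) sO in blast)
  have "real (m + 1) \<le> real (r n)"
    using n(1) strict_mono_imp_increasing[OF r(1), of n] by linarith
  then have "{\<omega>\<in>space M. real (r n) < \<bar>X (s (r n)) \<omega>\<bar>} \<subseteq>
      {\<omega>\<in>space M. real m < \<bar>X t \<omega>\<bar>} \<union> {\<omega>\<in>space M. 1 < \<bar>X (s (r n)) \<omega> - X t \<omega>\<bar>}"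
    by auto
  then have "\<P>(\<omega> in M. real (r n) < \<bar>X (s (r n)) \<omega>\<bar>) \<le>
      prob ({\<omega>\<in>space M. real m < \<bar>X t \<omega>\<bar>} \<union> {\<omega>\<in>space M. 1 < \<bar>X (s (r n)) \<omega> - X t \<omega>\<bar>})"
    by (intro finite_measure_mono) auto
  also have "\<dots> \<le> \<P>(\<omega> in M. real m < \<bar>X t \<omega>\<bar>) + \<P>(\<omega> in M. 1 < \<bar>X (s (r n)) \<omega> - X t \<omega>\<bar>)"
    by (intro measure_Un_le) auto
  also have "\<dots> < e" using m close by simp
  finally show False using s(2)[of "r n"] by simp
qed

abbreviation Inc :: "real^'n \<Rightarrow> real^'n \<Rightarrow> 'a \<Rightarrow> real" where
  "Inc a b \<omega> \<equiv> increment (\<lambda>t. X t \<omega>) a b"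

definition tail :: "real \<Rightarrow> real" where
  "tail a = \<P>(\<omega> in M. a \<le> \<bar>X (\<chi> i. 1) \<omega>\<bar>)"

lemma prob_Inc_tail:
  assumes "0 \<le> a" "a \<le> b"
  shows "\<P>(\<omega> in M. z \<le> \<bar>Inc a b \<omega>\<bar>) = \<P>(\<omega> in M. z \<le> \<bar>X (b - a) \<omega>\<bar>)"
    "\<P>(\<omega> in M. z < \<bar>Inc a b \<omega>\<bar>) = \<P>(\<omega> in M. z < \<bar>X (b - a) \<omega>\<bar>)"
proof -
  have "{y::real. z \<le> \<bar>y\<bar>} \<in> sets borel" "{y::real. z < \<bar>y\<bar>} \<in> sets borel" by measurable
  from this[THEN prob_increment[OF assms]]
  show "\<P>(\<omega> in M. z \<le> \<bar>Inc a b \<omega>\<bar>) = \<P>(\<omega> in M. z \<le> \<bar>X (b - a) \<omega>\<bar>)"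
    "\<P>(\<omega> in M. z < \<bar>Inc a b \<omega>\<bar>) = \<P>(\<omega> in M. z < \<bar>X (b - a) \<omega>\<bar>)"
    by simp_all
qed

text \<open>For \<open>s\<close> in the unit cube, \<open>X\<close> at \<open>(1, \<dots>, 1)\<close> is \<open>X s\<close> plus an independent remainder. By tightness
the remainder is at most \<open>c\<close> with probability at least \<open>1/2\<close>, uniformly in \<open>s\<close>; hence a large value of
\<open>X s\<close> entails a large value at \<open>(1, \<dots>, 1)\<close> with conditional probability at least \<open>1/2\<close>.\<close>

lemma tail_unit_cube:
  "\<exists>c\<ge>0. \<forall>s a. 0 \<le> s \<longrightarrow> (\<forall>i. s $ i \<le> 1) \<longrightarrow> \<P>(\<omega> in M. a + c \<le> \<bar>X s \<omega>\<bar>) \<le> 2 * tail a"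
proof -
  let ?one = "\<chi> i. 1 :: real^'n"
  define K where "K = cbox (0::real^'n) (\<chi> i. 1)"
  have inK: "s \<in> K \<longleftrightarrow> 0 \<le> s \<and> (\<forall>i. s $ i \<le> 1)" for s
    by (auto simp: K_def mem_box_cart less_eq_vec_def)
  have "compact K" "K \<subseteq> orthant" using inK by (auto simp: K_def)
  then obtain m where m: "\<And>s. s \<in> K \<Longrightarrow> \<P>(\<omega> in M. real m < \<bar>X s \<omega>\<bar>) < 1/4"
    using tight_on_compact[of K "1/4"] by auto
  define c where "c = 2 * real m"
  have "\<P>(\<omega> in M. a + c \<le> \<bar>X s \<omega>\<bar>) \<le> 2 * tail a" if s: "0 \<le> s" "\<And>i. s $ i \<le> 1" for s a
  proof -
    \<comment> \<open>With the partition \<open>0, s\<^sub>i, 1\<close> the box of \<open>s\<close> is a single cell of the unit cube.\<close>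
    define g where "g i j = (if j = 0 then 0 else if j = 1 then s $ i else 1)" for i and j :: nat
    let ?\<xi> = "\<lambda>k \<omega>. cell_increment g (\<lambda>t. X t \<omega>) k"
    let ?J = "index_box (\<lambda>_. 0) (\<lambda>_. 2) :: ('n \<Rightarrow> nat) set"
    have s0: "0 \<le> s $ i" for i using s(1) by (simp add: less_eq_vec_def)
    have "mono (g i)" for i
      using s(2)[of i] s0[of i] by (auto simp: g_def mono_def)
    then have ind: "indep_vars (\<lambda>_. borel) ?\<xi> ?J"
      by (intro indep_cells) (auto simp: g_def)
    have g: "grid_point g (\<lambda>_. 0) = 0" "grid_point g (\<lambda>_. 1) = s" "grid_point g (\<lambda>_. 2) = (\<chi> i. 1)"
      by (auto simp: g_def grid_point_def vec_eq_iff)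
    define k0 where "k0 = (\<lambda>_::'n. 0::nat)"
    have k0: "index_box (\<lambda>_. 0) (\<lambda>_. 1) = {k0}" by (auto simp: index_box_def k0_def)
    have Is: "Inc 0 s \<omega> = ?\<xi> k0 \<omega>" for \<omega>
      using increment_eq_sum_cells[of "\<lambda>_. 0" "\<lambda>_. 1" "\<lambda>t. X t \<omega>" g] unfolding g k0 by simp
    have I1: "Inc 0 (\<chi> i. 1) \<omega> = ?\<xi> k0 \<omega> + (\<Sum>k\<in>?J - {k0}. ?\<xi> k \<omega>)" for \<omega>
    proof -
      have "k0 \<in> ?J" by (simp add: k0_def index_box_def)
      then show ?thesis
        using increment_eq_sum_cells[of "\<lambda>_. 0" "\<lambda>_. 2" "\<lambda>t. X t \<omega>" g] unfolding g by (simp add: sum.remove)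
    qed
    have s1: "s \<le> (\<chi> i. 1)" "0 \<le> ((\<chi> i. 1)::real^'n)" using s(2) by (auto simp: less_eq_vec_def)
    note [measurable] = increment_measurable[OF order_refl s(1)] increment_measurable[OF order_refl s1(2)]
    let ?R = "\<lambda>\<omega>. Inc 0 (\<chi> i. 1) \<omega> - Inc 0 s \<omega>"
    have "\<P>(\<omega> in M. a + c \<le> \<bar>\<Sum>k\<in>{k0}. (\<lambda>k\<in>{k0}. ?\<xi> k \<omega>) k\<bar> \<and>
          \<not> (c < \<bar>\<Sum>k\<in>?J - {k0}. (\<lambda>k\<in>?J - {k0}. ?\<xi> k \<omega>) k\<bar>)) =
        \<P>(\<omega> in M. a + c \<le> \<bar>\<Sum>k\<in>{k0}. (\<lambda>k\<in>{k0}. ?\<xi> k \<omega>) k\<bar>) *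
        \<P>(\<omega> in M. \<not> (c < \<bar>\<Sum>k\<in>?J - {k0}. (\<lambda>k\<in>?J - {k0}. ?\<xi> k \<omega>) k\<bar>))"
    proof (rule prob_indep_blocks[OF ind])
      have "(\<lambda>z. \<Sum>k\<in>?J - {k0}. z k) \<in> borel_measurable (PiM (?J - {k0}) (\<lambda>_. borel :: real measure))"
        by (intro borel_measurable_sum measurable_component_singleton)
      then show "Measurable.pred (PiM (?J - {k0}) (\<lambda>_. borel)) (\<lambda>z. \<not> (c < \<bar>\<Sum>k\<in>?J - {k0}. z k\<bar>))"
        by measurable
    qed (auto intro: pred_abs_sum_PiM simp: k0_def index_box_def)
    then have "\<P>(\<omega> in M. a + c \<le> \<bar>Inc 0 s \<omega>\<bar> \<and> \<not> (c < \<bar>?R \<omega>\<bar>)) =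
        \<P>(\<omega> in M. a + c \<le> \<bar>Inc 0 s \<omega>\<bar>) * \<P>(\<omega> in M. \<not> (c < \<bar>?R \<omega>\<bar>))"
      by (simp add: Is I1)
    moreover have "1/2 \<le> \<P>(\<omega> in M. \<not> (c < \<bar>?R \<omega>\<bar>))"
    proof -
      have "\<P>(\<omega> in M. c < \<bar>?R \<omega>\<bar>) \<le>
          prob ({\<omega>\<in>space M. real m < \<bar>Inc 0 s \<omega>\<bar>} \<union> {\<omega>\<in>space M. real m < \<bar>Inc 0 (\<chi> i. 1) \<omega>\<bar>})"
        by (intro finite_measure_mono) (auto simp: c_def)
      also have "\<dots> \<le> \<P>(\<omega> in M. real m < \<bar>Inc 0 s \<omega>\<bar>) + \<P>(\<omega> in M. real m < \<bar>Inc 0 (\<chi> i. 1) \<omega>\<bar>)"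
        by (intro measure_Un_le) auto
      also have "\<dots> < 1/2"
        using m[of s] m[of "\<chi> i. 1"] s s1 inK prob_Inc_tail(2)[OF order_refl] by simp
      finally show ?thesis by (subst prob_neg) auto
    qed
    moreover have "\<P>(\<omega> in M. a + c \<le> \<bar>Inc 0 s \<omega>\<bar> \<and> \<not> (c < \<bar>?R \<omega>\<bar>)) \<le>
        \<P>(\<omega> in M. a \<le> \<bar>Inc 0 (\<chi> i. 1) \<omega>\<bar>)"
      by (intro finite_measure_mono) auto
    moreover have "\<P>(\<omega> in M. a \<le> \<bar>Inc 0 (\<chi> i. 1) \<omega>\<bar>) = tail a"
      using prob_Inc_tail(1)[OF order_refl s1(2), of a] by (simp add: tail_def)
    moreover have "\<P>(\<omega> in M. a + c \<le> \<bar>Inc 0 s \<omega>\<bar>) = \<P>(\<omega> in M. a + c \<le> \<bar>X s \<omega>\<bar>)"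
      using prob_Inc_tail(1)[OF order_refl s(1), of "a + c"] by simp
    moreover have "p * (1/2) \<le> p * q" if "1/2 \<le> q" "0 \<le> p" for p q :: real
      using that by (rule mult_left_mono)
    from this[OF calculation(2) measure_nonneg]
    have "\<P>(\<omega> in M. a + c \<le> \<bar>Inc 0 s \<omega>\<bar>) * (1/2) \<le>
        \<P>(\<omega> in M. a + c \<le> \<bar>Inc 0 s \<omega>\<bar>) * \<P>(\<omega> in M. \<not> (c < \<bar>?R \<omega>\<bar>))" .
    ultimately show ?thesis by linarith
  qed
  moreover have "0 \<le> c" by (simp add: c_def)
  ultimately show ?thesis by blast
qed

lemma card_index_box: "card (index_box (\<lambda>_. 0) (\<lambda>_. N) :: ('n \<Rightarrow> nat) set) = N ^ CARD('n)"
proof -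
  have "index_box (\<lambda>_. 0) (\<lambda>_. N) = (PiE UNIV (\<lambda>_. {..<N}) :: ('n \<Rightarrow> nat) set)"
    by (auto simp: index_box_def PiE_def Pi_def)
  then show ?thesis by (simp add: card_PiE)
qed

text \<open>The box \<open>]0, t]\<close> is cut along the integers into \<open>N\<^sup>d\<close> boxes of side at most 1. If the total
increment is large, so is the increment over one of them, which is a translate of a box in the
unit cube.\<close>

lemma tail_cube:
  assumes c: "0 \<le> c" "\<And>s a. 0 \<le> s \<Longrightarrow> (\<And>i. s $ i \<le> 1) \<Longrightarrow> \<P>(\<omega> in M. a + c \<le> \<bar>X s \<omega>\<bar>) \<le> 2 * tail a"
    and t: "0 \<le> t" "\<And>i. t $ i \<le> real N" and N: "0 < N"
  shows "\<P>(\<omega> in M. real (N ^ CARD('n)) * (a + c) \<le> \<bar>Inc 0 t \<omega>\<bar>) \<le> real (N ^ CARD('n)) * (2 * tail a)"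
proof -
  define g where "g i j = min (real j) (t $ i)" for i and j :: nat
  let ?\<xi> = "\<lambda>k \<omega>. cell_increment g (\<lambda>t. X t \<omega>) k"
  let ?J = "index_box (\<lambda>_. 0) (\<lambda>_. N) :: ('n \<Rightarrow> nat) set"
  have t0: "0 \<le> t $ i" for i using t(1) by (simp add: less_eq_vec_def)
  have g: "grid_point g (\<lambda>_. 0) = 0" "grid_point g (\<lambda>_. N) = t"
    using t0 t(2) by (simp_all add: g_def grid_point_def vec_eq_iff min_absorb1 min_absorb2)
  have It: "Inc 0 t \<omega> = (\<Sum>k\<in>?J. ?\<xi> k \<omega>)" for \<omega>
    using increment_eq_sum_cells[of "\<lambda>_. 0" "\<lambda>_. N" "\<lambda>t. X t \<omega>" g] unfolding g by simp
  have pos: "0 \<le> grid_point g k" "grid_point g k \<le> grid_point g (\<lambda>i. Suc (k i))"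
    "0 \<le> grid_point g (\<lambda>i. Suc (k i)) - grid_point g k"
    "(grid_point g (\<lambda>i. Suc (k i)) - grid_point g k) $ i \<le> 1" for k i
    using t0 by (auto simp: g_def grid_point_def less_eq_vec_def min_def)
  have pos': "0 \<le> grid_point g (\<lambda>i. Suc (k i))" for k
    using t0 by (auto simp: g_def grid_point_def less_eq_vec_def min_def)
  have meas: "{\<omega>\<in>space M. a + c \<le> \<bar>?\<xi> k \<omega>\<bar>} \<in> events" for k
    using increment_measurable[OF pos(1)[of k] pos'[of k]] unfolding cell_increment_def by measurable
  have "{\<omega>\<in>space M. real (N ^ CARD('n)) * (a + c) \<le> \<bar>Inc 0 t \<omega>\<bar>} \<subseteq> (\<Union>k\<in>?J. {\<omega>\<in>space M. a + c \<le> \<bar>?\<xi> k \<omega>\<bar>})"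
  proof safe
    fix \<omega> assume \<omega>: "\<omega> \<in> space M" "real (N ^ CARD('n)) * (a + c) \<le> \<bar>Inc 0 t \<omega>\<bar>"
    show "\<omega> \<in> (\<Union>k\<in>?J. {\<omega>\<in>space M. a + c \<le> \<bar>?\<xi> k \<omega>\<bar>})"
    proof (rule ccontr)
      assume "\<not> ?thesis"
      then have *: "\<bar>?\<xi> k \<omega>\<bar> < a + c" if "k \<in> ?J" for k using \<omega>(1) that by (auto simp: not_le)
      have "(\<lambda>_. 0) \<in> ?J" using N by (simp add: index_box_def)
      then have "?J \<noteq> {}" by blast
      have "\<bar>Inc 0 t \<omega>\<bar> \<le> (\<Sum>k\<in>?J. \<bar>?\<xi> k \<omega>\<bar>)" unfolding It by (rule sum_abs)
      also have "\<dots> < (\<Sum>k\<in>?J. a + c)" using * \<open>?J \<noteq> {}\<close> by (intro sum_strict_mono) auto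
      finally show False using \<omega>(2) by (simp add: card_index_box)
    qed
  qed
  then have "\<P>(\<omega> in M. real (N ^ CARD('n)) * (a + c) \<le> \<bar>Inc 0 t \<omega>\<bar>) \<le>
      prob (\<Union>k\<in>?J. {\<omega>\<in>space M. a + c \<le> \<bar>?\<xi> k \<omega>\<bar>})"
    using meas by (intro finite_measure_mono sets.finite_UN) auto
  also have "\<dots> \<le> (\<Sum>k\<in>?J. \<P>(\<omega> in M. a + c \<le> \<bar>?\<xi> k \<omega>\<bar>))"
    using meas by (intro finite_measure_subadditive_finite) auto
  also have "\<dots> \<le> (\<Sum>k\<in>?J. 2 * tail a)"
  proof (rule sum_mono)
    fix k
    show "\<P>(\<omega> in M. a + c \<le> \<bar>?\<xi> k \<omega>\<bar>) \<le> 2 * tail a"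
      unfolding cell_increment_def prob_Inc_tail(1)[OF pos(1,2)] by (rule c(2)[OF pos(3,4)])
  qed
  finally show ?thesis by (simp add: card_index_box)
qed

end

context levy_field
begin

lemma tail_markov:
  assumes fin: "(\<integral>\<^sup>+ \<omega>. ennreal (\<bar>X (\<chi> i. 1) \<omega>\<bar> powr \<eta>) \<partial>M) < \<infinity>" and "0 < \<eta>" "0 < a"
  shows "a powr \<eta> * tail a \<le> enn2real (\<integral>\<^sup>+ \<omega>. ennreal (\<bar>X (\<chi> i. 1) \<omega>\<bar> powr \<eta>) \<partial>M)"
proof -
  let ?A = "{\<omega>\<in>space M. a \<le> \<bar>X (\<chi> i. 1) \<omega>\<bar>}"
  have [measurable]: "X (\<chi> i. 1) \<in> borel_measurable M"
    by (rule random_field) (simp add: less_eq_vec_def)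
  have "ennreal (a powr \<eta> * tail a) = (\<integral>\<^sup>+ \<omega>. ennreal (a powr \<eta>) * indicator ?A \<omega> \<partial>M)"
    unfolding tail_def by (subst nn_integral_cmult_indicator) (auto simp: emeasure_eq_measure ennreal_mult)
  also have "\<dots> \<le> (\<integral>\<^sup>+ \<omega>. ennreal (\<bar>X (\<chi> i. 1) \<omega>\<bar> powr \<eta>) \<partial>M)"
    using assms by (intro nn_integral_mono) (auto simp: indicator_def intro!: ennreal_leI powr_mono2)
  finally have "enn2real (ennreal (a powr \<eta> * tail a)) \<le> enn2real (\<integral>\<^sup>+ \<omega>. ennreal (\<bar>X (\<chi> i. 1) \<omega>\<bar> powr \<eta>) \<partial>M)"
    using fin by (intro enn2real_mono) auto
  then show ?thesis by (simp add: tail_def)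
qed

text \<open>The maximal inequality on each dyadic grid has the same bound, and the grids increase with the level.\<close>

lemma maximal_dyadic:
  assumes c: "0 \<le> c" "\<And>s a. 0 \<le> s \<Longrightarrow> (\<And>i. s $ i \<le> 1) \<Longrightarrow> \<P>(\<omega> in M. a + c \<le> \<bar>X s \<omega>\<bar>) \<le> 2 * tail a"
    and N: "0 < N" and a: "0 \<le> a"
  defines "A \<equiv> {\<omega>\<in>space M. \<exists>n k. (\<forall>i. k i \<le> N * 2 ^ n) \<and>
    3 ^ CARD('n) * (real (N ^ CARD('n)) * (a + c)) \<le> \<bar>Inc 0 (grid_point (dyadic_grid n) k) \<omega>\<bar>}"
  shows "A \<in> events" "prob A \<le> 3 ^ CARD('n) * (real (N ^ CARD('n)) * (2 * tail a))"
proof -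
  let ?b = "real (N ^ CARD('n)) * (a + c)"
  define B where "B n = {\<omega>\<in>space M. \<exists>k. (\<forall>i. k i \<le> N * 2 ^ n) \<and>
    3 ^ CARD('n) * ?b \<le> \<bar>Inc 0 (grid_point (dyadic_grid n) k) \<omega>\<bar>}" for n
  have B_bound: "prob (B n) \<le> 3 ^ CARD('n) * (real (N ^ CARD('n)) * (2 * tail a))" for n
  proof -
    let ?\<xi> = "\<lambda>k \<omega>. cell_increment (dyadic_grid n) (\<lambda>t. X t \<omega>) k"
    have S: "(\<Sum>j\<in>index_box (\<lambda>_. 0) k. ?\<xi> j \<omega>) = Inc 0 (grid_point (dyadic_grid n) k) \<omega>" for k \<omega>
      using increment_eq_sum_cells[of "\<lambda>_. 0" k "\<lambda>t. X t \<omega>" "dyadic_grid n"]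
      by (simp add: dyadic_grid_props(3))
    have "\<P>(\<omega> in M. \<exists>k. (\<forall>i. k i \<le> N * 2 ^ n) \<and>
        3 ^ CARD('n) * ?b \<le> \<bar>\<Sum>j\<in>index_box (\<lambda>_. 0) k. ?\<xi> j \<omega>\<bar>)
        \<le> 3 ^ CARD('n) * (real (N ^ CARD('n)) * (2 * tail a))"
    proof (rule maximal_inequality_partial_sums)
      show "indep_vars (\<lambda>_. borel) ?\<xi> (index_box (\<lambda>_. 0) (\<lambda>_. N * 2 ^ n))"
        by (intro indep_cells dyadic_grid_props finite_index_box)
      show "0 \<le> ?b" using a c(1) by simp
      fix k :: "'n \<Rightarrow> nat" assume k: "\<And>i. k i \<le> N * 2 ^ n"
      have "grid_point (dyadic_grid n) k $ i \<le> real N" for i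
      proof -
        have "real (k i) \<le> real (N * 2 ^ n)" using k by (rule of_nat_mono)
        then show ?thesis by (simp add: grid_point_def divide_simps)
      qed
      then show "\<P>(\<omega> in M. ?b \<le> \<bar>\<Sum>j\<in>index_box (\<lambda>_. 0) k. ?\<xi> j \<omega>\<bar>) \<le> real (N ^ CARD('n)) * (2 * tail a)"
        unfolding S by (intro tail_cube[OF c dyadic_grid_props(4) _ N]) auto
    qed
    then show ?thesis unfolding S B_def .
  qed
  have B_event: "B n \<in> events" for n
  proof -
    have [measurable]: "Inc 0 (grid_point (dyadic_grid n) k) \<in> borel_measurable M" for k
      by (intro increment_measurable dyadic_grid_props order_refl)
    have "B n = (\<Union>k\<in>index_box (\<lambda>_. 0) (\<lambda>_. Suc (N * 2 ^ n)). {\<omega>\<in>space M. 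
        3 ^ CARD('n) * ?b \<le> \<bar>Inc 0 (grid_point (dyadic_grid n) k) \<omega>\<bar>})"
      unfolding B_def index_box_def less_Suc_eq_le by blast
    also have "\<dots> \<in> events" by (intro sets.finite_UN finite_index_box) measurable
    finally show ?thesis .
  qed
  have AB: "A = (\<Union>n. B n)" unfolding A_def B_def by blast
  then show "A \<in> events" using B_event by blast
  have "incseq B"
  proof (rule incseq_SucI)
    fix n
    show "B n \<subseteq> B (Suc n)"
    proof
      fix \<omega> assume "\<omega> \<in> B n"
      then obtain k where k: "\<omega> \<in> space M" "\<And>i. k i \<le> N * 2 ^ n"
        "3 ^ CARD('n) * ?b \<le> \<bar>Inc 0 (grid_point (dyadic_grid n) k) \<omega>\<bar>"
        unfolding B_def by blast
      have "grid_point (dyadic_grid (Suc n)) (\<lambda>i. 2 * k i) = grid_point (dyadic_grid n) k"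
        by (auto simp: grid_point_def vec_eq_iff)
      with k show "\<omega> \<in> B (Suc n)"
        unfolding B_def by (intro CollectI conjI exI[of _ "\<lambda>i. 2 * k i"]) (auto simp: mult.left_commute)
    qed
  qed
  then have "(\<lambda>n. prob (B n)) \<longlonglongrightarrow> prob A"
    unfolding AB using B_event by (intro finite_Lim_measure_incseq) auto
  then show "prob A \<le> 3 ^ CARD('n) * (real (N ^ CARD('n)) * (2 * tail a))"
    using B_bound by (intro LIMSEQ_le_const2) auto
qed

text \<open>At the level \<open>N\<^sup>p\<close> with \<open>p \<eta> \<ge> d + 2\<close> the bounds of the maximal inequality in the cube of side \<open>N\<close> are of
order \<open>N\<^sup>-\<^sup>2\<close>, hence summable. By the Borel-Cantelli lemma the bound holds at the dyadic points of all
large cubes, and the lamp property extends it to all points.\<close>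

lemma AE_polynomial_growth:
  assumes "0 < \<eta>" and fin: "(\<integral>\<^sup>+ \<omega>. ennreal (\<bar>X (\<chi> i. 1) \<omega>\<bar> powr \<eta>) \<partial>M) < \<infinity>"
  shows "AE \<omega> in M. lamp (\<lambda>t. X t \<omega>) \<and> (\<exists>C p. \<forall>t\<in>orthant. \<bar>X t \<omega>\<bar> \<le> C * (1 + norm t) ^ p)"
proof -
  let ?d = "CARD('n)"
  obtain c where c: "0 \<le> c"
    "\<And>s a. 0 \<le> s \<Longrightarrow> (\<And>i. s $ i \<le> 1) \<Longrightarrow> \<P>(\<omega> in M. a + c \<le> \<bar>X s \<omega>\<bar>) \<le> 2 * tail a"
    using tail_unit_cube by blast
  define m where "m = enn2real (\<integral>\<^sup>+ \<omega>. ennreal (\<bar>X (\<chi> i. 1) \<omega>\<bar> powr \<eta>) \<partial>M)"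
  obtain p :: nat where "real (?d + 2) / \<eta> \<le> real p" using real_arch_simple by blast
  then have p: "real (?d + 2) \<le> real p * \<eta>" using \<open>0 < \<eta>\<close> by (simp add: field_simps)
  define A where "A n = {\<omega>\<in>space M. \<exists>l k. (\<forall>i. k i \<le> Suc n * 2 ^ l) \<and>
    3 ^ ?d * (real (Suc n ^ ?d) * (real (Suc n) ^ p + c)) \<le> \<bar>Inc 0 (grid_point (dyadic_grid l) k) \<omega>\<bar>}" for n
  have A: "A n \<in> events" "prob (A n) \<le> 3 ^ ?d * (real (Suc n ^ ?d) * (2 * tail (real (Suc n) ^ p)))" for n
    unfolding A_def by (rule maximal_dyadic[OF c]; simp)+
  have bnd: "prob (A n) \<le> 3 ^ ?d * 2 * m * inverse (real (Suc n) ^ 2)" for n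
  proof -
    define N where "N = real (Suc n)"
    have N: "1 \<le> N" "0 < N" by (simp_all add: N_def)
    have "N ^ (?d + 2) = N powr real (?d + 2)" using N by (simp only: powr_realpow)
    also have "\<dots> \<le> N powr (real p * \<eta>)" using p N by (intro powr_mono) auto
    also have "\<dots> = (N ^ p) powr \<eta>" using N by (simp add: powr_powr flip: powr_realpow)
    finally have "N ^ (?d + 2) * tail (N ^ p) \<le> (N ^ p) powr \<eta> * tail (N ^ p)"
      by (rule mult_right_mono) (simp add: tail_def)
    also have "\<dots> \<le> m" unfolding m_def using N by (intro tail_markov[OF fin \<open>0 < \<eta>\<close>]) simp
    finally have "N ^ 2 * (N ^ ?d * tail (N ^ p)) \<le> m"
      by (simp add: power_add power2_eq_square mult_ac)
    then have "N ^ ?d * tail (N ^ p) \<le> m * inverse (N ^ 2)"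
      using N by (simp add: divide_inverse[symmetric] pos_le_divide_eq power2_eq_square mult_ac)
    then have "3 ^ ?d * 2 * (N ^ ?d * tail (N ^ p)) \<le> 3 ^ ?d * 2 * (m * inverse (N ^ 2))"
      by (rule mult_left_mono) simp
    moreover have "prob (A n) \<le> 3 ^ ?d * 2 * (N ^ ?d * tail (N ^ p))"
      using A(2)[of n] by (simp only: N_def of_nat_power mult.assoc mult.left_commute)
    ultimately show ?thesis unfolding N_def[symmetric] mult.assoc by (rule order_trans[rotated])
  qed
  have sumg: "summable (\<lambda>n. 3 ^ ?d * 2 * m * inverse (real (Suc n) ^ 2))"
    using inverse_power_summable[of 2, where 'a=real]
    by (intro summable_mult) (subst summable_Suc_iff, simp)
  have "summable (\<lambda>n. prob (A n))"
  proof (rule summable_comparison_test'[OF sumg, of 0])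
    show "norm (prob (A n)) \<le> 3 ^ ?d * 2 * m * inverse (real (Suc n) ^ 2)" for n
      unfolding real_norm_def abs_of_nonneg[OF measure_nonneg] by (rule bnd)
  qed
  then have "AE \<omega> in M. eventually (\<lambda>n. \<omega> \<in> space M - A n) sequentially"
    using A(1) by (intro borel_cantelli_AE1) (simp_all add: emeasure_eq_measure)
  with AE_lamp show ?thesis
  proof eventually_elim
    case (elim \<omega>)
    let ?x = "\<lambda>t. X t \<omega>"
    obtain n0 where n0: "\<And>n. n0 \<le> n \<Longrightarrow> \<omega> \<in> space M - A n"
      using elim(2) unfolding eventually_sequentially by blast
    have grid_bound: "\<bar>Inc 0 (grid_point (dyadic_grid l) k) \<omega>\<bar> < 3 ^ ?d * (real N ^ ?d * (real N ^ p + c))"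
      if "n0 < N" "\<And>i. k i \<le> N * 2 ^ l" for N l k
    proof -
      have N: "Suc (N - 1) = N" using that(1) by simp
      have "\<omega> \<in> space M - A (N - 1)" using that(1) by (intro n0) simp
      then show ?thesis
        using that(2) unfolding A_def N not_le[symmetric] of_nat_power by blast
    qed
    define q where "q = ?d + p"
    define C where "C = 3 ^ ?d * ((1 + c) * real (n0 + 2) ^ q)"
    have "\<bar>?x t\<bar> \<le> C * (1 + norm t) ^ q" if t: "t \<in> orthant" for t
    proof -
      define N where "N = n0 + 1 + nat \<lfloor>norm t\<rfloor>"
      let ?B = "3 ^ ?d * (real N ^ ?d * (real N ^ p + c))"
      have N: "norm t < real N" "real N \<le> real n0 + 1 + norm t" "1 \<le> real N" "n0 < N"
      proof -
        define f where "f = nat \<lfloor>norm t\<rfloor>"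
        have "real f \<le> norm t" "norm t < real f + 1"
          using norm_ge_zero[of t] unfolding f_def by linarith+
        moreover have "N = n0 + 1 + f" by (simp add: N_def f_def)
        ultimately show "norm t < real N" "real N \<le> real n0 + 1 + norm t" "1 \<le> real N" "n0 < N"
          by simp_all
      qed
      have t0: "0 \<le> t $ i" for i using t by (simp add: less_eq_vec_def)
      have tN: "t $ i < real N" for i
        using component_le_norm_cart[of t i] N(1) by linarith
      have bound: "\<bar>?x (dyadic_above l t)\<bar> \<le> ?B" for l
      proof -
        define k where "k i = nat (\<lfloor>2 ^ l * t $ i\<rfloor> + 1)" for i
        have "0 \<le> \<lfloor>2 ^ l * t $ i\<rfloor>" for i using t0 by simp
        then have kt: "grid_point (dyadic_grid l) k = dyadic_above l t"
          by (simp add: grid_point_def dyadic_above_def k_def vec_eq_iff)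
        have "k i \<le> N * 2 ^ l" for i
        proof -
          have "2 ^ l * t $ i < real_of_int (int (N * 2 ^ l))"
            using tN[of i] by (simp add: mult.commute)
          then have "\<lfloor>2 ^ l * t $ i\<rfloor> < int (N * 2 ^ l)" by (simp only: floor_less_iff)
          then show ?thesis unfolding k_def by linarith
        qed
        then have "\<bar>Inc 0 (dyadic_above l t) \<omega>\<bar> < ?B"
          unfolding kt[symmetric] by (rule grid_bound[OF N(4)])
        moreover have "dyadic_above l t \<in> orthant"
          unfolding kt[symmetric] using dyadic_grid_props(4) by simp
        ultimately show ?thesis
          using increment_from_zero[OF elim(1)] by simp
      qed
      have "(\<lambda>l. \<bar>?x (dyadic_above l t)\<bar>) \<longlonglongrightarrow> \<bar>?x t\<bar>"
        by (intro tendsto_rabs lamp_tendsto_above[OF elim(1) t] dyadic_above_tendsto dyadic_above_bounds)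
      then have "\<bar>?x t\<bar> \<le> ?B" using bound by (intro LIMSEQ_le_const2) blast+
      also have "?B \<le> 3 ^ ?d * (real N ^ ?d * ((1 + c) * real N ^ p))"
      proof -
        have "c * 1 \<le> c * real N ^ p" using c(1) N(3) by (intro mult_left_mono one_le_power)
        then have "real N ^ p + c \<le> (1 + c) * real N ^ p" by (simp add: algebra_simps)
        then show ?thesis by (intro mult_left_mono) simp_all
      qed
      also have "\<dots> = 3 ^ ?d * ((1 + c) * real N ^ q)" by (simp add: q_def power_add)
      also have "\<dots> \<le> 3 ^ ?d * ((1 + c) * (real (n0 + 2) * (1 + norm t)) ^ q)"
      proof (intro mult_left_mono power_mono)
        have "real n0 + 1 + norm t \<le> real (n0 + 2) * (1 + norm t)"
          by (simp add: algebra_simps)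
        with N(2) show "real N \<le> real (n0 + 2) * (1 + norm t)" by (rule order_trans)
      qed (use c(1) in simp_all)
      also have "\<dots> = C * (1 + norm t) ^ q" by (simp add: C_def power_mult_distrib)
      finally show ?thesis .
    qed
    with elim(1) show ?case by blast
  qed
qed

end


section \<open>Linear combinations of cell increments are not small\<close>

text \<open>Condition on \<open>U\<close>: then \<open>g U\<close> is a constant shift of the independent variable \<open>f V\<close>.\<close>

lemma (in prob_space) prob_shifted_by_independent:
  fixes f g :: "'b \<Rightarrow> real"
  assumes ind: "indep_var N U N' V"
    and P: "Measurable.pred N P" and g: "g \<in> borel_measurable N" and f: "f \<in> borel_measurable N'"
    and Q: "\<And>z. \<P>(\<omega> in M. \<bar>f (V \<omega>) + z\<bar> < K) \<le> q"
  shows "\<P>(\<omega> in M. P (U \<omega>) \<and> \<bar>f (V \<omega>) + g (U \<omega>)\<bar> < K) \<le> \<P>(\<omega> in M. P (U \<omega>)) * q"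
proof -
  note U[measurable] = indep_var_rv1[OF ind] and V[measurable] = indep_var_rv2[OF ind]
  note P[measurable] g[measurable] f[measurable]
  have eq: "distr M N U \<Otimes>\<^sub>M distr M N' V = distr M (N \<Otimes>\<^sub>M N') (\<lambda>\<omega>. (U \<omega>, V \<omega>))"
    using ind unfolding indep_var_distribution_eq by blast
  interpret DV: prob_space "distr M N' V" by (rule prob_space_distr[OF V])
  define S where "S = {z \<in> space (N \<Otimes>\<^sub>M N'). P (fst z) \<and> \<bar>f (snd z) + g (fst z)\<bar> < K}"
  have S: "S \<in> sets (N \<Otimes>\<^sub>M N')" unfolding S_def by measurable
  have S': "S \<in> sets (distr M N U \<Otimes>\<^sub>M distr M N' V)"
    using S by (simp cong: sets_pair_measure_cong)
  have q: "0 \<le> q" using Q[of 0] measure_nonneg order_trans by blast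
  have "emeasure M {\<omega>\<in>space M. P (U \<omega>) \<and> \<bar>f (V \<omega>) + g (U \<omega>)\<bar> < K} =
      emeasure (distr M (N \<Otimes>\<^sub>M N') (\<lambda>\<omega>. (U \<omega>, V \<omega>))) S"
  proof -
    have "(\<lambda>\<omega>. (U \<omega>, V \<omega>)) -` S \<inter> space M = {\<omega>\<in>space M. P (U \<omega>) \<and> \<bar>f (V \<omega>) + g (U \<omega>)\<bar> < K}"
      using measurable_space[OF U] measurable_space[OF V] by (auto simp: S_def space_pair_measure)
    then show ?thesis using S by (subst emeasure_distr) simp_all
  qed
  also have "\<dots> = (\<integral>\<^sup>+ u. emeasure (distr M N' V) (Pair u -` S) \<partial>distr M N U)"
    unfolding eq[symmetric] by (rule DV.emeasure_pair_measure_alt[OF S'])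
  also have "\<dots> \<le> (\<integral>\<^sup>+ u. ennreal q * indicator {u \<in> space N. P u} u \<partial>distr M N U)"
  proof (rule nn_integral_mono)
    fix u assume "u \<in> space (distr M N U)"
    then have u: "u \<in> space N" by simp
    show "emeasure (distr M N' V) (Pair u -` S) \<le> ennreal q * indicator {u \<in> space N. P u} u"
    proof (cases "P u")
      case True
      then have "Pair u -` S = {v \<in> space N'. \<bar>f v + g u\<bar> < K}"
        using u by (auto simp: S_def space_pair_measure)
      moreover have "V -` {v \<in> space N'. \<bar>f v + g u\<bar> < K} \<inter> space M = {\<omega>\<in>space M. \<bar>f (V \<omega>) + g u\<bar> < K}"
        using measurable_space[OF V] by auto
      moreover have "{v \<in> space N'. \<bar>f v + g u\<bar> < K} \<in> sets N'" by measurable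
      ultimately have "emeasure (distr M N' V) (Pair u -` S) = ennreal (\<P>(\<omega> in M. \<bar>f (V \<omega>) + g u\<bar> < K))"
        by (simp add: emeasure_distr emeasure_eq_measure)
      also have "\<dots> \<le> ennreal q" by (intro ennreal_leI Q)
      finally show ?thesis using True u by simp
    next
      case False
      then have "Pair u -` S = {}" by (auto simp: S_def)
      then show ?thesis by simp
    qed
  qed
  also have "\<dots> = ennreal q * emeasure (distr M N U) {u \<in> space N. P u}"
    by (rule nn_integral_cmult_indicator) simp
  also have "emeasure (distr M N U) {u \<in> space N. P u} = ennreal (\<P>(\<omega> in M. P (U \<omega>)))"
  proof -
    have "U -` {u \<in> space N. P u} \<inter> space M = {\<omega>\<in>space M. P (U \<omega>)}"
      using measurable_space[OF U] by auto
    then show ?thesis by (simp add: emeasure_distr emeasure_eq_measure)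
  qed
  finally have "ennreal (\<P>(\<omega> in M. P (U \<omega>) \<and> \<bar>f (V \<omega>) + g (U \<omega>)\<bar> < K)) \<le>
      ennreal (q * \<P>(\<omega> in M. P (U \<omega>)))"
    using q by (simp add: emeasure_eq_measure ennreal_mult)
  then show ?thesis using q by (simp add: mult.commute)
qed

text \<open>The cores \<open>C m\<close> are disjoint blocks on which only the \<open>m\<close>-th combination depends, with coefficient 1.
Conditioning on all variables outside the last core leaves a shifted core sum for the last
combination and determines all the others.\<close>

lemma (in prob_space) prob_linear_combinations_small:
  fixes \<xi> :: "'i \<Rightarrow> 'a \<Rightarrow> real" and c :: "nat \<Rightarrow> 'i \<Rightarrow> real"
  assumes ind: "indep_vars (\<lambda>_. borel) \<xi> J" and J: "finite J"
    and C: "\<And>m. m < n \<Longrightarrow> C m \<subseteq> J"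
    and c1: "\<And>m k. m < n \<Longrightarrow> k \<in> C m \<Longrightarrow> c m k = 1"
    and c0: "\<And>m m' k. m < n \<Longrightarrow> m' < n \<Longrightarrow> m \<noteq> m' \<Longrightarrow> k \<in> C m' \<Longrightarrow> c m k = 0"
    and Q: "\<And>m z. m < n \<Longrightarrow> \<P>(\<omega> in M. \<bar>(\<Sum>k\<in>C m. \<xi> k \<omega>) + z\<bar> < K m) \<le> q m"
  shows "\<P>(\<omega> in M. \<forall>m<n. \<bar>\<Sum>k\<in>J. c m k * \<xi> k \<omega>\<bar> < K m) \<le> (\<Prod>m<n. q m)"
  using C c1 c0 Q
proof (induction n)
  case 0
  then show ?case by simp
next
  case (Suc n)
  let ?B = "J - C n"
  let ?U = "\<lambda>\<omega>. \<lambda>k\<in>?B. \<xi> k \<omega>"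
  have Cn: "C n \<subseteq> J" using Suc.prems(1)[of n] by simp
  let ?V = "\<lambda>\<omega>. \<lambda>k\<in>C n. \<xi> k \<omega>"
  have ind': "indep_var (PiM ?B (\<lambda>_. borel)) ?U (PiM (C n) (\<lambda>_. borel)) ?V"
    using Cn by (intro indep_var_restrict[OF ind]) auto
  have sumV: "(\<Sum>k\<in>C n. ?V \<omega> k) = (\<Sum>k\<in>C n. \<xi> k \<omega>)" for \<omega>
    by (rule sum.cong) simp_all
  have measV: "(\<lambda>z. \<Sum>k\<in>C n. z k) \<in> borel_measurable (PiM (C n) (\<lambda>_. borel :: real measure))"
    by (intro borel_measurable_sum measurable_component_singleton)
  have split: "(\<Sum>k\<in>J. c m k * \<xi> k \<omega>) = (\<Sum>k\<in>C n. c m k * \<xi> k \<omega>) + (\<Sum>k\<in>?B. c m k * ?U \<omega> k)" for m \<omega>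
    using sum.subset_diff[OF Cn J, of "\<lambda>k. c m k * \<xi> k \<omega>"] by (simp add: add.commute)
  have lower: "(\<Sum>k\<in>J. c m k * \<xi> k \<omega>) = (\<Sum>k\<in>?B. c m k * ?U \<omega> k)" if "m < n" for m \<omega>
    unfolding split using that Suc.prems(3)[of m n] by simp
  have upper: "(\<Sum>k\<in>J. c n k * \<xi> k \<omega>) = (\<Sum>k\<in>C n. \<xi> k \<omega>) + (\<Sum>k\<in>?B. c n k * ?U \<omega> k)" for \<omega>
    unfolding split using Suc.prems(2)[of n] by simp
  have meas: "(\<lambda>z. \<Sum>k\<in>?B. c m k * z k) \<in> borel_measurable (PiM ?B (\<lambda>_. borel :: real measure))" for m
    by (intro borel_measurable_sum borel_measurable_times borel_measurable_const measurable_component_singleton)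
  define P where "P z \<longleftrightarrow> (\<forall>m\<in>{..<n}. \<bar>\<Sum>k\<in>?B. c m k * z k\<bar> < K m)" for z :: "'i \<Rightarrow> real"
  have "Measurable.pred (PiM ?B (\<lambda>_. borel :: real measure)) (\<lambda>z. \<bar>\<Sum>k\<in>?B. c m k * z k\<bar> < K m)" for m
    using meas[of m] by measurable
  then have P: "Measurable.pred (PiM ?B (\<lambda>_. borel)) P"
    unfolding P_def by (intro pred_intros_finite) auto
  have set_eq: "{\<omega>\<in>space M. \<forall>m<Suc n. \<bar>\<Sum>k\<in>J. c m k * \<xi> k \<omega>\<bar> < K m} =
      {\<omega>\<in>space M. P (?U \<omega>) \<and> \<bar>(\<Sum>k\<in>C n. ?V \<omega> k) + (\<Sum>k\<in>?B. c n k * ?U \<omega> k)\<bar> < K n}"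
    unfolding P_def All_less_Suc upper sumV using lower by auto
  have qn: "0 \<le> q n"
    using Suc.prems(4)[of n 0] measure_nonneg order_trans by blast
  have "\<P>(\<omega> in M. \<forall>m<Suc n. \<bar>\<Sum>k\<in>J. c m k * \<xi> k \<omega>\<bar> < K m) \<le>
      \<P>(\<omega> in M. P (?U \<omega>)) * q n"
    unfolding set_eq using Suc.prems(4)[of n]
    by (intro prob_shifted_by_independent[OF ind' P meas measV]) (simp add: sumV)
  also have "{\<omega>\<in>space M. P (?U \<omega>)} = {\<omega>\<in>space M. \<forall>m<n. \<bar>\<Sum>k\<in>J. c m k * \<xi> k \<omega>\<bar> < K m}"
    unfolding P_def using lower by auto
  also have "prob \<dots> * q n \<le> (\<Prod>m<n. q m) * q n"
  proof (rule mult_right_mono[OF _ qn], rule Suc.IH)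
    show "C m \<subseteq> J" if "m < n" for m using that by (intro Suc.prems(1)) simp
    show "c m k = 1" if "m < n" "k \<in> C m" for m k using that by (intro Suc.prems(2)) simp_all
    show "c m k = 0" if "m < n" "m' < n" "m \<noteq> m'" "k \<in> C m'" for m m' k
      using that by (intro Suc.prems(3)[of m m' k]) simp_all
    show "\<P>(\<omega> in M. \<bar>(\<Sum>k\<in>C m. \<xi> k \<omega>) + z\<bar> < K m) \<le> q m" if "m < n" for m z
      using that by (intro Suc.prems(4)) simp
  qed
  finally show ?case by simp
qed

text \<open>If the probability exceeds \<open>1/2\<close>, the event meets \<open>\<bar>A\<bar> \<le> c\<close>, so \<open>\<bar>z\<bar> < K + c\<close>, and then
\<open>\<bar>A + z\<bar> < K\<close> implies \<open>\<bar>A\<bar> < 2 K + c\<close>. The bound is uniform in \<open>z\<close>, so nothing has to be known about the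
size of an independent summand.\<close>

lemma (in prob_space) prob_shift_le:
  fixes A :: "'a \<Rightarrow> real"
  assumes A[measurable]: "A \<in> borel_measurable M" and c: "\<P>(\<omega> in M. c < \<bar>A \<omega>\<bar>) < 1/2"
  shows "\<P>(\<omega> in M. \<bar>A \<omega> + z\<bar> < K) \<le> max (1/2) (1 - \<P>(\<omega> in M. 2 * K + c \<le> \<bar>A \<omega>\<bar>))"
proof (cases "\<P>(\<omega> in M. \<bar>A \<omega> + z\<bar> < K) \<le> 1/2")
  case False
  let ?E = "{\<omega>\<in>space M. \<bar>A \<omega> + z\<bar> < K}" and ?F = "{\<omega>\<in>space M. c < \<bar>A \<omega>\<bar>}"
  have "\<not> ?E \<subseteq> ?F"
  proof
    assume "?E \<subseteq> ?F"
    then have "prob ?E \<le> prob ?F" by (intro finite_measure_mono) auto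
    then show False using False c by simp
  qed
  then obtain \<omega>0 where "\<omega>0 \<in> ?E" "\<omega>0 \<notin> ?F" by blast
  then have "\<bar>A \<omega>0 + z\<bar> < K" "\<bar>A \<omega>0\<bar> \<le> c" by auto
  then have z: "\<bar>z\<bar> < K + c" by linarith
  have "prob ?E \<le> \<P>(\<omega> in M. \<not> (2 * K + c \<le> \<bar>A \<omega>\<bar>))"
    using z by (intro finite_measure_mono) auto
  also have "\<dots> = 1 - \<P>(\<omega> in M. 2 * K + c \<le> \<bar>A \<omega>\<bar>)" by (rule prob_neg) auto
  finally show ?thesis by simp
qed simp

text \<open>Each factor is at most \<open>exp (- p m / 2)\<close>.\<close>

lemma prod_max_half_tendsto_0:
  fixes p :: "nat \<Rightarrow> real"
  assumes p: "\<And>m. 0 \<le> p m" "\<And>m. p m \<le> 1" and "\<not> summable p" and "0 < e"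
  shows "\<exists>n. (\<Prod>m<n. max (1/2) (1 - p m)) < e"
proof (rule ccontr)
  assume "\<not> ?thesis"
  then have big: "e \<le> (\<Prod>m<n. max (1/2) (1 - p m))" for n by (simp add: not_less)
  have le: "max (1/2) (1 - p m) \<le> exp (- (p m / 2))" for m
  proof -
    have "1 + (- (p m)) \<le> exp (- (p m))" by (rule exp_ge_add_one_self)
    also have "\<dots> \<le> exp (- (p m / 2))" using p(1)[of m] by simp
    finally have 1: "1 - p m \<le> exp (- (p m / 2))" by simp
    have "1 + (- (1/2 :: real)) \<le> exp (- (1/2))" by (rule exp_ge_add_one_self)
    also have "\<dots> \<le> exp (- (p m / 2))" using p(2)[of m] by simp
    finally show ?thesis using 1 by simp
  qed
  have "(\<Sum>m<n. p m) \<le> - 2 * ln e" for n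
  proof -
    have "e \<le> (\<Prod>m<n. exp (- (p m / 2)))"
      by (rule order_trans[OF big prod_mono]) (use le in \<open>simp add: le_max_iff_disj\<close>)
    also have "\<dots> = exp (- (\<Sum>m<n. p m) / 2)"
      by (simp add: exp_sum[symmetric] sum_negf sum_divide_distrib)
    finally have "ln e \<le> ln (exp (- (\<Sum>m<n. p m) / 2))"
      using \<open>0 < e\<close> by (simp only: ln_le_cancel_iff exp_gt_zero)
    then show ?thesis by simp
  qed
  then have "summable p" using p(1) by (intro summableI_nonneg_bounded) auto
  with assms(3) show False by simp
qed

context levy_field
begin

lemma X_one_measurable [measurable]: "X (\<chi> i. 1) \<in> borel_measurable M"
  by (rule random_field) (simp add: less_eq_vec_def)

lemma tail_bounds: "0 \<le> tail a" "tail a \<le> 1" and tail_antimono: "a \<le> b \<Longrightarrow> tail b \<le> tail a"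
  by (auto simp: tail_def intro!: finite_measure_mono)

text \<open>If the sum converged, the moment of order \<open>1 / (p + 1)\<close> would be finite: up to the factor \<open>L powr \<eta>\<close>
the power \<open>y powr \<eta>\<close> exceeds the number of levels \<open>L (m + 1)\<^sup>p\<^sup>+\<^sup>1\<close> up to \<open>y\<close> by at most one. The exponent
\<open>p + 1\<close> in place of \<open>p\<close> keeps the order of the moment defined for \<open>p = 0\<close>.\<close>

lemma not_summable_tail:
  assumes inf: "\<And>\<eta>. 0 < \<eta> \<Longrightarrow> (\<integral>\<^sup>+ \<omega>. ennreal (\<bar>X (\<chi> i. 1) \<omega>\<bar> powr \<eta>) \<partial>M) = \<infinity>" and L: "0 < L"
  shows "\<not> summable (\<lambda>m. tail (L * (real m + 1) ^ p))"
proof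
  assume "summable (\<lambda>m. tail (L * (real m + 1) ^ p))"
  then have sum: "summable (\<lambda>m. tail (L * (real m + 1) ^ Suc p))"
  proof (rule summable_comparison_test'[where N=0])
    fix m
    have "L * (real m + 1) ^ p \<le> L * (real m + 1) ^ Suc p"
      using L by (intro mult_left_mono power_increasing) auto
    then show "norm (tail (L * (real m + 1) ^ Suc p)) \<le> tail (L * (real m + 1) ^ p)"
      using tail_antimono tail_bounds(1) by simp
  qed
  define \<eta> where "\<eta> = 1 / real (Suc p)"
  have \<eta>: "0 < \<eta>" by (simp add: \<eta>_def)
  let ?A = "\<lambda>m. {\<omega>\<in>space M. L * (real m + 1) ^ Suc p \<le> \<bar>X (\<chi> i. 1) \<omega>\<bar>}"
  have pointwise: "ennreal (\<bar>X (\<chi> i. 1) \<omega>\<bar> powr \<eta>) \<le> ennreal (L powr \<eta>) * (1 + (\<Sum>m. indicator (?A m) \<omega>))"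
    if \<omega>: "\<omega> \<in> space M" for \<omega>
  proof -
    define y where "y = \<bar>X (\<chi> i. 1) \<omega>\<bar>"
    have "\<exists>n. y < L * (real n + 1) ^ Suc p"
    proof -
      obtain n :: nat where n: "y / L < real n" using reals_Archimedean2 by blast
      have "real n \<le> (real n + 1) ^ 1" by simp
      also have "\<dots> \<le> (real n + 1) ^ Suc p" by (intro power_increasing) auto
      finally have "y / L < (real n + 1) ^ Suc p" using n by simp
      then show ?thesis using L by (intro exI[of _ n]) (simp add: pos_divide_less_eq mult.commute)
    qed
    then obtain n where n: "y < L * (real n + 1) ^ Suc p" "\<And>m. m < n \<Longrightarrow> L * (real m + 1) ^ Suc p \<le> y"
      using exists_least_iff[of "\<lambda>n. y < L * (real n + 1) ^ Suc p"] by (meson not_le)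
    have "y powr \<eta> \<le> (L * (real n + 1) ^ Suc p) powr \<eta>"
      using n(1) \<eta> by (intro powr_mono2) (auto simp: y_def)
    also have "\<dots> = L powr \<eta> * ((real n + 1) ^ Suc p) powr \<eta>"
      by (rule powr_mult)
    also have "((real n + 1) ^ Suc p) powr \<eta> = real n + 1"
    proof -
      have "((real n + 1) ^ Suc p) powr \<eta> = ((real n + 1) powr real (Suc p)) powr \<eta>"
        by (subst powr_realpow) simp_all
      also have "\<dots> = real n + 1" by (simp add: powr_powr \<eta>_def)
      finally show ?thesis .
    qed
    finally have "ennreal (y powr \<eta>) \<le> ennreal (L powr \<eta>) * ennreal (real n + 1)"
      by (subst ennreal_mult[symmetric]) (auto intro: ennreal_leI)
    also have "ennreal (real n + 1) \<le> 1 + (\<Sum>m. indicator (?A m) \<omega>)"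
    proof -
      have "(of_nat n :: ennreal) = (\<Sum>m<n. indicator (?A m) \<omega>)"
        using n(2) \<omega> by (simp add: y_def)
      also have "\<dots> \<le> (\<Sum>m. indicator (?A m) \<omega>)" by (rule sum_le_suminf) auto
      finally have "1 + (of_nat n :: ennreal) \<le> 1 + (\<Sum>m. indicator (?A m) \<omega>)" by (rule add_left_mono)
      moreover have "ennreal (real n + 1) = 1 + of_nat n"
        by (simp add: ennreal_plus add.commute ennreal_of_nat_eq_real_of_nat flip: ennreal_1)
      ultimately show ?thesis by simp
    qed
    finally show ?thesis unfolding y_def by (simp add: mult_left_mono)
  qed
  have "(\<integral>\<^sup>+ \<omega>. ennreal (\<bar>X (\<chi> i. 1) \<omega>\<bar> powr \<eta>) \<partial>M) \<le>
      (\<integral>\<^sup>+ \<omega>. ennreal (L powr \<eta>) * (1 + (\<Sum>m. indicator (?A m) \<omega>)) \<partial>M)"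
    by (rule nn_integral_mono) (rule pointwise)
  also have "\<dots> = ennreal (L powr \<eta>) * (\<integral>\<^sup>+ \<omega>. 1 + (\<Sum>m. indicator (?A m) \<omega>) \<partial>M)"
    by (rule nn_integral_cmult) measurable
  also have "(\<integral>\<^sup>+ \<omega>. 1 + (\<Sum>m. indicator (?A m) \<omega>) \<partial>M) = 1 + (\<Sum>m. emeasure M (?A m))"
    by (subst nn_integral_add) (simp_all add: nn_integral_suminf emeasure_space_1)
  also have "(\<Sum>m. emeasure M (?A m)) = (\<Sum>m. ennreal (tail (L * (real m + 1) ^ Suc p)))"
    by (simp only: emeasure_eq_measure tail_def)
  also have "\<dots> = ennreal (\<Sum>m. tail (L * (real m + 1) ^ Suc p))"
    by (rule suminf_ennreal2[OF tail_bounds(1) sum])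
  also have "ennreal (L powr \<eta>) * (1 + \<dots>) < \<infinity>"
    by (simp add: ennreal_mult_less_top)
  finally show False using inf[OF \<eta>] by simp
qed

text \<open>The sum over the cells of the \<open>m\<close>-th core is the increment over a unit cube, so its tails are those
of the field at \<open>(1, \<dots>, 1)\<close>.\<close>

lemma prob_cell_combinations_small:
  fixes c :: "nat \<Rightarrow> ('n \<Rightarrow> nat) \<Rightarrow> real"
  assumes c0: "\<P>(\<omega> in M. c0 < \<bar>X (\<chi> i. 1) \<omega>\<bar>) < 1/2"
    and c: "\<And>m k. k \<in> core_box n m \<Longrightarrow> c m k = 1"
      "\<And>m m' k. m \<noteq> m' \<Longrightarrow> k \<in> core_box n m' \<Longrightarrow> c m k = 0"
  shows "\<P>(\<omega> in M. \<forall>m<r. \<bar>\<Sum>k\<in>index_box (\<lambda>_. 0) (\<lambda>_. 3 * r * 2 ^ n).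
      c m k * cell_increment (dyadic_grid n) (\<lambda>t. X t \<omega>) k\<bar> < K m) \<le>
    (\<Prod>m<r. max (1/2) (1 - tail (2 * K m + c0)))"
proof (rule prob_linear_combinations_small)
  let ?\<xi> = "\<lambda>k \<omega>. cell_increment (dyadic_grid n) (\<lambda>t. X t \<omega>) k"
  show "indep_vars (\<lambda>_. borel) ?\<xi> (index_box (\<lambda>_. 0) (\<lambda>_. 3 * r * 2 ^ n))"
    by (intro indep_cells dyadic_grid_props finite_index_box)
  show "core_box n m \<subseteq> index_box (\<lambda>_. 0) (\<lambda>_. 3 * r * 2 ^ n)" if "m < r" for m
  proof -
    have "(3 * m + 2) * 2 ^ n \<le> 3 * r * 2 ^ n" using that by (intro mult_right_mono) auto
    then show ?thesis by (auto simp: index_box_def intro: less_le_trans)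
  qed
  show "c m k = 1" if "k \<in> core_box n m" for m k using c(1) that .
  show "c m k = 0" if "m \<noteq> m'" "k \<in> core_box n m'" for m m' k using c(2) that .
  fix m z
  let ?a = "grid_point (dyadic_grid n) (\<lambda>_. (3 * m + 1) * 2 ^ n)"
  let ?b = "grid_point (dyadic_grid n) (\<lambda>_. (3 * m + 2) * 2 ^ n)"
  have ab: "0 \<le> ?a" "?a \<le> ?b" "0 \<le> ?b" "?b - ?a = (\<chi> i. 1)"
    by (simp_all add: grid_point_def less_eq_vec_def vec_eq_iff field_simps)
  have sum: "(\<Sum>k\<in>core_box n m. ?\<xi> k \<omega>) = Inc ?a ?b \<omega>" for \<omega>
    by (rule increment_eq_sum_cells[symmetric]) simp
  have "\<P>(\<omega> in M. c0 < \<bar>Inc ?a ?b \<omega>\<bar>) < 1/2"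
    using prob_Inc_tail(2)[OF ab(1,2), of c0] c0 unfolding ab(4) by simp
  from prob_shift_le[OF increment_measurable[OF ab(1,3)] this]
  have "\<P>(\<omega> in M. \<bar>Inc ?a ?b \<omega> + z\<bar> < K m) \<le>
      max (1/2) (1 - \<P>(\<omega> in M. 2 * K m + c0 \<le> \<bar>Inc ?a ?b \<omega>\<bar>))" .
  also have "\<P>(\<omega> in M. 2 * K m + c0 \<le> \<bar>Inc ?a ?b \<omega>\<bar>) = tail (2 * K m + c0)"
    using prob_Inc_tail(1)[OF ab(1,2), of "2 * K m + c0"] unfolding ab(4) by (simp add: tail_def)
  finally show "\<P>(\<omega> in M. \<bar>(\<Sum>k\<in>core_box n m. ?\<xi> k \<omega>) + z\<bar> < K m) \<le> max (1/2) (1 - tail (2 * K m + c0))"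
    unfolding sum .
qed simp

end


section \<open>A smooth plateau function on the line\<close>

text \<open>Smoothness on the line is measured by the number of derivatives, so that closure under products needs
no Leibniz formula.\<close>

fun times_differentiable :: "nat \<Rightarrow> (real \<Rightarrow> real) \<Rightarrow> bool" where
  "times_differentiable 0 f \<longleftrightarrow> True"
| "times_differentiable (Suc n) f \<longleftrightarrow>
     (\<exists>f'. (\<forall>x. (f has_real_derivative f' x) (at x)) \<and> times_differentiable n f')"

lemma times_differentiable_less: "times_differentiable (Suc n) f \<Longrightarrow> times_differentiable n f"
  by (induction n arbitrary: f) auto

lemma times_differentiable_add:
  "times_differentiable n f \<Longrightarrow> times_differentiable n g \<Longrightarrow> times_differentiable n (\<lambda>x. f x + g x)"
proof (induction n arbitrary: f g)
  case (Suc n)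
  then obtain f' g' where "\<forall>x. (f has_real_derivative f' x) (at x)" "times_differentiable n f'"
    "\<forall>x. (g has_real_derivative g' x) (at x)" "times_differentiable n g'" by auto
  with Suc.IH show ?case
    unfolding times_differentiable.simps by (intro exI[of _ "\<lambda>x. f' x + g' x"] conjI allI DERIV_add) auto
qed simp

lemma times_differentiable_mult:
  "times_differentiable n f \<Longrightarrow> times_differentiable n g \<Longrightarrow> times_differentiable n (\<lambda>x. f x * g x)"
proof (induction n arbitrary: f g)
  case (Suc n)
  then obtain f' g' where d: "\<forall>x. (f has_real_derivative f' x) (at x)" "times_differentiable n f'"
    "\<forall>x. (g has_real_derivative g' x) (at x)" "times_differentiable n g'" by auto
  have "times_differentiable n (\<lambda>x. f' x * g x + g' x * f x)"
    using d times_differentiable_less[OF Suc.prems(1)] times_differentiable_less[OF Suc.prems(2)]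
    by (intro times_differentiable_add Suc.IH)
  with d show ?case
    unfolding times_differentiable.simps
    by (intro exI[of _ "\<lambda>x. f' x * g x + g' x * f x"] conjI allI DERIV_mult) auto
qed simp

lemma times_differentiable_affine:
  "times_differentiable n f \<Longrightarrow> times_differentiable n (\<lambda>x. a * f (b * x + c))"
proof (induction n arbitrary: f a)
  case (Suc n)
  then obtain f' where d: "\<And>x. (f has_real_derivative f' x) (at x)" "times_differentiable n f'" by auto
  have "((\<lambda>x. a * f (b * x + c)) has_real_derivative (a * b) * f' (b * x + c)) (at x)" for x
    by (rule derivative_eq_intros DERIV_chain2[OF d(1)] refl | simp)+
  with Suc.IH[OF d(2)] show ?case
    unfolding times_differentiable.simps by (intro exI[of _ "\<lambda>x. (a * b) * f' (b * x + c)"] conjI allI)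
qed simp

lemma times_differentiable_deriv:
  "times_differentiable (Suc n) f \<Longrightarrow> ((deriv ^^ n) f has_real_derivative (deriv ^^ Suc n) f x) (at x)"
proof (induction n arbitrary: f)
  case 0
  then obtain f' where f': "\<And>x. (f has_real_derivative f' x) (at x)" by auto
  from this[of x] show ?case using DERIV_imp_deriv[OF f'[of x]] by simp
next
  case (Suc n)
  then obtain f' where f': "\<And>x. (f has_real_derivative f' x) (at x)" "times_differentiable (Suc n) f'"
    by auto
  have "deriv f = f'" using DERIV_imp_deriv[OF f'(1)] by auto
  with Suc.IH[OF f'(2)] show ?case by (simp add: funpow_swap1)
qed

text \<open>These functions are closed under differentiation, also at 0, which makes the flat function
\<open>exp (- 1 / x)\<close> smooth.\<close>

definition exp_poly :: "real poly \<Rightarrow> real \<Rightarrow> real" where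
  "exp_poly p x = (if 0 < x then poly p (inverse x) * exp (- inverse x) else 0)"

lemma poly_times_exp_tendsto_0: "((\<lambda>y::real. poly p y * exp (- y)) \<longlongrightarrow> 0) at_top"
proof -
  have "((\<lambda>y::real. \<Sum>i\<le>degree p. coeff p i * (y ^ i / exp y)) \<longlongrightarrow> (\<Sum>i\<le>degree p. coeff p i * 0)) at_top"
    by (intro tendsto_intros tendsto_power_div_exp_0)
  moreover have "poly p y * exp (- y) = (\<Sum>i\<le>degree p. coeff p i * (y ^ i / exp y))" for y :: real
    by (simp add: poly_altdef sum_distrib_right exp_minus divide_inverse mult.assoc)
  ultimately show ?thesis by simp
qed

lemma exp_poly_deriv:
  "(exp_poly p has_real_derivative exp_poly (monom 1 2 * (p - pderiv p)) x) (at x)"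
proof -
  consider "0 < x" | "x < 0" | "x = 0" by linarith
  then show ?thesis
  proof cases
    case 1
    have "((\<lambda>x. poly p (inverse x) * exp (- inverse x)) has_real_derivative
        poly (pderiv p) (inverse x) * (- (inverse x ^ Suc (Suc 0))) * exp (- inverse x) +
        exp (- inverse x) * (inverse x ^ Suc (Suc 0)) * poly p (inverse x)) (at x)"
      using 1 by (intro derivative_eq_intros DERIV_chain2[OF poly_DERIV] DERIV_inverse refl | simp)+
    then have "((\<lambda>x. poly p (inverse x) * exp (- inverse x)) has_real_derivative
        exp_poly (monom 1 2 * (p - pderiv p)) x) (at x)"
      by (rule back_subst[where P="\<lambda>d. (_ has_real_derivative d) _"])
        (use 1 in \<open>simp add: exp_poly_def poly_monom power2_eq_square algebra_simps\<close>)
    then show ?thesis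
      by (rule has_field_derivative_transform_within_open[of _ _ _ "{0<..}"])
        (use 1 in \<open>auto simp: exp_poly_def\<close>)
  next
    case 2
    have "((\<lambda>x. 0) has_real_derivative exp_poly (monom 1 2 * (p - pderiv p)) x) (at x)"
      using 2 by (simp add: exp_poly_def)
    then show ?thesis
      by (rule has_field_derivative_transform_within_open[of _ _ _ "{..<0}"])
        (use 2 in \<open>auto simp: exp_poly_def\<close>)
  next
    case 3
    have "((\<lambda>h. exp_poly p h / h) \<longlongrightarrow> 0) (at_left 0)"
      by (rule tendsto_eventually) (auto simp: eventually_at_filter exp_poly_def)
    moreover have "((\<lambda>h. exp_poly p h / h) \<longlongrightarrow> 0) (at_right 0)"
      unfolding filterlim_at_right_to_top
    proof (rule Lim_transform_eventually)
      show "((\<lambda>y. poly (pCons 0 p) y * exp (- y)) \<longlongrightarrow> 0) at_top" by (rule poly_times_exp_tendsto_0)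
      show "\<forall>\<^sub>F y in at_top. poly (pCons 0 p) y * exp (- y) = exp_poly p (inverse y) / inverse y"
        using eventually_gt_at_top[of 0] by eventually_elim (simp add: exp_poly_def field_simps)
    qed
    ultimately have "((\<lambda>h. exp_poly p h / h) \<longlongrightarrow> 0) (at 0)" by (rule filterlim_split_at)
    then show ?thesis unfolding 3 DERIV_def by (simp add: exp_poly_def)
  qed
qed

lemma times_differentiable_exp_poly: "times_differentiable n (exp_poly p)"
  by (induction n arbitrary: p) (use exp_poly_deriv in auto)

definition bump :: "real \<Rightarrow> real" where
  "bump x = exp_poly 1 x * exp_poly 1 (1 - x)"

lemma bump_nonneg: "0 \<le> bump x" and bump_pos_iff: "0 < bump x \<longleftrightarrow> 0 < x \<and> x < 1"
  and bump_eq_0: "\<not> (0 < x \<and> x < 1) \<Longrightarrow> bump x = 0"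
  by (auto simp: bump_def exp_poly_def)

lemma times_differentiable_bump: "times_differentiable n bump"
proof -
  have "times_differentiable n (\<lambda>x. 1 * exp_poly 1 ((-1) * x + 1))"
    by (intro times_differentiable_affine times_differentiable_exp_poly)
  then have "times_differentiable n (\<lambda>x. exp_poly 1 x * (1 * exp_poly 1 ((-1) * x + 1)))"
    by (rule times_differentiable_mult[OF times_differentiable_exp_poly])
  moreover have "bump = (\<lambda>x. exp_poly 1 x * (1 * exp_poly 1 ((-1) * x + 1)))"
    by (auto simp: bump_def)
  ultimately show ?thesis by simp
qed

lemma continuous_bump: "continuous_on A bump"
proof -
  obtain f' where "\<And>x. (bump has_real_derivative f' x) (at x)"
    using times_differentiable_bump[of "Suc 0"] by auto
  then have "isCont bump x" for x by (rule DERIV_isCont)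
  then show ?thesis by (intro continuous_at_imp_continuous_on) auto
qed

definition bump_integral :: "real \<Rightarrow> real" where
  "bump_integral x = integral {-1..x} bump"

lemma bump_integral_left: "x \<le> 0 \<Longrightarrow> bump_integral x = 0"
  unfolding bump_integral_def by (rule integral_unique, rule has_integral_is_0) (auto intro: bump_eq_0)

lemma bump_integral_deriv: "(bump_integral has_real_derivative bump x) (at x)"
proof (cases "x < 0")
  case True
  have "((\<lambda>x. 0) has_real_derivative bump x) (at x)" using True by (simp add: bump_eq_0)
  then show ?thesis
    by (rule has_field_derivative_transform_within_open[of _ _ _ "{..<0}"])
      (use True bump_integral_left in \<open>auto simp: less_imp_le\<close>)
next
  case False
  have "(bump_integral has_real_derivative bump x) (at x within {-1..x+1})"
    unfolding bump_integral_def using False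
    by (intro integral_has_real_derivative continuous_bump) auto
  moreover have "at x within {-1..x+1} = at x"
    using False by (intro at_within_interior) (auto simp: interior_atLeastAtMost_real)
  ultimately show ?thesis by simp
qed

lemma bump_integral_right: "1 \<le> x \<Longrightarrow> bump_integral x = bump_integral 1"
proof -
  assume "1 \<le> x"
  have "\<exists>c. \<forall>x\<in>{1..}. bump_integral x = c"
  proof (rule has_field_derivative_zero_constant)
    show "(bump_integral has_real_derivative 0) (at x within {1..})" if "x \<in> {1..}" for x
      using bump_integral_deriv[of x] that by (auto simp: bump_eq_0 intro: has_field_derivative_at_within)
  qed simp
  then obtain c where "\<And>x. x \<in> {1..} \<Longrightarrow> bump_integral x = c" by blast
  then show ?thesis using \<open>1 \<le> x\<close> by simp
qed

text \<open>The derivative is one bump on \<open>(0, 1)\<close> minus its translate by 2; the function is constant on \<open>[1, 2]\<close>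
and vanishes outside \<open>[0, 3]\<close>.\<close>

definition plateau :: "real \<Rightarrow> real" where
  "plateau x = bump_integral x - bump_integral (x - 2)"

lemma plateau_deriv: "(plateau has_real_derivative bump x - bump (x - 2)) (at x)"
proof -
  have "((\<lambda>x. bump_integral (x - 2)) has_real_derivative bump (x - 2) * 1) (at x)"
    by (rule DERIV_chain2[OF bump_integral_deriv]) (auto intro!: derivative_eq_intros)
  then show ?thesis
    unfolding plateau_def using DERIV_diff[OF bump_integral_deriv] by simp
qed

lemma plateau_eq_0:
  assumes "x \<le> 0 \<or> 3 \<le> x"
  shows "plateau x = 0"
  using assms
proof
  assume "3 \<le> x"
  then show ?thesis using bump_integral_right[of x] bump_integral_right[of "x - 2"] by (simp add: plateau_def)
qed (simp add: plateau_def bump_integral_left)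

lemma times_differentiable_plateau: "times_differentiable n plateau"
proof (rule times_differentiable_less)
  have "times_differentiable n (\<lambda>x. bump x + (-1) * bump (1 * x + (-2)))"
    by (intro times_differentiable_add times_differentiable_affine times_differentiable_bump)
  then show "times_differentiable (Suc n) plateau"
    using plateau_deriv unfolding times_differentiable.simps
    by (intro exI[of _ "\<lambda>x. bump x + (-1) * bump (1 * x + (-2))"]) simp
qed


section \<open>Probing the white noise by translates of a test function\<close>

lemma has_derivative_prod_coords:
  fixes g :: "'n::finite \<Rightarrow> real \<Rightarrow> real"
  assumes "\<And>i y. (g i has_real_derivative g' i y) (at y)"
  shows "((\<lambda>t::real^'n. \<Prod>i\<in>UNIV. g i (t $ i)) has_derivative
    (\<lambda>h. \<Sum>i\<in>UNIV. g' i (t $ i) * h $ i * (\<Prod>j\<in>UNIV - {i}. g j (t $ j)))) (at t)"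
proof (rule has_derivative_prod)
  fix i
  have "((\<lambda>t::real^'n. t $ i) has_derivative (\<lambda>h. h $ i)) (at t)"
    by (rule bounded_linear_imp_has_derivative[OF bounded_linear_vec_nth])
  from has_derivative_compose[OF this, of "g i" "\<lambda>y. g' i (t $ i) * y"]
  show "((\<lambda>t::real^'n. g i (t $ i)) has_derivative (\<lambda>h. g' i (t $ i) * h $ i)) (at t)"
    using assms[of i "t $ i"] unfolding has_field_derivative_def by simp
qed

definition plateau_product :: "real^'n::finite \<Rightarrow> real" where
  "plateau_product t = (\<Prod>i\<in>UNIV. plateau (t $ i))"

text \<open>The partial derivatives act on the factors separately: each occurrence of a coordinate in the list
differentiates the factor of that coordinate once.\<close>

lemma iter_partial_plateau_product:
  "iter_partial is plateau_product t = (\<Prod>i\<in>UNIV. (deriv ^^ count_list is i) plateau (t $ i))"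
proof (induction "is" arbitrary: t)
  case Nil
  then show ?case by (simp add: plateau_product_def)
next
  case (Cons j "is")
  let ?g = "\<lambda>i. (deriv ^^ count_list is i) plateau"
  let ?g' = "\<lambda>i. (deriv ^^ Suc (count_list is i)) plateau"
  have IH: "iter_partial is plateau_product = (\<lambda>t. \<Prod>i\<in>UNIV. ?g i (t $ i))"
    using Cons by (intro ext)
  have "partial_deriv j (\<lambda>t. \<Prod>i\<in>UNIV. ?g i (t $ i)) t =
      (\<Sum>i\<in>UNIV. ?g' i (t $ i) * axis j 1 $ i * (\<Prod>l\<in>UNIV - {i}. ?g l (t $ l)))"
    by (rule partial_deriv_eqI[OF has_derivative_prod_coords[OF times_differentiable_deriv[OF times_differentiable_plateau]]])
  also have "\<dots> = (\<Sum>i\<in>{j}. ?g' i (t $ i) * axis j 1 $ i * (\<Prod>l\<in>UNIV - {i}. ?g l (t $ l)))"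
    by (rule sum.mono_neutral_right) (auto simp: axis_def)
  also have "\<dots> = ?g' j (t $ j) * (\<Prod>l\<in>UNIV - {j}. ?g l (t $ l))" by (simp add: axis_def)
  also have "\<dots> = (\<Prod>i\<in>UNIV. (deriv ^^ count_list (j # is) i) plateau (t $ i))"
    by (subst prod.remove[of UNIV j]) (auto intro!: prod.cong)
  finally show ?case by (simp only: iter_partial.simps IH)
qed

lemma smooth_plateau_product: "smooth (plateau_product :: real^'n::finite \<Rightarrow> real)"
  unfolding smooth_def
proof (intro allI)
  fix "is" and t :: "real^'n"
  have eq: "iter_partial is plateau_product = (\<lambda>t::real^'n. \<Prod>i\<in>UNIV. (deriv ^^ count_list is i) plateau (t $ i))"
    by (intro ext iter_partial_plateau_product)
  show "iter_partial is plateau_product differentiable at t"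
    unfolding eq
    by (rule differentiableI[OF has_derivative_prod_coords[OF times_differentiable_deriv[OF times_differentiable_plateau]]])
qed

lemma count_list_distinct: "distinct xs \<Longrightarrow> x \<in> set xs \<Longrightarrow> count_list xs x = 1"
  by (induction xs) auto

lemma mixed_partial_plateau_product:
  "mixed_partial plateau_product (t :: real^'n::finite) = (\<Prod>i\<in>UNIV. bump (t $ i) - bump (t $ i - 2))"
proof -
  have "count_list all_directions i = 1" for i :: 'n
    by (rule count_list_distinct) (simp_all add: all_directions_enumerates)
  moreover have "deriv plateau y = bump y - bump (y - 2)" for y
    by (rule DERIV_imp_deriv[OF plateau_deriv])
  ultimately show ?thesis by (simp add: mixed_partial_eq iter_partial_plateau_product)
qed

definition probe_offset :: "nat \<Rightarrow> real^'n::finite" where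
  "probe_offset m = (\<chi> i. 3 * real m)"

text \<open>The product of plateaus, moved to the \<open>m\<close>-th cube of side 3 on the diagonal.\<close>

definition probe :: "nat \<Rightarrow> real^'n::finite \<Rightarrow> real" where
  "probe m t = plateau_product (t - probe_offset m)"

lemma probe_test_function: "probe m \<in> (test_functions :: (real^'n::finite \<Rightarrow> real) set)"
proof -
  have "smooth (probe m :: real^'n \<Rightarrow> real)"
    unfolding probe_def[abs_def] by (rule smooth_translate[OF smooth_plateau_product])
  moreover have "{t. probe m t \<noteq> 0} \<subseteq> cbox (probe_offset m) (probe_offset m + (\<chi> i. 3) :: real^'n)"
  proof
    fix t :: "real^'n" assume "t \<in> {t. probe m t \<noteq> 0}"
    then have "plateau (t $ i - 3 * real m) \<noteq> 0" for i
      by (simp add: probe_def plateau_product_def probe_offset_def)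
    then have "\<not> (t $ i - 3 * real m \<le> 0 \<or> 3 \<le> t $ i - 3 * real m)" for i
      using plateau_eq_0 by blast
    then show "t \<in> cbox (probe_offset m) (probe_offset m + (\<chi> i. 3))"
      unfolding mem_box_cart probe_offset_def by (auto simp: not_le intro: less_imp_le) (smt (verit))+
  qed
  then have "closure {t. probe m t \<noteq> 0} \<subseteq> cbox (probe_offset m) (probe_offset m + (\<chi> i. 3) :: real^'n)"
    by (rule closure_minimal) (rule closed_cbox)
  then have "compact (closure {t. probe m t \<noteq> (0::real)} \<inter> cbox (probe_offset m) (probe_offset m + (\<chi> i. 3) :: real^'n))"
    by (intro closed_Int_compact closed_closure compact_cbox)
  ultimately show ?thesis
    using \<open>closure _ \<subseteq> _\<close> by (simp add: test_functions_def Int_absorb2)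
qed

lemma probe_schwartz: "probe m \<in> schwartz_space"
  by (rule test_functions_schwartz[OF probe_test_function])

text \<open>Translation by \<open>v\<close> costs at most the factor \<open>(1 + norm v)\<^sup>k\<close>, and the offset is linear in \<open>m\<close>.\<close>

lemma schwartz_seminorm_probe_growth:
  "\<exists>D\<ge>0. \<forall>m. schwartz_seminorm k is (probe m :: real^'n::finite \<Rightarrow> real) \<le> D * (real m + 1) ^ k"
proof -
  let ?f = "plateau_product :: real^'n \<Rightarrow> real"
  have f: "?f \<in> schwartz_space"
  proof -
    have "?f = probe 0" by (simp add: probe_def[abs_def] probe_offset_def zero_vec_def[symmetric])
    then show ?thesis using probe_schwartz by metis
  qed
  define a where "a = 1 + 3 * real CARD('n)"
  let ?S = "schwartz_seminorm k is ?f"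
  have S0: "0 \<le> ?S"
    by (rule order_trans[OF _ schwartz_seminorm_upper[OF f, of 0]]) simp
  have "schwartz_seminorm k is (probe m :: real^'n \<Rightarrow> real) \<le> (a ^ k * ?S) * (real m + 1) ^ k" for m
  proof (rule schwartz_seminorm_least)
    fix t :: "real^'n"
    have "norm (probe_offset m :: real^'n) \<le> (\<Sum>i\<in>UNIV. \<bar>(probe_offset m :: real^'n) $ i\<bar>)" by (rule norm_le_l1_cart)
    also have "\<dots> = 3 * real CARD('n) * real m" by (simp add: probe_offset_def)
    finally have v: "norm (probe_offset m :: real^'n) \<le> 3 * real CARD('n) * real m" .
    have "1 + norm t \<le> 1 + norm (t - probe_offset m) + norm (probe_offset m :: real^'n)"
      using norm_triangle_ineq[of "t - probe_offset m" "probe_offset m"] by simp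
    also have "\<dots> \<le> (1 + norm (t - probe_offset m)) * (1 + norm (probe_offset m :: real^'n))"
      by (simp add: algebra_simps)
    also have "\<dots> \<le> (1 + norm (t - probe_offset m)) * (a * (real m + 1))"
      using v by (intro mult_left_mono) (simp_all add: a_def algebra_simps)
    finally have "(1 + norm t) ^ k \<le> ((1 + norm (t - probe_offset m)) * (a * (real m + 1))) ^ k"
      by (rule power_mono) simp
    then have "(1 + norm t) ^ k * \<bar>iter_partial is ?f (t - probe_offset m)\<bar> \<le>
        ((1 + norm (t - probe_offset m)) * (a * (real m + 1))) ^ k * \<bar>iter_partial is ?f (t - probe_offset m)\<bar>"
      by (rule mult_right_mono) simp
    also have "\<dots> = (a ^ k * (real m + 1) ^ k) * ((1 + norm (t - probe_offset m)) ^ k * \<bar>iter_partial is ?f (t - probe_offset m)\<bar>)"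
      by (simp add: power_mult_distrib)
    also have "\<dots> \<le> (a ^ k * (real m + 1) ^ k) * ?S"
      by (intro mult_left_mono schwartz_seminorm_upper[OF f]) (simp add: a_def)
    finally show "(1 + norm t) ^ k * \<bar>iter_partial is (probe m) t\<bar> \<le> (a ^ k * ?S) * (real m + 1) ^ k"
      unfolding probe_def[abs_def] iter_partial_translate[OF smooth_plateau_product] by (simp add: mult_ac)
  qed
  moreover have "0 \<le> a ^ k * ?S" using S0 by (simp add: a_def)
  ultimately show ?thesis by blast
qed

lemma zero_schwartz: "(\<lambda>_. 0) \<in> schwartz_space"
  using schwartz_lincomb[OF probe_schwartz[of 0] probe_schwartz[of 0], of 0 0] by simp

text \<open>The topology is generated by a subbasis, so the claim is proved by induction on the generation of open
sets. Finite intersections keep it by taking the larger power and the smaller radius.\<close>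

lemma scaled_probes_near_zero:
  fixes U :: "(real^'n::finite \<Rightarrow> real) set"
  assumes "openin schwartz_topology U" "(\<lambda>_. 0) \<in> U"
  shows "\<exists>K. \<exists>r>0. \<forall>m c. \<bar>c\<bar> * (real m + 1) ^ K \<le> r \<longrightarrow> (\<lambda>t. c * probe m t) \<in> U"
proof -
  define S where "S = {{g \<in> schwartz_space. p (\<lambda>x. g x - f x) < e} | p f e.
     p \<in> {schwartz_seminorm k is | k is. True} \<and> (f :: real^'n \<Rightarrow> real) \<in> schwartz_space \<and> 0 < e}"
  have "generate_topology_on S U"
    using assms(1) unfolding schwartz_topology_def seminorm_topology_def S_def openin_topology_generated_by_iff .
  then show ?thesis using assms(2)
  proof (induction rule: generate_topology_on.induct)
    case (Int a b)
    then obtain K1 r1 K2 r2 where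
      1: "r1 > 0" "\<And>m c. \<bar>c\<bar> * (real m + 1) ^ K1 \<le> r1 \<Longrightarrow> (\<lambda>t. c * probe m t) \<in> a" and
      2: "r2 > 0" "\<And>m c. \<bar>c\<bar> * (real m + 1) ^ K2 \<le> r2 \<Longrightarrow> (\<lambda>t. c * probe m t) \<in> b"
      by (metis IntD1 IntD2)
    have "(\<lambda>t. c * probe m t) \<in> a \<inter> b" if c: "\<bar>c\<bar> * (real m + 1) ^ max K1 K2 \<le> min r1 r2" for m c
    proof
      have "\<bar>c\<bar> * (real m + 1) ^ K1 \<le> \<bar>c\<bar> * (real m + 1) ^ max K1 K2"
        by (intro mult_left_mono power_increasing) auto
      with c show "(\<lambda>t. c * probe m t) \<in> a" by (intro 1(2)) linarith
      have "\<bar>c\<bar> * (real m + 1) ^ K2 \<le> \<bar>c\<bar> * (real m + 1) ^ max K1 K2"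
        by (intro mult_left_mono power_increasing) auto
      with c show "(\<lambda>t. c * probe m t) \<in> b" by (intro 2(2)) linarith
    qed
    moreover have "min r1 r2 > 0" using 1(1) 2(1) by simp
    ultimately show ?case by blast
  next
    case (UN \<K>)
    then obtain a where a: "a \<in> \<K>" "(\<lambda>_. 0) \<in> a" by blast
    from UN.IH[OF this] obtain K r where "r > 0" "\<And>m c. \<bar>c\<bar> * (real m + 1) ^ K \<le> r \<Longrightarrow> (\<lambda>t. c * probe m t) \<in> a"
      by blast
    with a(1) show ?case by blast
  next
    case (Basis s)
    then obtain k "is" f e where s: "s = {g \<in> schwartz_space. schwartz_seminorm k is (\<lambda>x. g x - f x) < e}"
      and f: "f \<in> schwartz_space" unfolding S_def by blast
    define \<delta> where "\<delta> = e - schwartz_seminorm k is (\<lambda>x. 0 - f x)"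
    have \<delta>: "0 < \<delta>" using Basis.prems unfolding s \<delta>_def by simp
    obtain D where D: "0 \<le> D" "\<And>m. schwartz_seminorm k is (probe m :: real^'n \<Rightarrow> real) \<le> D * (real m + 1) ^ k"
      using schwartz_seminorm_probe_growth by blast
    have "(\<lambda>t. c * probe m t) \<in> s" if c: "\<bar>c\<bar> * (real m + 1) ^ k \<le> \<delta> / (D + 1)" for m c
    proof -
      have nf: "(\<lambda>x. 0 - f x) \<in> schwartz_space"
        using schwartz_lincomb[OF zero_schwartz f, of 1 "-1"] by simp
      have "schwartz_seminorm k is (\<lambda>x. c * probe m x + 1 * (0 - f x)) \<le>
          \<bar>c\<bar> * schwartz_seminorm k is (probe m) + \<bar>1\<bar> * schwartz_seminorm k is (\<lambda>x. 0 - f x)"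
        by (rule schwartz_seminorm_lincomb[OF probe_schwartz nf])
      also have "\<bar>c\<bar> * schwartz_seminorm k is (probe m :: real^'n \<Rightarrow> real) \<le> D * (\<bar>c\<bar> * (real m + 1) ^ k)"
        using mult_left_mono[OF D(2), of "\<bar>c\<bar>" m] by (simp add: mult_ac)
      also have "\<dots> \<le> D * (\<delta> / (D + 1))" by (rule mult_left_mono[OF c D(1)])
      also have "\<dots> < \<delta>" using \<delta> D(1) by (simp add: field_simps)
      finally have "schwartz_seminorm k is (\<lambda>x. c * probe m x - f x) < e"
        by (simp add: \<delta>_def)
      moreover have "(\<lambda>x. c * probe m x) \<in> schwartz_space"
        using schwartz_lincomb[OF probe_schwartz[of m] zero_schwartz, of c 0] by simp
      ultimately show ?thesis by (simp add: s)
    qed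
    moreover have "0 < \<delta> / (D + 1)" using \<delta> D(1) by simp
    ultimately show ?case by blast
  qed simp
qed

text \<open>The preimage of the unit ball is a neighbourhood of 0. It contains the probes after division by
a fixed power of \<open>m + 1\<close>.\<close>

lemma tempered_probe_growth:
  assumes "T \<in> tempered_distributions"
  shows "\<exists>C K. \<forall>m. \<bar>T (probe m :: real^'n::finite \<Rightarrow> real)\<bar> \<le> C * (real m + 1) ^ K"
proof -
  obtain L where lin: "linear_functional_on schwartz_space L"
    and cont: "continuous_map schwartz_topology euclideanreal L"
    and ext: "\<And>f. f \<in> test_functions \<Longrightarrow> L f = T f"
    using assms unfolding tempered_distributions_def by blast
  have L_scale: "L (\<lambda>t. c * probe m t) = c * L (probe m)" for c m
  proof -
    have "\<forall>a b. L (\<lambda>x. a * probe m x + b * probe m x) = a * L (probe m) + b * L (probe m)"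
      using lin probe_schwartz[of m] unfolding linear_functional_on_def by blast
    from spec[OF spec[OF this, of c], of 0] show ?thesis by simp
  qed
  let ?U = "{f \<in> topspace schwartz_topology. L f \<in> ball 0 1}"
  have "openin schwartz_topology ?U"
    by (rule openin_continuous_map_preimage[OF cont]) simp
  moreover have "(\<lambda>_. 0) \<in> ?U"
  proof -
    have "openin schwartz_topology {g \<in> schwartz_space. schwartz_seminorm 0 [] (\<lambda>x. g x - (0::real)) < 1}"
      unfolding schwartz_topology_def by (rule seminorm_topology_ball[OF _ zero_schwartz]) auto
    moreover have "(\<lambda>_. 0) \<in> {g \<in> schwartz_space. schwartz_seminorm 0 [] (\<lambda>x. g x - (0::real)) < 1}"
      using zero_schwartz by (simp add: schwartz_seminorm_zero)
    ultimately have "(\<lambda>_. 0) \<in> topspace schwartz_topology" using openin_subset by blast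
    moreover have "L (\<lambda>_. 0) = 0" using L_scale[of 0 0] by simp
    ultimately show ?thesis by simp
  qed
  ultimately obtain K r where r: "0 < r"
    "\<And>m c. \<bar>c\<bar> * (real m + 1) ^ K \<le> r \<Longrightarrow> (\<lambda>t. c * probe m t) \<in> ?U"
    using scaled_probes_near_zero[of ?U] by blast
  have "\<bar>T (probe m)\<bar> \<le> (1 / r) * (real m + 1) ^ K" for m
  proof -
    define w where "w = (real m + 1) ^ K"
    have w: "0 < w" by (simp add: w_def)
    have "(\<lambda>t. (r / w) * probe m t) \<in> ?U"
      using r(1) w by (intro r(2)) (simp add: w_def[symmetric])
    then have "L (\<lambda>t. (r / w) * probe m t) \<in> ball 0 1" by (rule CollectE) (erule conjunct2)
    then have "\<bar>(r / w) * L (probe m)\<bar> < 1" unfolding L_scale by simp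
    then have "\<bar>L (probe m)\<bar> * (r / w) < 1" using r(1) w by (simp add: abs_mult mult.commute)
    then have "\<bar>L (probe m)\<bar> < w / r" using r(1) w by (simp add: field_simps)
    then show ?thesis using ext[OF probe_test_function[of m]] by (simp add: w_def)
  qed
  then show ?thesis by blast
qed

definition bump_product :: "real^'n::finite \<Rightarrow> real" where
  "bump_product s = (\<Prod>i\<in>UNIV. bump (s $ i))"

lemma bump_product_nonneg: "0 \<le> bump_product s"
  unfolding bump_product_def by (intro prod_nonneg bump_nonneg)

lemma bump_product_support: "bump_product s \<noteq> 0 \<Longrightarrow> 0 < s $ i \<and> s $ i < 1"
  unfolding bump_product_def using bump_eq_0 by fastforce

lemma continuous_bump_product: "continuous_on A bump_product"
  unfolding bump_product_def
  by (intro continuous_intros continuous_on_compose2[OF continuous_bump[of UNIV]] subset_UNIV)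

lemma bump_product_measurable [measurable]: "bump_product \<in> borel_measurable borel"
  by (intro borel_measurable_continuous_onI continuous_bump_product)

lemma bump_product_integrable: "integrable lborel (bump_product :: real^'n::finite \<Rightarrow> real)"
proof -
  have int: "integrable lborel (\<lambda>s::real^'n. indicator (cbox 0 (\<chi> i. 1)) s *\<^sub>R bump_product s)"
    by (intro borel_integrable_compact compact_cbox continuous_bump_product)
  have "indicator (cbox 0 (\<chi> i. 1)) s *\<^sub>R bump_product s = bump_product s" for s :: "real^'n"
  proof (cases "bump_product s = 0")
    case False
    then have "s \<in> cbox 0 (\<chi> i. 1)"
      unfolding mem_box_cart using bump_product_support[OF False] by (simp add: less_imp_le)
    then show ?thesis by simp
  qed simp
  with int show ?thesis by (simp only:)
qed

text \<open>A value of the type \<open>itself\<close> carries the dimension, which occurs nowhere else in the expression.\<close>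

definition bump_mass :: "'n::finite itself \<Rightarrow> real" where
  "bump_mass _ = (LINT s|lborel. bump_product (s :: real^'n))"

lemma bump_mass_pos: "0 < bump_mass TYPE('n::finite)"
proof -
  let ?I = "LINT s|lborel. bump_product (s :: real^'n)"
  have "0 \<le> ?I" by (rule Bochner_Integration.integral_nonneg) (rule bump_product_nonneg)
  moreover have "?I \<noteq> 0"
  proof
    assume "?I = 0"
    then have ae: "AE s in lborel. bump_product (s :: real^'n) = 0"
      using integral_nonneg_eq_0_iff_AE[OF bump_product_integrable] bump_product_nonneg by auto
    have "AE s in lborel. s \<notin> box (0::real^'n) (\<chi> i. 1)"
      using ae
    proof eventually_elim
      case (elim s)
      show ?case
      proof
        assume "s \<in> box 0 (\<chi> i. 1)"
        then have "0 < bump (s $ i)" for i by (simp add: mem_box_cart bump_pos_iff)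
        then have "0 < bump_product s" unfolding bump_product_def by (intro prod_pos) blast
        with elim show False by simp
      qed
    qed
    then have "emeasure lborel (box (0::real^'n) (\<chi> i. 1)) = 0"
      by (subst (asm) AE_iff_null) (auto simp: null_sets_def)
    moreover have "emeasure lborel (box (0::real^'n) (\<chi> i. 1)) \<noteq> 0"
    proof -
      have "(\<chi> i. 1) \<bullet> b = 1" if "b \<in> Basis" for b :: "real^'n"
        using that by (auto simp: Basis_vec_def inner_axis)
      then show ?thesis by (simp add: emeasure_lborel_box_eq)
    qed
    ultimately show False by simp
  qed
  ultimately show ?thesis by (simp add: bump_mass_def)
qed

definition two :: "real^'n::finite" where "two = (\<chi> i. 2)"

text \<open>Multiplying out the product of differences gives one translate of the bump product for each corner of
the box from \<open>probe_offset m\<close> to \<open>probe_offset m + two\<close>, with the sign that the corner has in an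
increment, up to the factor \<open>(-1)\<^sup>d\<close>.\<close>

lemma mixed_partial_probe:
  "mixed_partial (probe m) (t :: real^'n::finite) =
    (\<Sum>E\<in>UNIV. (-1) ^ card (- E) * bump_product (t - corner E (probe_offset m) (probe_offset m + two)))"
proof -
  let ?u = "t - probe_offset m"
  have "mixed_partial (probe m) t = (\<Prod>i\<in>UNIV. bump (?u $ i) + - bump (?u $ i - 2))"
    unfolding probe_def[abs_def] mixed_partial_eq iter_partial_translate[OF smooth_plateau_product]
    unfolding mixed_partial_eq[symmetric] by (simp add: mixed_partial_plateau_product)
  also have "\<dots> = (\<Sum>E\<in>UNIV. (\<Prod>i\<in>E. bump (?u $ i)) * (\<Prod>i\<in>- E. - bump (?u $ i - 2)))"
    by (subst prod_add) (simp_all add: Compl_eq_Diff_UNIV)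
  also have "\<dots> = (\<Sum>E\<in>UNIV. (-1) ^ card (- E) * bump_product (t - corner E (probe_offset m) (probe_offset m + two)))"
  proof (rule sum.cong[OF refl])
    fix E :: "'n set"
    let ?w = "t - corner E (probe_offset m) (probe_offset m + two)"
    have "bump_product ?w = (\<Prod>i\<in>E. bump (?w $ i)) * (\<Prod>i\<in>- E. bump (?w $ i))"
      unfolding bump_product_def
      by (subst prod.union_disjoint[symmetric]) (auto simp: Compl_partition)
    moreover have "(\<Prod>i\<in>E. bump (?w $ i)) = (\<Prod>i\<in>E. bump (?u $ i))"
      by (rule prod.cong) (auto simp: corner_def)
    moreover have "(\<Prod>i\<in>- E. bump (?w $ i)) = (\<Prod>i\<in>- E. bump (?u $ i - 2))"
      by (rule prod.cong) (auto simp: corner_def two_def algebra_simps)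
    moreover have "(\<Prod>i\<in>- E. - bump (?u $ i - 2)) = (-1) ^ card (- E) * (\<Prod>i\<in>- E. bump (?u $ i - 2))"
      by (rule prod_uminus)
    ultimately show "(\<Prod>i\<in>E. bump (?u $ i)) * (\<Prod>i\<in>- E. - bump (?u $ i - 2)) = (-1) ^ card (- E) * bump_product ?w"
      by simp
  qed
  finally show ?thesis .
qed

lemma integral_lborel_translate:
  fixes f :: "'b::euclidean_space \<Rightarrow> real"
  assumes "f \<in> borel_measurable borel"
  shows "(LINT t|lborel. f t) = (LINT s|lborel. f (s + c))"
    and "integrable lborel (\<lambda>s. f (s + c)) \<Longrightarrow> integrable lborel f"
proof -
  have c: "(+) c \<in> lborel \<rightarrow>\<^sub>M borel" by simp
  have "(LINT t|lborel. f t) = (LINT t|distr lborel borel ((+) c). f t)" by (simp only: lborel_distr_plus)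
  also have "\<dots> = (LINT s|lborel. f (c + s))" using assms by (rule integral_distr[OF c])
  finally show "(LINT t|lborel. f t) = (LINT s|lborel. f (s + c))" by (simp only: add.commute)
  assume "integrable lborel (\<lambda>s. f (s + c))"
  then have "integrable (distr lborel borel ((+) c)) f"
    using assms by (subst integrable_distr_eq[OF c]) (simp_all add: add.commute)
  then show "integrable lborel f" by (simp only: lborel_distr_plus)
qed

context
  fixes x :: "real^'n::finite \<Rightarrow> real"
  assumes lamp: "lamp x"
begin

lemma bump_translate_integrable:
  assumes c: "c \<in> orthant"
  shows "integrable lborel (\<lambda>s. bump_product s * (indicator orthant (s + c) * x (s + c)))"
proof -
  let ?K = "cbox c (c + (\<chi> i. 1))"
  have K: "?K \<subseteq> orthant"
  proof
    fix t assume "t \<in> ?K"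
    then have "c $ i \<le> t $ i" for i by (simp add: mem_box_cart)
    then have "c \<le> t" by (simp add: less_eq_vec_def)
    moreover have "0 \<le> c" using c by simp
    ultimately show "t \<in> orthant" using order_trans by blast
  qed
  obtain B where B: "\<And>t. t \<in> ?K \<Longrightarrow> \<bar>x t\<bar> \<le> B"
    using lamp_bounded_on_compact[OF lamp compact_cbox K] by blast
  show ?thesis
  proof (rule Bochner_Integration.integrable_bound)
    show "integrable lborel (\<lambda>s. B * bump_product (s :: real^'n))"
      by (rule integrable_mult_right) (rule bump_product_integrable)
    have "(\<lambda>s. indicator orthant (s + c) * x (s + c)) \<in> borel_measurable borel"
      by (rule measurable_compose[OF _ lamp_path_measurable[OF lamp]]) simp
    then show "(\<lambda>s. bump_product s * (indicator orthant (s + c) * x (s + c))) \<in> borel_measurable lborel"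
      by measurable
    show "AE s in lborel. norm (bump_product s * (indicator orthant (s + c) * x (s + c))) \<le> norm (B * bump_product s)"
    proof (intro AE_I2)
      fix s :: "real^'n"
      show "norm (bump_product s * (indicator orthant (s + c) * x (s + c))) \<le> norm (B * bump_product s)"
      proof (cases "bump_product s = 0")
        case False
        have "s + c \<in> ?K"
          unfolding mem_box_cart using bump_product_support[OF False] by (simp add: less_imp_le)
        from B[OF this] have "\<bar>indicator orthant (s + c) * x (s + c)\<bar> \<le> \<bar>B\<bar>"
          by (cases "s + c \<in> orthant") simp_all
        then have "\<bar>bump_product s\<bar> * \<bar>indicator orthant (s + c) * x (s + c)\<bar> \<le> \<bar>bump_product s\<bar> * \<bar>B\<bar>"
          by (rule mult_left_mono) simp
        then show ?thesis by (simp only: real_norm_def abs_mult mult.commute)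
      qed simp
    qed
  qed
qed

lemma probe_corner_orthant: "corner E (probe_offset m) (probe_offset m + two) \<in> (orthant :: (real^'n) set)"
  by (simp add: corner_def probe_offset_def two_def less_eq_vec_def)

text \<open>Moving each translated bump back to the origin turns the integral of the path against the mixed
derivative into an average of increments over the boxes from \<open>v + s\<close> to \<open>v + s + two\<close>, \<open>v\<close> being the
offset of the probe. For \<open>s\<close> in the unit cube all these boxes contain the unit cube from \<open>v + 1\<close> to
\<open>v + 2\<close> and are contained in the cube from \<open>v\<close> to \<open>v + 3\<close>.\<close>

lemma white_noise_probe:
  "white_noise x (probe m) =
    (LINT s|lborel. bump_product s * increment x (s + probe_offset m) (s + probe_offset m + two))"
proof -
  let ?c = "\<lambda>E. corner E (probe_offset m) (probe_offset m + two) :: real^'n"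
  let ?H = "\<lambda>E s. bump_product s * (indicator orthant (s + ?c E) * x (s + ?c E))"
  let ?F = "\<lambda>E t. indicator orthant t * x t * bump_product (t - ?c E)"
  have FH: "?F E (s + ?c E) = ?H E s" for E s by (simp add: mult.commute)
  have Fm: "?F E \<in> borel_measurable borel" for E
  proof -
    have "(\<lambda>t. bump_product (t - ?c E)) \<in> borel_measurable borel"
      by (rule measurable_compose[OF _ bump_product_measurable]) simp
    then show ?thesis by (rule borel_measurable_times[OF lamp_path_measurable[OF lamp]])
  qed
  have H: "integrable lborel (?H E)" for E by (rule bump_translate_integrable[OF probe_corner_orthant])
  have Fi: "integrable lborel (?F E)" for E
    using integral_lborel_translate(2)[where f="?F E" and c="?c E", OF Fm] H[of E] unfolding FH by blast
  have "white_noise x (probe m) = (-1) ^ CARD('n) *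
      (LINT t|lborel. (\<Sum>E\<in>UNIV. (-1) ^ card (- E) * ?F E t))"
    unfolding white_noise_def set_lebesgue_integral_def mixed_partial_probe
    by (simp add: sum_distrib_left mult_ac)
  also have "\<dots> = (-1) ^ CARD('n) * (\<Sum>E\<in>UNIV. (-1) ^ card (- E) * (LINT t|lborel. ?F E t))"
    using Fi by (subst Bochner_Integration.integral_sum) simp_all
  also have "\<dots> = (\<Sum>E\<in>UNIV. (-1) ^ card E * (LINT t|lborel. ?F E t))"
  proof -
    have "(-1) ^ CARD('n) * (-1) ^ card (- E) = (-1 :: real) ^ card E" for E :: "'n set"
    proof -
      have "CARD('n) = card E + card (- E)"
        by (subst card_Un_disjoint[symmetric]) (auto simp: Compl_partition)
      then show ?thesis by (simp add: power_add mult.assoc flip: power_mult_distrib)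
    qed
    then show ?thesis by (simp add: sum_distrib_left mult.assoc[symmetric])
  qed
  also have "\<dots> = (\<Sum>E\<in>UNIV. (-1) ^ card E * (LINT s|lborel. ?H E s))"
  proof -
    have "(LINT t|lborel. ?F E t) = (LINT s|lborel. ?H E s)" for E
      using integral_lborel_translate(1)[where f="?F E" and c="?c E", OF Fm] unfolding FH .
    then show ?thesis by (simp only:)
  qed
  also have "\<dots> = (LINT s|lborel. (\<Sum>E\<in>UNIV. (-1) ^ card E * ?H E s))"
    using H by (subst Bochner_Integration.integral_sum) simp_all
  also have "\<dots> = (LINT s|lborel. bump_product s * increment x (s + probe_offset m) (s + probe_offset m + two))"
  proof (rule Bochner_Integration.integral_cong[OF refl])
    fix s :: "real^'n"
    show "(\<Sum>E\<in>UNIV. (-1) ^ card E * ?H E s) =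
        bump_product s * increment x (s + probe_offset m) (s + probe_offset m + two)"
    proof (cases "bump_product s = 0")
      case False
      have "s + ?c E \<in> orthant" for E
        using bump_product_support[OF False] probe_corner_orthant[of E m]
        by (auto simp: less_eq_vec_def intro: add_nonneg_nonneg less_imp_le)
      moreover have "corner E (s + probe_offset m) (s + probe_offset m + two) = s + ?c E" for E
        by (auto simp: corner_def vec_eq_iff)
      ultimately show ?thesis
        unfolding increment_corner by (simp add: sum_distrib_left mult.left_commute)
    qed simp
  qed
  finally show ?thesis .
qed

end

definition selecting_shifts :: "nat \<Rightarrow> nat \<Rightarrow> ('n::finite \<Rightarrow> nat) \<Rightarrow> (real^'n) set" where
  "selecting_shifts n m k =
     {s. grid_point (dyadic_grid n) k \<in> half_open_box (s + probe_offset m) (s + probe_offset m + two)}"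

text \<open>When \<open>s\<close> is rounded up to the grid of level \<open>n\<close>, the box from \<open>v + s\<close> to \<open>v + s + two\<close> consists of the
cells whose lower corner lies in the unrounded box. The coefficient of a cell is the normalised weight
of the \<open>s\<close> for which the cell is selected.\<close>

definition probe_coeff :: "nat \<Rightarrow> nat \<Rightarrow> ('n::finite \<Rightarrow> nat) \<Rightarrow> real" where
  "probe_coeff n m k = (LINT s|lborel. bump_product s *
     indicator (selecting_shifts n m k) s)
   / bump_mass TYPE('n)"

lemma selected_measurable:
  "selecting_shifts n m k \<in> sets (borel :: (real^'n::finite) measure)"
proof -
  have "{s. g \<in> half_open_box (s + v) (s + v + two)} =
      (\<Inter>i. {s. s $ i + v $ i < g $ i} \<inter> {s. g $ i \<le> s $ i + v $ i + 2})" for g v :: "real^'n"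
    by (auto simp: half_open_box_def two_def)
  also have "(\<Inter>i. {s. s $ i + v $ i < g $ i} \<inter> {s. g $ i \<le> s $ i + v $ i + 2}) \<in> sets borel" for g v :: "real^'n"
    by (intro sets.countable_INT'' sets.Int) (auto intro!: borel_measurable_le borel_measurable_less borel_measurable_const borel_measurable_continuous_onI continuous_intros)
  finally show ?thesis unfolding selecting_shifts_def .
qed

lemma selected_integrable:
  "integrable lborel (\<lambda>s::real^'n::finite. bump_product s *
     indicator (selecting_shifts n m k) s)"
  using integrable_mult_indicator[OF selected_measurable[of n m k, folded sets_lborel] bump_product_integrable]
  by (simp add: mult.commute)

text \<open>For \<open>s\<close> in the open unit cube every cell of the own core is selected, and no cell of another core.\<close>

lemma probe_coeff_core:
  fixes k :: "'n::finite \<Rightarrow> nat"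
  assumes "k \<in> core_box n m'"
  shows "probe_coeff n m k = (if m' = m then 1 else 0 :: real)"
proof -
  have k: "3 * real m' + 1 \<le> real (k i) / 2 ^ n" "real (k i) / 2 ^ n < 3 * real m' + 2" for i
  proof -
    have "(3 * m' + 1) * 2 ^ n \<le> k i" "k i < (3 * m' + 2) * 2 ^ n"
      using assms by (auto simp: index_box_def)
    then have "real ((3 * m' + 1) * 2 ^ n) \<le> real (k i)" "real (k i) < real ((3 * m' + 2) * 2 ^ n)"
      by (simp_all only: of_nat_le_iff of_nat_less_iff)
    then show "3 * real m' + 1 \<le> real (k i) / 2 ^ n" "real (k i) / 2 ^ n < 3 * real m' + 2"
      by (simp_all add: field_simps)
  qed
  have eq: "bump_product s * indicator (selecting_shifts n m k) s =
      (if m' = m then bump_product s else 0)" for s :: "real^'n"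
  proof (cases "bump_product s = 0")
    case False
    note s = bump_product_support[OF False]
    show ?thesis
    proof (cases "m' = m")
      case True
      have "s $ i + 3 * real m < real (k i) / 2 ^ n \<and> real (k i) / 2 ^ n \<le> s $ i + 3 * real m + 2" for i
        using k[of i] s[of i] True by linarith
      then have "grid_point (dyadic_grid n) k \<in> half_open_box (s + probe_offset m) (s + probe_offset m + two)"
        by (simp add: half_open_box_def grid_point_def probe_offset_def two_def)
      then show ?thesis using True by (simp add: selecting_shifts_def)
    next
      case neq: False
      have "\<not> (s $ i + 3 * real m < real (k i) / 2 ^ n \<and> real (k i) / 2 ^ n \<le> s $ i + 3 * real m + 2)" for i
      proof -
        have "m' + 1 \<le> m \<or> m + 1 \<le> m'" using neq by linarith
        then have "real m' + 1 \<le> real m \<or> real m + 1 \<le> real m'" by linarith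
        then show ?thesis using k[of i] s[of i] by linarith
      qed
      then have "grid_point (dyadic_grid n) k \<notin> half_open_box (s + probe_offset m) (s + probe_offset m + two)"
        by (simp add: half_open_box_def grid_point_def probe_offset_def two_def)
      then show ?thesis using neq by (simp add: selecting_shifts_def)
    qed
  qed simp
  show ?thesis
    unfolding probe_coeff_def eq using bump_mass_pos[where 'n='n] by (simp add: bump_mass_def)
qed

lemma increment_dyadic_above_eq_sum:
  fixes s :: "real^'n::finite"
  assumes s: "\<And>i. 0 < s $ i \<and> s $ i < 1" and m: "m < r"
  shows "increment x (dyadic_above n s + probe_offset m) (dyadic_above n s + probe_offset m + two) =
    (\<Sum>k\<in>index_box (\<lambda>_. 0) (\<lambda>_. 3 * r * 2 ^ n).
      indicator (selecting_shifts n m k) s *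
      cell_increment (dyadic_grid n) x k)"
proof -
  let ?J = "index_box (\<lambda>_. 0) (\<lambda>_. 3 * r * 2 ^ n) :: ('n \<Rightarrow> nat) set"
  let ?sel = "\<lambda>k s. grid_point (dyadic_grid n) k \<in> half_open_box (s + probe_offset m) (s + probe_offset m + two)"
  define f where "f i = nat \<lfloor>2 ^ n * s $ i\<rfloor>" for i
  have f: "real (f i) \<le> 2 ^ n * s $ i" "2 ^ n * s $ i < real (f i) + 1" "dyadic_above n s $ i = (real (f i) + 1) / 2 ^ n" for i
  proof -
    have "0 \<le> 2 ^ n * s $ i" using s[of i] by (simp add: less_imp_le)
    then have "real (f i) = real_of_int \<lfloor>2 ^ n * s $ i\<rfloor>" by (simp add: f_def)
    then show "real (f i) \<le> 2 ^ n * s $ i" "2 ^ n * s $ i < real (f i) + 1" "dyadic_above n s $ i = (real (f i) + 1) / 2 ^ n"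
      by (simp_all add: dyadic_above_def)
  qed
  have f1: "f i + 1 \<le> 2 ^ n" for i
  proof -
    have "real (f i) < 2 ^ n * 1"
      using f(1)[of i] s[of i] by (intro le_less_trans[OF f(1)] mult_strict_left_mono) simp_all
    then have "f i < 2 ^ n" by (simp flip: of_nat_less_iff)
    then show ?thesis by simp
  qed
  define l where "l i = 3 * m * 2 ^ n + f i + 1" for i
  define u where "u i = (3 * m + 2) * 2 ^ n + f i + 1" for i
  have gl: "grid_point (dyadic_grid n) l = dyadic_above n s + probe_offset m"
    by (simp add: grid_point_def vec_eq_iff f(3) probe_offset_def l_def field_simps)
  have gu: "grid_point (dyadic_grid n) u = dyadic_above n s + probe_offset m + two"
    by (simp add: grid_point_def vec_eq_iff f(3) probe_offset_def two_def u_def field_simps)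
  have sel: "?sel k s \<longleftrightarrow> k \<in> index_box l u" for k
  proof -
    have "s $ i + 3 * real m < real (k i) / 2 ^ n \<longleftrightarrow> l i \<le> k i" for i
    proof -
      have "s $ i + 3 * real m < real (k i) / 2 ^ n \<longleftrightarrow> 2 ^ n * s $ i + real (3 * m * 2 ^ n) < real (k i)"
        by (simp add: field_simps)
      also have "\<dots> \<longleftrightarrow> 3 * m * 2 ^ n + f i < k i"
        using f(1,2)[of i] by linarith
      finally show ?thesis by (simp add: l_def Suc_le_eq)
    qed
    moreover have "real (k i) / 2 ^ n \<le> s $ i + 3 * real m + 2 \<longleftrightarrow> k i < u i" for i
    proof -
      have "real (k i) / 2 ^ n \<le> s $ i + 3 * real m + 2 \<longleftrightarrow> real (k i) \<le> 2 ^ n * s $ i + real ((3 * m + 2) * 2 ^ n)"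
        by (simp add: field_simps)
      also have "\<dots> \<longleftrightarrow> k i \<le> (3 * m + 2) * 2 ^ n + f i"
        using f(1,2)[of i] by linarith
      finally show ?thesis by (simp add: u_def less_Suc_eq_le)
    qed
    ultimately show ?thesis
      by (simp add: half_open_box_def grid_point_def probe_offset_def two_def index_box_def)
  qed
  have sub: "index_box l u \<subseteq> ?J"
  proof -
    have "u i \<le> 3 * r * 2 ^ n" for i
    proof -
      have "u i \<le> (3 * m + 3) * 2 ^ n" using f1[of i] by (simp add: u_def algebra_simps)
      also have "\<dots> \<le> 3 * r * 2 ^ n" using m by (intro mult_right_mono) simp_all
      finally show ?thesis .
    qed
    then show ?thesis by (auto simp: index_box_def intro: less_le_trans)
  qed
  have "increment x (dyadic_above n s + probe_offset m) (dyadic_above n s + probe_offset m + two) =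
      (\<Sum>k\<in>index_box l u. cell_increment (dyadic_grid n) x k)"
    unfolding gu[symmetric] unfolding gl[symmetric]
    by (rule increment_eq_sum_cells) (simp add: l_def u_def)
  also have "\<dots> = (\<Sum>k\<in>?J. indicator {s. ?sel k s} s * cell_increment (dyadic_grid n) x k)"
    using sub by (intro sum.mono_neutral_cong_left) (auto simp: sel)
  finally show ?thesis by (simp add: selecting_shifts_def)
qed

text \<open>The combinations are the averages of the increments with \<open>s\<close> rounded up to the dyadic grid. The lamp
property gives pointwise convergence, and boundedness of the path on compact sets gives domination.\<close>

lemma probe_coeff_sum_tendsto:
  assumes lamp: "lamp (x :: real^'n::finite \<Rightarrow> real)" and m: "m < r"
  shows "(\<lambda>n. \<Sum>k\<in>index_box (\<lambda>_. 0) (\<lambda>_. 3 * r * 2 ^ n). probe_coeff n m k * cell_increment (dyadic_grid n) x k)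
    \<longlonglongrightarrow> white_noise x (probe m) / bump_mass TYPE('n)"
proof -
  let ?J = "\<lambda>n. index_box (\<lambda>_. 0) (\<lambda>_. 3 * r * 2 ^ n) :: ('n \<Rightarrow> nat) set"
  let ?sel = "\<lambda>n k s. indicator (selecting_shifts n m k) s :: real"
  let ?f = "\<lambda>s. increment x (s + probe_offset m) (s + probe_offset m + two)"
  have approx: "bump_product s * ?f (dyadic_above n s) =
      (\<Sum>k\<in>?J n. bump_product s * ?sel n k s * cell_increment (dyadic_grid n) x k)" for n s
  proof (cases "bump_product s = 0")
    case False
    show ?thesis
      unfolding increment_dyadic_above_eq_sum[OF bump_product_support[OF False] m]
      by (simp only: sum_distrib_left mult.assoc)
  qed simp
  have int_approx: "integrable lborel (\<lambda>s. bump_product s * ?f (dyadic_above n s))" for n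
    unfolding approx by (intro Bochner_Integration.integrable_sum integrable_mult_left selected_integrable)
  have "(LINT s|lborel. bump_product s * ?f (dyadic_above n s)) =
      bump_mass TYPE('n) * (\<Sum>k\<in>?J n. probe_coeff n m k * cell_increment (dyadic_grid n) x k)" for n
  proof -
    have "(LINT s|lborel. bump_product s * ?f (dyadic_above n s)) =
        (\<Sum>k\<in>?J n. (LINT s|lborel. bump_product s * ?sel n k s) * cell_increment (dyadic_grid n) x k)"
      unfolding approx
      by (subst Bochner_Integration.integral_sum) (simp_all add: selected_integrable)
    also have "\<dots> = (\<Sum>k\<in>?J n. bump_mass TYPE('n) * (probe_coeff n m k * cell_increment (dyadic_grid n) x k))"
      using bump_mass_pos[where 'n='n] by (simp add: probe_coeff_def)
    finally show ?thesis by (simp only: sum_distrib_left)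
  qed
  moreover have "(\<lambda>n. LINT s|lborel. bump_product s * ?f (dyadic_above n s)) \<longlonglongrightarrow> (LINT s|lborel. bump_product s * ?f s)"
  proof -
    define K where "K = cbox (probe_offset m) (probe_offset m + two + two :: real^'n)"
    have KO: "K \<subseteq> orthant"
    proof
      fix t assume "t \<in> K"
      then have "3 * real m \<le> t $ i" for i by (simp add: K_def mem_box_cart probe_offset_def)
      then have "0 \<le> t $ i" for i by (rule order_trans[rotated]) simp
      then show "t \<in> orthant" by (simp add: less_eq_vec_def)
    qed
    obtain B where B: "\<And>t. t \<in> K \<Longrightarrow> \<bar>x t\<bar> \<le> B"
      using lamp_bounded_on_compact[OF lamp _ KO] by (auto simp: K_def)
    have f_bound: "\<bar>?f u\<bar> \<le> (\<Sum>E\<in>(UNIV :: 'n set set). B)" if u: "\<And>i. 0 \<le> u $ i \<and> u $ i \<le> 2" for u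
    proof -
      have "corner E (u + probe_offset m) (u + probe_offset m + two) \<in> K" for E
      proof -
        have "u $ i \<le> 4" for i using u[of i] by linarith
        then show ?thesis
          unfolding K_def mem_box_cart using u by (simp add: corner_def two_def)
      qed
      then show ?thesis
        unfolding increment_corner
        by (intro order_trans[OF sum_abs] sum_mono) (simp add: abs_mult B)
    qed
    have above: "0 \<le> dyadic_above n s $ i \<and> dyadic_above n s $ i \<le> 2" if "0 < s $ i \<and> s $ i < 1" for n s and i :: 'n
    proof -
      have "1 / 2 ^ n \<le> (1 :: real)" by simp
      with dyadic_above_bounds(1)[where n=n and t=s and i=i] dyadic_above_bounds(2)[where n=n and t=s and i=i] that
      show ?thesis by linarith
    qed
    have lim: "(\<lambda>n. bump_product s * ?f (dyadic_above n s)) \<longlonglongrightarrow> bump_product s * ?f s" for s :: "real^'n"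
    proof (cases "bump_product s = 0")
      case False
      note s = bump_product_support[OF False]
      have "(\<lambda>n. x (corner E (dyadic_above n s + probe_offset m) (dyadic_above n s + probe_offset m + two)))
          \<longlonglongrightarrow> x (corner E (s + probe_offset m) (s + probe_offset m + two))" for E
      proof (rule lamp_tendsto_above[OF lamp])
        have eq: "corner E (t + probe_offset m) (t + probe_offset m + two) = t + corner E (probe_offset m) (probe_offset m + two)" for t :: "real^'n"
          by (auto simp: corner_def vec_eq_iff)
        show "corner E (s + probe_offset m) (s + probe_offset m + two) \<in> orthant"
        proof -
          have "0 \<le> s $ i + 3 * real m" for i using s[of i] by (intro add_nonneg_nonneg) simp_all
          then have "0 \<le> s $ i + 3 * real m" "0 \<le> s $ i + 3 * real m + 2" for i
            by (simp_all add: add_nonneg_nonneg)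
          then show ?thesis by (simp add: corner_def less_eq_vec_def probe_offset_def two_def)
        qed
        show "(\<lambda>n. corner E (dyadic_above n s + probe_offset m) (dyadic_above n s + probe_offset m + two))
            \<longlonglongrightarrow> corner E (s + probe_offset m) (s + probe_offset m + two)"
          unfolding eq by (intro tendsto_intros dyadic_above_tendsto)
        show "corner E (s + probe_offset m) (s + probe_offset m + two) $ i <
            corner E (dyadic_above n s + probe_offset m) (dyadic_above n s + probe_offset m + two) $ i" for n i
          unfolding eq using dyadic_above_bounds(1) by simp
      qed
      then show ?thesis unfolding increment_corner by (intro tendsto_intros)
    qed simp
    show ?thesis
    proof (rule integral_dominated_convergence[where w="\<lambda>s. (\<Sum>E\<in>(UNIV :: 'n set set). B) * bump_product s"])
      show meas: "(\<lambda>s. bump_product s * ?f (dyadic_above n s)) \<in> borel_measurable lborel" for n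
        using int_approx by (rule borel_measurable_integrable)
      show "(\<lambda>s. bump_product s * ?f s) \<in> borel_measurable lborel"
        by (rule borel_measurable_LIMSEQ_real[OF lim meas])
      show "integrable lborel (\<lambda>s::real^'n. (\<Sum>E\<in>(UNIV :: 'n set set). B) * bump_product s)"
        by (rule integrable_mult_right) (rule bump_product_integrable)
      show "AE s in lborel. (\<lambda>n. bump_product s * ?f (dyadic_above n s)) \<longlonglongrightarrow> bump_product s * ?f s"
        using lim by (rule AE_I2)
      show "AE s in lborel. norm (bump_product s * ?f (dyadic_above n s)) \<le> (\<Sum>E\<in>(UNIV :: 'n set set). B) * bump_product s" for n
      proof (rule AE_I2)
        fix s :: "real^'n"
        show "norm (bump_product s * ?f (dyadic_above n s)) \<le> (\<Sum>E\<in>(UNIV :: 'n set set). B) * bump_product s"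
        proof (cases "bump_product s = 0")
          case False
          have "\<bar>?f (dyadic_above n s)\<bar> \<le> (\<Sum>E\<in>(UNIV :: 'n set set). B)"
            by (rule f_bound, rule above, rule bump_product_support[OF False])
          from mult_left_mono[OF this bump_product_nonneg[of s]] show ?thesis
            using bump_product_nonneg[of s] by (simp only: real_norm_def abs_mult abs_of_nonneg mult.commute)
        qed simp
      qed
    qed
  qed
  ultimately have "(\<lambda>n. bump_mass TYPE('n) * (\<Sum>k\<in>?J n. probe_coeff n m k * cell_increment (dyadic_grid n) x k))
      \<longlonglongrightarrow> white_noise x (probe m)"
    unfolding white_noise_probe[OF lamp] by simp
  from tendsto_divide[OF this tendsto_const, of "bump_mass TYPE('n)"] show ?thesis
    using bump_mass_pos[where 'n='n] by simp
qed


section \<open>Temperedness of the white noise\<close>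

context levy_field
begin

text \<open>The pairings with the probes are limits of combinations of cell increments. If they all stay below
\<open>N (m + 1)\<^sup>N\<close>, then for each \<open>r\<close> the first \<open>r\<close> combinations are eventually below a slightly larger level,
an event whose probability is bounded uniformly in the grid and tends to 0 as \<open>r\<close> grows. Countably many
\<open>N\<close> exhaust the polynomial bounds.\<close>

lemma AE_not_tempered:
  assumes inf: "\<And>\<eta>. 0 < \<eta> \<Longrightarrow> (\<integral>\<^sup>+ \<omega>. ennreal (\<bar>X (\<chi> i. 1) \<omega>\<bar> powr \<eta>) \<partial>M) = \<infinity>"
  shows "AE \<omega> in M. white_noise (\<lambda>t. X t \<omega>) \<notin> tempered_distributions"
proof -
  let ?\<kappa> = "bump_mass TYPE('n)"
  let ?S = "\<lambda>n r m \<omega>. \<Sum>k\<in>index_box (\<lambda>_. 0) (\<lambda>_. 3 * r * 2 ^ n).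
      probe_coeff n m k * cell_increment (dyadic_grid n) (\<lambda>t. X t \<omega>) k"
  define Y where "Y m \<omega> = white_noise (\<lambda>t. X t \<omega>) (probe m) / ?\<kappa>" for m \<omega>
  define A where "A n r K = {\<omega>\<in>space M. \<forall>m<r. \<bar>?S n r m \<omega>\<bar> < K m}" for n r and K :: "nat \<Rightarrow> real"
  obtain c0 :: nat where c0: "\<P>(\<omega> in M. real c0 < \<bar>X (\<chi> i. 1) \<omega>\<bar>) < 1/2"
    using real_tight[OF X_one_measurable, of "1/2"] by auto
  have A_event: "A n r K \<in> events" for n r K
  proof -
    have "(\<lambda>\<omega>. cell_increment (dyadic_grid n) (\<lambda>t. X t \<omega>) k) \<in> borel_measurable M" for k
      unfolding cell_increment_def by (intro increment_measurable dyadic_grid_props)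
    then have "(\<lambda>\<omega>. ?S n r m \<omega>) \<in> borel_measurable M" for m
      by (intro borel_measurable_sum borel_measurable_times borel_measurable_const)
    then have "Measurable.pred M (\<lambda>\<omega>. \<bar>?S n r m \<omega>\<bar> < K m)" for m
      by measurable
    then have "Measurable.pred M (\<lambda>\<omega>. \<forall>m\<in>{..<r}. \<bar>?S n r m \<omega>\<bar> < K m)"
      by (intro pred_intros_finite finite_lessThan)
    then show ?thesis unfolding A_def pred_def Ball_def lessThan_iff .
  qed
  have A_prob: "prob (A n r K) \<le> (\<Prod>m<r. max (1/2) (1 - tail (2 * K m + real c0)))" for n r K
    unfolding A_def by (rule prob_cell_combinations_small[OF c0]) (simp_all add: probe_coeff_core)
  have main: "AE \<omega> in M. lamp (\<lambda>t. X t \<omega>) \<longrightarrow> \<not> (\<forall>m. \<bar>Y m \<omega>\<bar> \<le> real N * (real m + 1) ^ N)" for N :: nat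
  proof -
    define K where "K m = (real N + 1) * (real m + 1) ^ N" for m
    \<comment> \<open>The level \<open>2 K m + c0\<close> of the concentration bound is dominated by \<open>L (m + 1)\<^sup>N\<close>.\<close>
    define L where "L = 2 * (real N + 1) + real c0"
    have L: "0 < L" by (simp add: L_def add_pos_nonneg)
    have KL: "2 * K m + real c0 \<le> L * (real m + 1) ^ N" for m
    proof -
      have "real c0 * 1 \<le> real c0 * (real m + 1) ^ N" by (intro mult_left_mono one_le_power) simp_all
      then show ?thesis by (simp add: K_def L_def algebra_simps)
    qed
    let ?q = "\<lambda>r. \<Prod>m<r. max (1/2) (1 - tail (L * (real m + 1) ^ N))"
    \<comment> \<open>The lower limit of the approximating events. It is measurable by construction, so the argument
      does not depend on the measurability of the pairings themselves.\<close>
    define D where "D r = (\<Union>j. \<Inter>n\<in>{j..}. A n r K)" for r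
    have D_event: "D r \<in> events" for r
      unfolding D_def using A_event by (intro sets.countable_UN sets.countable_INT) auto
    have D_prob: "prob (D r) \<le> ?q r" for r
    proof -
      let ?I = "\<lambda>j. \<Inter>n\<in>{j..}. A n r K"
      have I_event: "?I j \<in> events" for j
        using A_event by (intro sets.countable_INT) auto
      have "prob (?I j) \<le> ?q r" for j
      proof -
        have "prob (?I j) \<le> prob (A j r K)"
          using A_event by (intro finite_measure_mono) auto
        also have "\<dots> \<le> (\<Prod>m<r. max (1/2) (1 - tail (2 * K m + real c0)))" by (rule A_prob)
        also have "\<dots> \<le> ?q r"
        proof (rule prod_mono)
          fix m
          have "max (1/2) (1 - tail (2 * K m + real c0)) \<le> max (1/2) (1 - tail (L * (real m + 1) ^ N))"
            using tail_antimono[OF KL[of m]] by (intro max.mono) simp_all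
          then show "0 \<le> max (1/2) (1 - tail (2 * K m + real c0)) \<and>
              max (1/2) (1 - tail (2 * K m + real c0)) \<le> max (1/2) (1 - tail (L * (real m + 1) ^ N))"
            by (simp add: le_max_iff_disj)
        qed
        finally show ?thesis .
      qed
      moreover have "(\<lambda>j. prob (?I j)) \<longlonglongrightarrow> prob (\<Union>j. ?I j)"
        using I_event by (intro finite_Lim_measure_incseq) (auto simp: incseq_def)
      ultimately show ?thesis unfolding D_def by (intro LIMSEQ_le_const2) blast+
    qed
    have in_D: "\<omega> \<in> D r" if \<omega>: "\<omega> \<in> space M" "lamp (\<lambda>t. X t \<omega>)" "\<And>m. \<bar>Y m \<omega>\<bar> \<le> real N * (real m + 1) ^ N" for \<omega> r
    proof -
      have "eventually (\<lambda>n. \<bar>?S n r m \<omega>\<bar> < K m) sequentially" if "m < r" for m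
      proof (rule order_tendstoD(2)[OF tendsto_rabs])
        show "(\<lambda>n. ?S n r m \<omega>) \<longlonglongrightarrow> Y m \<omega>"
          unfolding Y_def by (rule probe_coeff_sum_tendsto[OF \<omega>(2) that])
        have "real N * (real m + 1) ^ N < K m" unfolding K_def by (intro mult_strict_right_mono) simp_all
        with \<omega>(3)[of m] show "\<bar>Y m \<omega>\<bar> < K m" by linarith
      qed
      then have "eventually (\<lambda>n. \<forall>m\<in>{..<r}. \<bar>?S n r m \<omega>\<bar> < K m) sequentially"
        by (intro eventually_ball_finite) auto
      then have "eventually (\<lambda>n. \<omega> \<in> A n r K) sequentially"
        by (rule eventually_mono) (simp add: A_def \<omega>(1))
      then show ?thesis unfolding D_def eventually_sequentially by blast
    qed
    let ?Z = "\<Inter>r. D r"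
    have Z_event: "?Z \<in> events" using D_event by (intro sets.countable_INT) auto
    have "prob ?Z \<le> 0"
    proof (rule field_le_epsilon)
      fix e :: real assume "0 < e"
      then obtain r where r: "?q r < e"
        using prod_max_half_tendsto_0[OF tail_bounds not_summable_tail[OF inf L], of e N] by blast
      have "prob ?Z \<le> prob (D r)" using D_event by (intro finite_measure_mono) auto
      with D_prob[of r] r show "prob ?Z \<le> 0 + e" by linarith
    qed
    then have "prob ?Z = 0" by (intro antisym measure_nonneg)
    then have "emeasure M ?Z = 0" by (simp only: emeasure_eq_measure ennreal_0)
    with Z_event have "?Z \<in> null_sets M" by blast
    then show ?thesis
      by (rule AE_I') (use in_D in blast)
  qed
  have "AE \<omega> in M. \<forall>N. lamp (\<lambda>t. X t \<omega>) \<longrightarrow> \<not> (\<forall>m. \<bar>Y m \<omega>\<bar> \<le> real N * (real m + 1) ^ N)"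
    unfolding AE_all_countable using main by blast
  with AE_lamp show ?thesis
  proof eventually_elim
    case (elim \<omega>)
    show ?case
    proof
      assume "white_noise (\<lambda>t. X t \<omega>) \<in> tempered_distributions"
      then obtain C p where Cp: "\<And>m. \<bar>white_noise (\<lambda>t. X t \<omega>) (probe m)\<bar> \<le> C * (real m + 1) ^ p"
        using tempered_probe_growth by blast
      obtain N0 :: nat where N0: "C / ?\<kappa> \<le> real N0" using real_arch_simple by blast
      define N where "N = max N0 p"
      have "\<bar>Y m \<omega>\<bar> \<le> real N * (real m + 1) ^ N" for m
      proof -
        have "\<bar>Y m \<omega>\<bar> = \<bar>white_noise (\<lambda>t. X t \<omega>) (probe m)\<bar> / ?\<kappa>"
          using bump_mass_pos[where 'n='n] by (simp add: Y_def)
        also have "\<dots> \<le> (C * (real m + 1) ^ p) / ?\<kappa>"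
          using bump_mass_pos[where 'n='n] by (intro divide_right_mono Cp) simp
        also have "\<dots> = (C / ?\<kappa>) * (real m + 1) ^ p" by simp
        also have "\<dots> \<le> real N * (real m + 1) ^ N"
          using N0 by (intro mult_mono power_increasing) (auto simp: N_def)
        finally show ?thesis .
      qed
      with elim show False by blast
    qed
  qed
qed

text \<open>Polynomial growth holds almost surely, and it implies temperedness path by path.\<close>

lemma AE_tempered:
  assumes "0 < \<eta>" "(\<integral>\<^sup>+ \<omega>. ennreal (\<bar>X (\<chi> i. 1) \<omega>\<bar> powr \<eta>) \<partial>M) < \<infinity>"
  shows "AE \<omega> in M. white_noise (\<lambda>t. X t \<omega>) \<in> tempered_distributions"
  using AE_polynomial_growth[OF assms]
proof eventually_elim
  case (elim \<omega>)
  then obtain C p where growth: "\<And>t. t \<in> orthant \<Longrightarrow> \<bar>X t \<omega>\<bar> \<le> C * (1 + norm t) ^ p" by blast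
  interpret slowly_growing_path "\<lambda>t. X t \<omega>" C p
  proof
    show "(\<lambda>t. indicator orthant t * X t \<omega>) \<in> borel_measurable borel"
      using elim by (intro lamp_path_measurable) blast
    show "\<bar>X t \<omega>\<bar> \<le> C * (1 + norm t) ^ p" if "t \<in> orthant" for t using growth that .
  qed
  show ?case by (rule white_noise_tempered)
qed

end

theorem theorem3p13:
  fixes M :: "'a measure" and X :: "real^'n::finite \<Rightarrow> 'a \<Rightarrow> real"
    and J :: "'a \<Rightarrow> ((real^'n) \<times> real) measure"
    and \<gamma> \<sigma> :: real and \<nu> :: "real measure"
  assumes "complete_measure M" and "levy_field M X"
    and "\<And>\<omega>. \<omega> \<in> space M \<Longrightarrow> J \<omega> = jump_measure (\<lambda>t. X t \<omega>)"
    and "characteristic_triplet M X \<gamma> \<sigma> \<nu>"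
  shows "((\<exists>\<eta>>0. (\<integral>\<^sup>+ \<omega>. ennreal (\<bar>X (\<chi> i. 1) \<omega>\<bar> powr \<eta>) \<partial>M) < \<infinity>) \<longrightarrow>
            tempered_event M X \<in> sets M \<and> measure M (tempered_event M X) = 1) \<and>
         ((\<forall>\<eta>>0. (\<integral>\<^sup>+ \<omega>. ennreal (\<bar>X (\<chi> i. 1) \<omega>\<bar> powr \<eta>) \<partial>M) = \<infinity>) \<longrightarrow>
            tempered_event M X \<in> sets M \<and> measure M (tempered_event M X) = 0)"
proof -
  interpret complete_measure M by (rule assms(1))
  interpret levy_field M X by (rule assms(2))
  let ?T = "tempered_event M X"
  \<comment> \<open>By completeness, exceptional sets are measurable as soon as they are almost surely avoided.\<close>
  have null: "S \<in> null_sets M" if S: "S \<subseteq> space M" and ae: "AE \<omega> in M. \<omega> \<notin> S" for S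
  proof -
    obtain Z where Z: "Z \<in> null_sets M" "S \<subseteq> Z"
      using AE_E[OF ae] S by (smt (verit, best) mem_Collect_eq null_setsI subset_eq)
    then have "S \<in> sets M" using complete by blast
    with Z show ?thesis using null_sets_subset by blast
  qed
  have sub: "?T \<subseteq> space M" by (auto simp: tempered_event_def)
  show ?thesis
  proof (intro conjI[of "_ \<longrightarrow> _"] impI)
    assume "\<exists>\<eta>>0. (\<integral>\<^sup>+ \<omega>. ennreal (\<bar>X (\<chi> i. 1) \<omega>\<bar> powr \<eta>) \<partial>M) < \<infinity>"
    then have "AE \<omega> in M. white_noise (\<lambda>t. X t \<omega>) \<in> tempered_distributions"
      using AE_tempered by blast
    then have ae: "AE \<omega> in M. \<omega> \<notin> space M - ?T"
      by eventually_elim (simp add: tempered_event_def)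
    have N: "space M - ?T \<in> null_sets M" by (rule null[OF Diff_subset ae])
    have T: "?T = space M - (space M - ?T)" using sub by blast
    have "?T \<in> sets M" using N by (subst T) auto
    moreover have "prob ?T = 1"
      using N by (subst T, subst prob_compl) (auto simp: measure_eq_0_null_sets)
    ultimately show "?T \<in> sets M \<and> prob ?T = 1" by blast
  next
    assume "\<forall>\<eta>>0. (\<integral>\<^sup>+ \<omega>. ennreal (\<bar>X (\<chi> i. 1) \<omega>\<bar> powr \<eta>) \<partial>M) = \<infinity>"
    then have "AE \<omega> in M. white_noise (\<lambda>t. X t \<omega>) \<notin> tempered_distributions"
      by (intro AE_not_tempered) blast
    then have "AE \<omega> in M. \<omega> \<notin> ?T"
      by eventually_elim (simp add: tempered_event_def)
    then have "?T \<in> null_sets M" by (rule null[OF sub])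
    then show "?T \<in> sets M \<and> prob ?T = 0" by (auto simp: measure_eq_0_null_sets)
  qed
qed

end
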